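(* Let $f^\flat(x)=\sum_{n\ge0}A_n^\flat x^n$ be the entire function attached to the Riemann Xi function, let $B_y(f^\flat)(x)=\sum_{n\ge0}A_n^\flat x^ny^{n(n+1)/2}$, and let $$\Theta=\sup\{y\in[0,+\infty)\;:\; B_y(f^\flat)\text{ is an entire function and has only real zeros}\}.$$ If $0\le y\le\Theta$, then $B_y(f^\flat)$ is $L_1$ and thus has only negative zeros; furthermore, the zeros are simple if $0\le y<\Theta$. In particular, the Riemann hypothesis implies that the zeros of $B_y(f^\flat)$ are simple for all $y\in(0,1)$.
   Context: The Riemann Xi function is $\Xi(z)=\tfrac12 s(s-1)\pi^{-s/2}\Gamma(s/2)\zeta(s)$ with $s=\tfrac12+iz$. It is entire, and $\Xi(z)=\sum_{n\ge0}(-1)^nA_n^\flat z^{2n}$ with all $A_n^\flat>0$; put $f^\flat(x)=\Xi(-i\sqrt{x})=\sum_{n\ge0}A_n^\flat x^n$, an entire function. The Riemann hypothesis is the assertion that all zeros of $\Xi$ are real. An entire function $f$ is called $L_1$ (first type of Laguerre) if it can be written $f(x)=Cx^me^{\sigma x}\prod_{p\ge1}(1+a_px)$ with $C,\sigma,a_p\ge0$, $m\in\mathbb{N}$ (including $0$), and $\sum_{p\ge1}a_p<+\infty$ (finite products allowed). For $y=0$ the convention is $B_0(f)(x)=A_0$. *)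

theory Defs
  imports "HOL-Complex_Analysis.Complex_Analysis"
begin

text \<open>
  The Riemann zeta function, by analytic continuation. The value at the pole is irrelevant
  below; it is fixed to \<open>0\<close> only so that the description is unique.
\<close>
definition zeta :: "complex \<Rightarrow> complex" where
  "zeta = (THE f. f holomorphic_on - {1} \<and>
                  (\<forall>s. Re s > 1 \<longrightarrow> (\<lambda>n. of_nat (Suc n) powr (- s)) sums f s) \<and>
                  f 1 = 0)"

text \<open>
  The product formula has removable singularities at \<open>s = 1\<close> and at \<open>s = 0, -2, -4, \<dots>\<close>, where
  it must not be evaluated literally (there \<^const>\<open>Gamma\<close> resp. \<open>zeta\<close> has a junk value).
\<close>
definition Xi :: "complex \<Rightarrow> complex" where
  "Xi = remove_sings (\<lambda>z. let s = 1 / 2 + \<i> * z in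
          1 / 2 * s * (s - 1) * of_real pi powr (- s / 2) * Gamma (s / 2) * zeta s)"

definition riemann_hypothesis :: bool where
  "riemann_hypothesis \<longleftrightarrow> (\<forall>z. Xi z = 0 \<longrightarrow> z \<in> \<real>)"

text \<open>Since \<^const>\<open>Xi\<close> is even, the choice of the branch of the square root is immaterial.\<close>
definition f_flat :: "complex \<Rightarrow> complex" where
  "f_flat x = Xi (- \<i> * csqrt x)"

text \<open>
  \<open>B y f\<close> is a formal power series, because for \<open>y > 1\<close> it may fail to converge; being an
  entire function means that its radius of convergence is infinite, in which case the
  function is \<^term>\<open>eval_fps (B y f)\<close>. As \<open>0 ^ 0 = 1\<close>, \<open>B 0 f\<close> is the constant \<open>f 0\<close>.
\<close>
definition B :: "real \<Rightarrow> (complex \<Rightarrow> complex) \<Rightarrow> complex fps" where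
  "B y f = Abs_fps (\<lambda>n. fps_nth (fps_expansion f 0) n * of_real y ^ (n * (n + 1) div 2))"

definition entire_fps :: "complex fps \<Rightarrow> bool" where
  "entire_fps F \<longleftrightarrow> fps_conv_radius F = \<infinity>"

text \<open>Laguerre functions of the first type; finite products are those with almost all \<open>a p = 0\<close>.\<close>
definition L1 :: "(complex \<Rightarrow> complex) \<Rightarrow> bool" where
  "L1 f \<longleftrightarrow> (\<exists>(C::real) (\<sigma>::real) (m::nat) (a::nat \<Rightarrow> real).
     C \<ge> 0 \<and> \<sigma> \<ge> 0 \<and> (\<forall>p. a p \<ge> 0) \<and> summable a \<and>
     (\<forall>x. f x = of_real C * x ^ m * exp (of_real \<sigma> * x) * (\<Prod>p. 1 + of_real (a p) * x)))"

definition only_real_zeros :: "(complex \<Rightarrow> complex) \<Rightarrow> bool" where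
  "only_real_zeros f \<longleftrightarrow> (\<forall>z. f z = 0 \<longrightarrow> z \<in> \<real>)"

definition only_negative_zeros :: "(complex \<Rightarrow> complex) \<Rightarrow> bool" where
  "only_negative_zeros f \<longleftrightarrow> (\<forall>z. f z = 0 \<longrightarrow> z \<in> \<real> \<and> Re z < 0)"

definition only_simple_zeros :: "(complex \<Rightarrow> complex) \<Rightarrow> bool" where
  "only_simple_zeros f \<longleftrightarrow> (\<forall>z. f z = 0 \<longrightarrow> zorder f z = 1)"

text \<open>Taken in the extended reals, so that no boundedness of the set is presupposed.\<close>
definition Theta :: ereal where
  "Theta = (SUP y \<in> {y::real. y \<ge> 0 \<and> entire_fps (B y f_flat) \<and>
                              only_real_zeros (eval_fps (B y f_flat))}. ereal y)"

end

theory Submission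
  imports Defs "HOL-Real_Asymp.Real_Asymp"
begin

text \<open>
  Write \<open>F\<^sub>y\<close> for the normalisation of \<open>B\<^sub>y f\<close> with value \<open>1\<close> at \<open>0\<close>. Riemann's integral gives
  \<open>f (w\<^sup>2) = \<integral> K (x) cosh (w ln x / 2) dx\<close> over \<open>[1, \<infinity>)\<close> with a positive, rapidly decreasing kernel, so the
  coefficients of \<open>f\<close> are positive and \<open>f\<close> has order less than one. The coefficients do not decay fast
  enough for \<open>F\<^sub>y\<close> to be entire when \<open>y > 1\<close>. Hence, if \<open>F\<^sub>y\<close> is entire with real zeros, it has order
  less than one and negative zeros, and is a genus zero product by Hadamard's argument.

  For \<open>0 < q < 1\<close> the identity \<open>B\<^sub>q ((1 + a x) p) (x) = B\<^sub>q p (x) + a q x B\<^sub>q p (q x)\<close> and the intermediate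
  value theorem show inductively that \<open>B\<^sub>q\<close> maps a product of factors \<open>1 + a x\<close> to one whose consecutive
  zeros have ratio at least \<open>1 / q\<close>. This separation, which implies simplicity, survives coefficientwise
  limits of Laguerre functions, as does the Laguerre class itself. Apply it to \<open>F\<^sub>y = B\<^sub>q F\<^sub>y'\<close> with
  \<open>q = y / y'\<close> for \<open>y < y'\<close>, and let \<open>y\<close> tend to \<open>\<Theta>\<close>.
\<close>

section \<open>Separation of zeros under the multiplier \<open>q ^ (n (n + 1) / 2)\<close>\<close>

text \<open>Simple zeros can merge in a limit, whereas a lower bound \<open>1 / q > 1\<close> on the
  ratio of consecutive zeros persists. So the induction on polynomials and the limits carry the
  ratio, and simplicity is read off only at the end. As \<open>zeta\<close> is specified by a
  description, a continuation has to be exhibited. It is found backwards: the cosh moments of the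
  kernel define an entire series in \<open>(s - 1 / 2)^2\<close>; this series equals the completed
  product for real \<open>s > 1\<close>, and dividing by the other factors produces zeta. The
  functional equation enters as the symmetry of the kernel under inversion, that is, as the
  transformation law of the theta series. The order of \<open>f\<close> is 1/2, and the exponent 3/4
  in the growth bounds is a convenient number between this and 1. Its being less than 1 makes the
  reciprocals of the zeros summable and excludes an exponential factor.\<close>

lemma sgn_prod_linear:
  fixes b :: "nat \<Rightarrow> real"
  assumes "k \<le> d" "\<And>i. i < k \<Longrightarrow> b i * t > 1" "\<And>i. k \<le> i \<Longrightarrow> i < d \<Longrightarrow> b i * t < 1"
  shows "(-1) ^ k * (\<Prod>i<d. 1 - b i * t) > 0"
proof -
  have eq: "{..<d} = {..<k} \<union> {k..<d}" using assms(1) by auto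
  have "(\<Prod>i<d. 1 - b i * t) = (\<Prod>i<k. 1 - b i * t) * (\<Prod>i\<in>{k..<d}. 1 - b i * t)"
    unfolding eq by (rule prod.union_disjoint) auto
  also have "(\<Prod>i<k. 1 - b i * t) = (\<Prod>i<k. (-1) * (b i * t - 1))" by (intro prod.cong) auto
  also have "\<dots> = (-1) ^ k * (\<Prod>i<k. b i * t - 1)" by (subst prod.distrib) simp
  finally have "(-1) ^ k * (\<Prod>i<d. 1 - b i * t) = (\<Prod>i<k. b i * t - 1) * (\<Prod>i\<in>{k..<d}. 1 - b i * t)"
    by (simp add: mult_ac flip: power_add mult_2)
  moreover have "(\<Prod>i<k. b i * t - 1) > 0" using assms(2) by (intro prod_pos) auto
  moreover have "(\<Prod>i\<in>{k..<d}. 1 - b i * t) > 0" using assms(3) by (intro prod_pos) auto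
  ultimately show ?thesis by simp
qed

lemma q_separated_less:
  fixes b :: "nat \<Rightarrow> real"
  assumes "0 < q" "q < 1" "\<And>i. i < d \<Longrightarrow> b i > 0" "\<And>i. Suc i < d \<Longrightarrow> b (Suc i) < q * b i"
    and "j < k" "k < d"
  shows "b k < q * b j"
  using assms(5,6)
proof (induction k rule: less_induct)
  case (less k)
  then obtain m where m: "k = Suc m" by (cases k) auto
  show ?case
  proof (cases "j = m")
    case True then show ?thesis using assms(4) less.prems m by auto
  next
    case False
    then have "b m < q * b j" using less m by auto
    moreover have "b k < q * b m" using assms(4) less.prems m by auto
    moreover have "q * b m < 1 * b m" using assms(2,3) less.prems m by (intro mult_strict_right_mono) auto
    ultimately show ?thesis by linarith
  qed
qed

text \<open>In the variable \<open>t = - x\<close> the first term vanishes at the points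
  \<open>1 / b i\<close> and the second at \<open>1 / (q * b i)\<close>; by the separation these
  alternate. At either end of the gap from \<open>1 / (q * b (i - 1))\<close> to
  \<open>1 / b i\<close> only one term survives, and the signs there are opposite, so the gap
  contains a zero. Each right end is \<open>q\<close> times the left end of the next gap, which is
  the separation of the new zeros.\<close>

lemma q_shift_roots:
  fixes b :: "nat \<Rightarrow> real" and q a :: real
  assumes q: "0 < q" "q < 1" and a: "a > 0"
    and pos: "\<And>i. i < d \<Longrightarrow> b i > 0" and sep: "\<And>i. Suc i < d \<Longrightarrow> b (Suc i) < q * b i"
  defines "g \<equiv> \<lambda>t. \<Prod>i<d. 1 - b i * t"
  obtains y where "\<And>i. i \<le> d \<Longrightarrow> y i > 0" "\<And>i. i < d \<Longrightarrow> y i < q * y (Suc i)"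
    "\<And>i. i \<le> d \<Longrightarrow> g (y i) - a * q * y i * g (q * y i) = 0"
proof -
  define h where "h = (\<lambda>t. g t - a * q * t * g (q * t))"
  have sp: "b k < q * b j" if "j < k" "k < d" for j k
    using q_separated_less[of q d b j k] q pos sep that by auto
  have sp': "b k \<le> b j" if "j \<le> k" "k < d" for j k
  proof (cases "j = k")
    case False
    then have "b k < q * b j" using sp[of j k] that by auto
    also have "\<dots> \<le> 1 * b j" using q pos[of j] that by (intro mult_right_mono) auto
    finally show ?thesis by simp
  qed auto
  have cont: "continuous_on A h" for A
    unfolding h_def g_def by (intro continuous_intros)
  have g0: "g (1 / b i) = 0" if "i < d" for i
    unfolding g_def using that pos[of i] by (auto intro!: prod_zero)
  \<comment> \<open>The first gap starts at 0, where \<open>h\<close> has the value 1.\<close>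
  define lo where "lo = (\<lambda>i. if i = 0 then 0 else 1 / (q * b (i - 1)))"
  have lo: "(-1) ^ i * h (lo i) > 0" if "i \<le> d" for i
  proof (cases "i = 0")
    case True then show ?thesis by (simp add: lo_def h_def g_def)
  next
    case False
    then have i: "i - 1 < d" using that by auto
    have "q * lo i = 1 / b (i - 1)" using False q by (simp add: lo_def)
    then have "h (lo i) = g (lo i)" using g0[OF i] by (simp add: h_def)
    moreover have "(-1) ^ i * g (lo i) > 0" unfolding g_def
    proof (rule sgn_prod_linear)
      fix j assume "j < i"
      then have "b (i - 1) \<le> b j" using i by (intro sp') auto
      moreover have "q * b (i-1) < 1 * b (i-1)" using q pos[OF i] by (intro mult_strict_right_mono) auto
      ultimately have "q * b (i - 1) < b j" by auto
      then show "b j * lo i > 1" using False q pos[OF i] by (simp add: lo_def field_simps)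
    next
      fix j assume "i \<le> j" "j < d"
      then have "b j < q * b (i - 1)" using False by (intro sp) auto
      then show "b j * lo i < 1" using False q pos[OF i] by (simp add: lo_def field_simps)
    qed fact
    ultimately show ?thesis by simp
  qed
  \<comment> \<open>No zero of \<open>g\<close> closes the last gap. The first summand of
    \<open>T\<close> makes each \<open>b j * (q * T)\<close> at least 2, so that
    \<open>b j * T - 1\<close> is at most \<open>2 / q\<close> times
    \<open>b j * (q * T) - 1\<close>; the second makes \<open>a * q * T\<close> exceed the product
    \<open>(2 / q) ^ d\<close> of these losses. Hence the shifted term wins at
    \<open>T\<close>.\<close>
  define T where "T = 2 / q * (\<Sum>i<d. 1 / b i) + (2 / q) ^ d / (a * q) + 1"
  have T1: "b j * (q * T) \<ge> 2" if "j < d" for j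
  proof -
    have "1 / b j \<le> (\<Sum>i<d. 1 / b i)" using that pos by (intro member_le_sum) (auto simp: less_imp_le)
    then have "2 / q * (1 / b j) \<le> 2 / q * (\<Sum>i<d. 1 / b i)" using q by (intro mult_left_mono) auto
    also have "\<dots> \<le> T" using q a unfolding T_def by (auto simp: less_imp_le)
    finally show ?thesis using q pos[OF that] by (simp add: field_simps)
  qed
  have T2: "a * q * T > (2 / q) ^ d"
  proof -
    have "(\<Sum>i<d. 1 / b i) \<ge> 0" using pos by (intro sum_nonneg) (auto simp: less_imp_le)
    then have "2 / q * (\<Sum>i<d. 1 / b i) \<ge> 0" using q by auto
    then have "T > (2 / q) ^ d / (a * q)" by (simp add: T_def)
    then show ?thesis using q a by (simp add: field_simps)
  qed
  have Tpos: "T > 0" using T2 q a by (smt (verit) mult_nonneg_nonpos mult_pos_pos zero_less_divide_iff zero_less_power)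
  have hT: "(-1) ^ d * h T < 0"
  proof -
    have e1: "(-1) ^ d * g t = (\<Prod>i<d. b i * t - 1)" for t
      proof -
      have "(\<Prod>i<d. b i * t - 1) = (\<Prod>i<d. (-1) * (1 - b i * t))" by (intro prod.cong) auto
      then show ?thesis unfolding g_def by (simp only: prod.distrib) simp
    qed
    have "(\<Prod>i<d. b i * T - 1) \<le> (\<Prod>i<d. 2 / q * (b i * (q * T) - 1))"
    proof (intro prod_mono conjI)
      fix i assume "i \<in> {..<d}"
      then have i: "i < d" by auto
      have "b i * (q * T) \<le> b i * (1 * T)" using pos[OF i] Tpos q by (intro mult_left_mono mult_right_mono) auto
      then show "0 \<le> b i * T - 1" using T1[OF i] by simp
      have "q * (b i * T - 1) \<le> 2 * (b i * (q * T) - 1)" using T1[OF i] q by (simp add: algebra_simps)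
      then show "b i * T - 1 \<le> 2 / q * (b i * (q * T) - 1)" using q by (simp add: field_simps)
    qed
    also have "\<dots> = (2 / q) ^ d * (\<Prod>i<d. b i * (q * T) - 1)" by (simp only: prod.distrib) simp
    also have "\<dots> < a * q * T * (\<Prod>i<d. b i * (q * T) - 1)"
      using T1 by (intro mult_strict_right_mono T2 prod_pos) (force)
    finally have "(-1) ^ d * g T < a * q * T * ((-1) ^ d * g (q * T))" by (simp only: e1)
    then show ?thesis by (simp add: h_def right_diff_distrib mult_ac)
  qed
  define hi where "hi = (\<lambda>i. if i < d then 1 / b i else T)"
  have hi: "(-1) ^ i * h (hi i) < 0" if "i \<le> d" for i
  proof (cases "i = d")
    case True then show ?thesis using hT by (simp add: hi_def)
  next
    case False
    then have i: "i < d" using that by auto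
    have "h (hi i) = - (a * q * hi i * g (q * hi i))" using g0[OF i] i by (simp add: h_def hi_def)
    moreover have "(-1) ^ i * g (q * hi i) > 0" unfolding g_def
    proof (rule sgn_prod_linear)
      fix j assume "j < i"
      then have "b i < q * b j" using i by (intro sp) auto
      then show "b j * (q * hi i) > 1" using i pos[OF i] by (simp add: hi_def field_simps)
    next
      fix j assume j: "i \<le> j" "j < d"
      have "q * b j < 1 * b j" using q pos j by (intro mult_strict_right_mono) auto
      also have "\<dots> \<le> b i" using j sp' by auto
      finally show "b j * (q * hi i) < 1" using i pos[OF i] by (simp add: hi_def field_simps)
    qed fact
    moreover have "hi i > 0" using pos i by (simp add: hi_def)
    ultimately show ?thesis using q a
      by (simp add: mult.left_commute[of "(-1)^i"])
  qed
  have lohi: "lo i < hi i" if "i \<le> d" for i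
  proof (cases "i = 0")
    case True then show ?thesis using pos Tpos by (simp add: lo_def hi_def)
  next
    case False
    then have i: "i - 1 < d" using that by auto
    show ?thesis
    proof (cases "i = d")
      case True
      then show ?thesis using T1[OF i] False pos[OF i] q i by (simp add: lo_def hi_def field_simps)
    next
      case F: False
      have "b i < q * b (i - 1)" using False F that by (intro sp) auto
      then show ?thesis using False F that pos[OF i] pos[of i] q by (simp add: lo_def hi_def field_simps)
    qed
  qed
  have "\<exists>y. lo i < y \<and> y < hi i \<and> h y = 0" if "i \<le> d" for i
  proof -
    have "\<exists>y\<ge>lo i. y \<le> hi i \<and> (-1) ^ i * h y = 0"
      using lo[OF that] hi[OF that] lohi[OF that]
      by (intro IVT2') (auto intro!: continuous_intros cont)
    then obtain y where y: "lo i \<le> y" "y \<le> hi i" "h y = 0" by auto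
    moreover have "y \<noteq> lo i" "y \<noteq> hi i" using lo[OF that] hi[OF that] y by auto
    ultimately show ?thesis by (intro exI[of _ y]) auto
  qed
  then obtain y where y: "\<And>i. i \<le> d \<Longrightarrow> lo i < y i \<and> y i < hi i \<and> h (y i) = 0" by metis
  have lo0: "lo i \<ge> 0" if "i \<le> d" for i
    using pos[of "i - 1"] q that by (auto simp: lo_def less_imp_le)
  show ?thesis
  proof (rule that[of y])
    show "y i > 0" if "i \<le> d" for i using lo0[OF that] y[OF that] by linarith
    show "g (y i) - a * q * y i * g (q * y i) = 0" if "i \<le> d" for i using y[OF that] by (simp add: h_def)
    show "y i < q * y (Suc i)" if "i < d" for i
    proof -
      have "y i < hi i" using y[of i] that by auto
      also have "\<dots> = q * lo (Suc i)" using that q by (simp add: hi_def lo_def)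
      also have "\<dots> < q * y (Suc i)" using y[of "Suc i"] that q by auto
      finally show ?thesis .
    qed
  qed
qed

section \<open>The multiplier on polynomials with positive linear factors\<close>

definition q_poly :: "real \<Rightarrow> real poly \<Rightarrow> real poly" where
  "q_poly q p = Abs_poly (\<lambda>n. coeff p n * q ^ (n * (n + 1) div 2))"

lemma coeff_q_poly [simp]: "coeff (q_poly q p) n = coeff p n * q ^ (n * (n + 1) div 2)"
  unfolding q_poly_def
  by (subst coeff_Abs_poly[where n = "degree p"]) (auto simp: coeff_eq_0)

lemma triangle_Suc: "Suc m * (Suc m + 1) div 2 = m * (m + 1) div 2 + Suc m"
proof -
  have "Suc m * (Suc m + 1) = m * (m + 1) + Suc m * 2" by simp
  then show ?thesis by (simp del: mult_Suc mult_Suc_right)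
qed

text \<open>Passing from index \<open>m\<close> to \<open>Suc m\<close> raises the triangular
  exponent by \<open>Suc m\<close>: the part \<open>q ^ m\<close> amounts to substituting
  \<open>q x\<close> for \<open>x\<close>, and one factor \<open>q\<close> remains.\<close>

lemma q_poly_linear_mult:
  "q_poly q ([:1, a:] * p) = q_poly q p + smult (a * q) (pCons 0 (q_poly q p \<circ>\<^sub>p [:0, q:]))"
proof (rule poly_eqI)
  fix n
  show "coeff (q_poly q ([:1, a:] * p)) n =
        coeff (q_poly q p + smult (a * q) (pCons 0 (q_poly q p \<circ>\<^sub>p [:0, q:]))) n"
  proof (cases n)
    case 0 then show ?thesis by simp
  next
    case (Suc m)
    have "coeff (q_poly q p \<circ>\<^sub>p [:0, q:]) m = coeff (q_poly q p) m * q ^ m"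
      by (simp add: coeff_pcompose_linear mult.commute)
    moreover have "q ^ (Suc m * (Suc m + 1) div 2) = q ^ (m * (m + 1) div 2) * (q * q ^ m)"
      unfolding triangle_Suc power_add by simp
    ultimately show ?thesis unfolding Suc coeff_q_poly coeff_add coeff_smult coeff_pCons_Suc
      by (simp add: coeff_pCons_Suc algebra_simps del: mult_Suc mult_Suc_right add_Suc add_Suc_right Suc_eq_plus1)
  qed
qed

lemma degree_prod_linear: "degree (\<Prod>i<d. [:1, c i:] :: real poly) \<le> d"
proof (induction d)
  case (Suc d)
  have "degree ([:1, c d:]) \<le> 1" by simp
  then show ?case using degree_mult_le[of "\<Prod>i<d. [:1, c i:]" "[:1, c d:]"] Suc by simp
qed simp

text \<open>The given \<open>a i\<close> may coincide: the separation is created by the multiplier,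
  one linear factor at a time, through \<open>q_shift_roots\<close>.\<close>

lemma q_poly_prod_pos:
  fixes a :: "nat \<Rightarrow> real"
  assumes q: "0 < q" "q < 1" and a: "\<And>i. i < d \<Longrightarrow> a i > 0"
  shows "\<exists>b. (\<forall>i<d. b i > 0) \<and> (\<forall>i. Suc i < d \<longrightarrow> b (Suc i) < q * b i) \<and>
             q_poly q (\<Prod>i<d. [:1, a i:]) = (\<Prod>i<d. [:1, b i:])"
  using a
proof (induction d)
  case 0
  have "q_poly q 1 = 1" by (rule poly_eqI) (auto simp: coeff_1 intro: ccontr)
  then show ?case by simp
next
  case (Suc d)
  then obtain b where b: "\<And>i. i < d \<Longrightarrow> b i > 0" "\<And>i. Suc i < d \<Longrightarrow> b (Suc i) < q * b i"
    and eq: "q_poly q (\<Prod>i<d. [:1, a i:]) = (\<Prod>i<d. [:1, b i:])" (is "_ = ?G") by auto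
  have ad: "a d > 0" using Suc.prems by auto
  have pg: "poly ?G (- t) = (\<Prod>i<d. 1 - b i * t)" for t by (simp add: poly_prod mult.commute)
  obtain y where y: "\<And>i. i \<le> d \<Longrightarrow> y i > 0" "\<And>i. i < d \<Longrightarrow> y i < q * y (Suc i)"
    "\<And>i. i \<le> d \<Longrightarrow> (\<Prod>j<d. 1 - b j * y i) - a d * q * y i * (\<Prod>j<d. 1 - b j * (q * y i)) = 0"
    using q_shift_roots[where q = q and a = "a d" and b = b and d = d] q ad b by blast
  define H where "H = ?G + smult (a d * q) (pCons 0 (?G \<circ>\<^sub>p [:0, q:]))"
  have H: "q_poly q (\<Prod>i<Suc d. [:1, a i:]) = H"
    unfolding prod.lessThan_Suc mult.commute[of _ "[:1, a d:]"] q_poly_linear_mult eq H_def ..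
  define c where "c = (\<lambda>i. 1 / y i)"
  have degG: "degree ?G \<le> d" by (rule degree_prod_linear)
  have degH: "degree H \<le> Suc d"
    unfolding H_def
  proof (rule degree_add_le)
    have "degree (?G \<circ>\<^sub>p [:0, q:]) \<le> d" using degG q by (simp add: degree_pcompose)
    then show "degree (smult (a d * q) (pCons 0 (?G \<circ>\<^sub>p [:0, q:]))) \<le> Suc d"
      by (meson degree_pCons_le degree_smult_le le_trans Suc_le_mono)
  qed (use degG in auto)
  have degC: "degree (\<Prod>i<Suc d. [:1, c i:]) \<le> Suc d"
    by (rule degree_prod_linear)
  have inj: "y i < y j" if "i < j" "j \<le> d" for i j
    using that
  proof (induction j)
    case (Suc j)
    have "y j < q * y (Suc j)" using y(2) Suc.prems by auto
    also have "\<dots> < 1 * y (Suc j)" using y(1)[of "Suc j"] Suc.prems q by (intro mult_strict_right_mono) auto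
    finally show ?case using Suc by (cases "i = j") auto
  qed auto
  then have inj: "inj_on y {..d}" by (metis (no_types, lifting) atMost_iff inj_onI less_irrefl linorder_neqE_nat)
  \<comment> \<open>Two polynomials of degree at most \<open>d + 1\<close> agree if they do so at
    \<open>d + 2\<close> points. These are the \<open>d + 1\<close> new zeros, which are distinct by
    the separation, and 0, which fixes the normalisation.\<close>
  define A where "A = insert 0 ((\<lambda>i. - y i) ` {..d})"
  have "card ((\<lambda>i. - y i) ` {..d}) = Suc d"
    using inj by (subst card_image) (auto simp: inj_on_def)
  moreover have "0 \<notin> (\<lambda>i. - y i) ` {..d}" using y(1) by force
  ultimately have cA: "card A = Suc (Suc d)" by (simp add: A_def)
  have "H = (\<Prod>i<Suc d. [:1, c i:])"
  proof (rule poly_eqI_degree[where A = A])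
    fix x assume "x \<in> A"
    then consider "x = 0" | i where "x = - y i" "i \<le> d" by (auto simp: A_def)
    then show "poly H x = poly (\<Prod>i<Suc d. [:1, c i:]) x"
    proof cases
      case 1 then show ?thesis by (simp add: H_def poly_prod)
    next
      case 2
      have "poly H x = 0" using y(3)[OF 2(2)]
        unfolding 2 H_def poly_add poly_smult poly_pCons poly_pcompose pg
        using pg[of "q * y i"] by (simp add: mult_ac)
      moreover have "poly (\<Prod>i<Suc d. [:1, c i:]) x = 0"
        unfolding poly_prod using 2 y(1)[of i] by (intro prod_zero) (auto simp: c_def intro!: bexI[of _ i])
      ultimately show ?thesis by simp
    qed
  qed (use cA degH degC in auto)
  moreover have "c (Suc i) < q * c i" if "Suc i < Suc d" for i
    using y(1)[of i] y(1)[of "Suc i"] y(2)[of i] that by (simp add: c_def field_simps)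
  ultimately show ?case using H y(1) by (intro exI[of _ c]) (auto simp: c_def)
qed

section \<open>Laguerre functions and their limits\<close>

lemma prod_telescope:
  fixes u :: "nat \<Rightarrow> 'a::comm_ring_1"
  shows "(\<Prod>p<n. 1 + u p) = 1 + (\<Sum>p<n. u p * (\<Prod>j<p. 1 + u j))"
  by (induction n) (auto simp: algebra_simps)

lemma norm_prod_le_exp:
  fixes u :: "nat \<Rightarrow> complex"
  assumes "\<And>p. norm (u p) \<le> M p" "summable M"
  shows "norm (\<Prod>p<n. 1 + u p) \<le> exp (suminf M)"
proof -
  have M0: "M p \<ge> 0" for p using assms(1)[of p] norm_ge_zero[of "u p"] by linarith
  have "norm (\<Prod>p<n. 1 + u p) = (\<Prod>p<n. norm (1 + u p))" by (simp add: prod_norm)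
  also have "\<dots> \<le> (\<Prod>p<n. 1 + M p)"
    by (intro prod_mono) (use norm_triangle_ineq[of 1] assms(1) in \<open>smt (verit) norm_ge_zero norm_one\<close>)
  also have "\<dots> \<le> exp (\<Sum>p<n. M p)" by (rule prod_le_exp_sum) (use M0 in auto)
  also have "\<dots> \<le> exp (suminf M)" using assms M0 by (simp add: sum_le_suminf)
  finally show ?thesis .
qed

lemma prod_tendsto_prodinf:
  fixes u :: "nat \<Rightarrow> complex"
  assumes "summable (\<lambda>p. norm (u p))"
  shows "(\<lambda>n. \<Prod>p<n. 1 + u p) \<longlonglongrightarrow> (\<Prod>p. 1 + u p)"
proof -
  have "convergent_prod (\<lambda>p. 1 + u p)"
    by (intro abs_convergent_prod_imp_convergent_prod summable_imp_abs_convergent_prod) (use assms in simp)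
  then have "(\<lambda>n. \<Prod>p\<le>n. 1 + u p) \<longlonglongrightarrow> (\<Prod>p. 1 + u p)"
    by (rule convergent_prod_LIMSEQ)
  then have "(\<lambda>n. \<Prod>p<Suc n. 1 + u p) \<longlonglongrightarrow> (\<Prod>p. 1 + u p)"
    by (simp only: lessThan_Suc_atMost)
  then show ?thesis by (subst (asm) filterlim_sequentially_Suc)
qed

lemma norm_prodinf_le_exp:
  fixes u :: "nat \<Rightarrow> complex"
  assumes "\<And>p. norm (u p) \<le> M p" "summable M"
  shows "norm (\<Prod>p. 1 + u p) \<le> exp (suminf M)"
proof (rule Lim_bounded)
  show "(\<lambda>n. norm (\<Prod>p<n. 1 + u p)) \<longlonglongrightarrow> norm (\<Prod>p. 1 + u p)"
    using assms by (intro tendsto_norm prod_tendsto_prodinf) (auto intro: summable_comparison_test')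
qed (use norm_prod_le_exp[OF assms] in auto)

lemma prodinf_eq_suminf:
  fixes u :: "nat \<Rightarrow> complex"
  assumes "summable (\<lambda>p. norm (u p))"
  shows "(\<lambda>p. u p * (\<Prod>j<p. 1 + u j)) sums ((\<Prod>p. 1 + u p) - 1)"
proof -
  have "(\<lambda>n. (\<Prod>p<n. 1 + u p) - 1) \<longlonglongrightarrow> (\<Prod>p. 1 + u p) - 1"
    by (intro tendsto_intros prod_tendsto_prodinf assms)
  moreover have "(\<Prod>p<n. 1 + u p) - 1 = (\<Sum>p<n. u p * (\<Prod>j<p. 1 + u j))" for n
    by (subst prod_telescope) simp
  ultimately show ?thesis by (simp only: sums_def)
qed

text \<open>The telescoping form of a product turns Tannery's theorem for series into one for products.\<close>
lemma tendsto_prodinf: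
  fixes u :: "'b \<Rightarrow> nat \<Rightarrow> complex"
  assumes lim: "\<And>p. ((\<lambda>k. u k p) \<longlongrightarrow> v p) F"
    and bound: "\<And>k p. norm (u k p) \<le> M p" and M: "summable M"
  shows "((\<lambda>k. \<Prod>p. 1 + u k p) \<longlongrightarrow> (\<Prod>p. 1 + v p)) F"
proof (cases "F = bot")
  case False
  have vM: "norm (v p) \<le> M p" for p
    by (rule tendsto_upperbound[OF tendsto_norm[OF lim] _ False]) (use bound in auto)
  have sm: "summable (\<lambda>p. norm (w p))" if "\<And>p. norm (w p) \<le> M p" for w :: "nat \<Rightarrow> complex"
    using that M by (auto intro: summable_comparison_test')
  let ?a = "\<lambda>p k. u k p * (\<Prod>j<p. 1 + u k j)"
  have "((\<lambda>k. suminf (\<lambda>p. ?a p k)) \<longlongrightarrow> suminf (\<lambda>p. v p * (\<Prod>j<p. 1 + v j))) F"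
  proof (rule tannerys_theorem[THEN conjunct2, THEN conjunct2])
    show "((\<lambda>k. ?a p k) \<longlongrightarrow> v p * (\<Prod>j<p. 1 + v j)) F" for p
      by (intro tendsto_intros lim)
    show "\<forall>\<^sub>F (p, k) in at_top \<times>\<^sub>F F. norm (?a p k) \<le> M p * exp (suminf M)"
    proof (intro always_eventually allI, clarify)
      fix p k show "norm (?a p k) \<le> M p * exp (suminf M)"
        unfolding norm_mult
        by (intro mult_mono norm_prod_le_exp bound M) (use bound[of k p] norm_ge_zero order_trans in blast)+
    qed
    show "summable (\<lambda>p. M p * exp (suminf M))" by (intro summable_mult2 M)
  qed (use False in auto)
  then have "((\<lambda>k. 1 + suminf (\<lambda>p. ?a p k)) \<longlongrightarrow> 1 + suminf (\<lambda>p. v p * (\<Prod>j<p. 1 + v j))) F"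
    by (intro tendsto_intros)
  then show ?thesis
    using prodinf_eq_suminf[OF sm[OF bound]] prodinf_eq_suminf[OF sm[OF vM]]
    by (simp add: sums_iff)
qed auto

lemma fps_nth_cauchy_bound:
  fixes F :: "complex fps"
  assumes "entire_fps F" "R > 0" "\<And>x. norm x = R \<Longrightarrow> norm (eval_fps F x) \<le> M"
  shows "norm (fps_nth F n) \<le> M / R ^ n"
proof -
  have hol: "eval_fps F holomorphic_on UNIV"
    using assms(1) by (intro holomorphic_on_eval_fps) (auto simp: entire_fps_def eball_def)
  have "norm ((deriv ^^ n) (eval_fps F) 0) \<le> fact n * M / R ^ n"
    using hol assms(2,3)
    by (intro Cauchy_inequality holomorphic_on_subset[OF hol] holomorphic_on_imp_continuous_on) auto
  moreover have "fps_nth F n = (deriv ^^ n) (eval_fps F) 0 / fact n"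
    using assms(1) by (intro fps_nth_conv_deriv) (auto simp: entire_fps_def)
  ultimately show ?thesis
    by (simp add: norm_divide divide_le_eq mult_ac)
qed

lemma entire_fpsI:
  assumes "\<And>R. R > 0 \<Longrightarrow> \<exists>C. \<forall>n. norm (fps_nth G n) * R ^ n \<le> C"
  shows "entire_fps G"
proof -
  have "conv_radius (fps_nth G) \<ge> \<infinity>"
  proof (rule conv_radius_geI_ex')
    fix r :: real assume r: "r > 0"
    obtain C where C: "\<And>n. norm (fps_nth G n) * (2 * r) ^ n \<le> C" using assms[of "2 * r"] r by auto
    show "summable (\<lambda>n. fps_nth G n * of_real r ^ n)"
    proof (rule summable_comparison_test'[where g = "\<lambda>n. C * (1/2) ^ n"])
      show "norm (fps_nth G n * of_real r ^ n) \<le> C * (1/2) ^ n" for n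
        using C[of n] r by (simp add: norm_mult norm_power power_mult_distrib field_simps)
    qed (auto intro!: summable_mult summable_geometric)
  qed
  then show ?thesis by (simp add: entire_fps_def fps_conv_radius_def)
qed

text \<open>
  Laguerre functions of the first type with value \<open>1\<close> at \<open>0\<close>, whose zeros \<open>- 1 / a p\<close>, in increasing
  order of modulus, are separated by the factor \<open>1 / q\<close>. For \<open>q = 1\<close> the condition only sorts the zeros.
\<close>
definition q_laguerre :: "real \<Rightarrow> complex fps \<Rightarrow> bool" where
  "q_laguerre q F \<longleftrightarrow> entire_fps F \<and>
    (\<exists>(\<sigma>::real) (a::nat \<Rightarrow> real). \<sigma> \<ge> 0 \<and> (\<forall>p. a p \<ge> 0) \<and> (\<forall>p. a (Suc p) \<le> q * a p) \<and> summable a \<and>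
      (\<forall>x. eval_fps F x = exp (of_real \<sigma> * x) * (\<Prod>p. 1 + of_real (a p) * x)))"

text \<open>The difference quotient of the product at 0 is its telescoped series divided by
  \<open>x\<close>, to which Tannery's theorem applies.\<close>

lemma laguerre_deriv_0:
  fixes a :: "nat \<Rightarrow> real"
  assumes "\<And>p. a p \<ge> 0" "summable a"
  shows "((\<lambda>x::complex. exp (of_real \<sigma> * x) * (\<Prod>p. 1 + of_real (a p) * x))
           has_field_derivative of_real (\<sigma> + suminf a)) (at 0)"
proof -
  have sm: "summable (\<lambda>p. norm (of_real (a p) * x :: complex))" for x
    using assms by (simp add: norm_mult summable_mult2)
  have "((\<lambda>x::complex. \<Prod>p. 1 + of_real (a p) * x) has_field_derivative of_real (suminf a)) (at 0)"
    unfolding has_field_derivative_iff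
  proof (rule Lim_transform_eventually)
    let ?a = "\<lambda>p (x::complex). of_real (a p) * (\<Prod>j<p. 1 + of_real (a j) * x)"
    have ev: "\<forall>\<^sub>F x in at (0::complex). norm x \<le> 1"
      unfolding eventually_at by (rule exI[of _ 1]) auto
    show "((\<lambda>x. suminf (\<lambda>p. ?a p x)) \<longlongrightarrow> of_real (suminf a)) (at 0)"
    proof -
      have "((\<lambda>x. suminf (\<lambda>p. ?a p x)) \<longlongrightarrow> (\<Sum>p. of_real (a p))) (at (0::complex))"
      proof (rule tannerys_theorem[THEN conjunct2, THEN conjunct2])
        show "((\<lambda>x. ?a p x) \<longlongrightarrow> of_real (a p)) (at 0)" for p
        proof -
          have "((\<lambda>x. ?a p x) \<longlongrightarrow> ?a p 0) (at 0)"
            by (intro tendsto_intros)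
          then show ?thesis by simp
        qed
        have "norm (?a p x) \<le> a p * exp (suminf a)" if "norm x \<le> 1" for p x
          unfolding norm_mult
          by (intro mult_mono norm_prod_le_exp assms(2))
             (use that assms(1) in \<open>auto simp: norm_mult mult_left_le\<close>)
        then show "\<forall>\<^sub>F (p, x) in at_top \<times>\<^sub>F at (0::complex). norm (?a p x) \<le> a p * exp (suminf a)"
          unfolding eventually_prod_filter using ev
          by (intro exI[of _ "\<lambda>_. True"] exI[of _ "\<lambda>x. norm x \<le> 1"]) auto
        show "summable (\<lambda>p. a p * exp (suminf a))" by (intro summable_mult2 assms)
      qed auto
      then show ?thesis by (simp add: suminf_of_real assms)
    qed
    show "\<forall>\<^sub>F x in at 0. suminf (\<lambda>p. ?a p x) =
        ((\<Prod>p. 1 + of_real (a p) * x) - (\<Prod>p. 1 + of_real (a p) * 0)) / (x - 0)"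
      using eventually_neq_at_within[of 0 0]
    proof eventually_elim
      case (elim x)
      have "(\<lambda>p. of_real (a p) * x * (\<Prod>j<p. 1 + of_real (a j) * x)) sums ((\<Prod>p. 1 + of_real (a p) * x) - 1)"
        by (rule prodinf_eq_suminf[OF sm])
      then have "(\<lambda>p. of_real (a p) * x * (\<Prod>j<p. 1 + of_real (a j) * x) / x) sums (((\<Prod>p. 1 + of_real (a p) * x) - 1) / x)"
        by (rule sums_divide)
      then show ?case using elim by (simp add: sums_iff)
    qed
  qed
  then show ?thesis
    by (auto intro!: derivative_eq_intros)
qed

text \<open>In a decreasing sequence the first \<open>p + 1\<close> terms are all at least
  \<open>a p\<close>. The resulting decay depends on the sum alone, hence is uniform along a
  sequence of Laguerre functions with bounded sums.\<close>

lemma antimono_bound: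
  fixes a :: "nat \<Rightarrow> real"
  assumes "\<And>p. a p \<ge> 0" "\<And>p. a (Suc p) \<le> a p" "summable a"
  shows "a p \<le> suminf a / (real p + 1)"
proof -
  have "decseq a" using assms(2) by (auto simp: decseq_Suc_iff)
  then have "(\<Sum>j<Suc p. a p) \<le> (\<Sum>j<Suc p. a j)" by (intro sum_mono) (auto simp: decseq_def)
  also have "\<dots> \<le> suminf a" by (rule sum_le_suminf) (use assms in auto)
  finally show ?thesis by (simp add: field_simps)
qed

lemma norm_genus1_factor:
  "norm ((1 + w) * exp (- w) - 1 :: complex) \<le> exp (2 * norm w) * norm w ^ 2"
proof -
  have "(1 + w) * exp (- w) - 1 = - exp (- w) * (exp w - (1 + w))"
    by (simp add: algebra_simps flip: exp_add)
  also have "norm \<dots> \<le> exp (norm w) * (exp (norm w) * norm w ^ 2)"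
  proof -
    have "norm (exp w - (1 + w)) \<le> exp (norm w) * norm w ^ 2"
      using Taylor_exp_field[of w 1] by (simp add: power2_eq_square)
    moreover have "norm (exp (- w)) \<le> exp (norm w)" using norm_exp[of "-w"] by simp
    ultimately show ?thesis by (simp add: norm_mult mult_mono)
  qed
  also have "\<dots> = exp (2 * norm w) * norm w ^ 2"
    by (simp only: mult.assoc[symmetric] exp_add[symmetric] mult_2)
  finally show ?thesis .
qed

lemma summable_const_over_square: "summable (\<lambda>p. C / (real p + 1) ^ 2)"
  using summable_mult[OF sums_summable[OF inverse_squares_sums], of C] by (simp add: add.commute)

lemma summable_Suc_powr: "c > 1 \<Longrightarrow> summable (\<lambda>n. (real n + 1) powr (- c))"
  using summable_real_powr_iff[of "- c"] summable_iff_shift[of "\<lambda>n. real n powr (- c)" 1] by (simp add: add.commute)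

text \<open>In a limit part of the sum of the \<open>a p\<close> may escape to large
  \<open>p\<close>, so the plain factors have no common summable majorant. Once the exponentials are
  moved out, each factor differs from 1 only to second order, and by \<open>antimono_bound\<close> a
  bound on the sum yields a majorant of order \<open>1 / (p + 1)^2\<close>.\<close>

lemma genus1_prodinf:
  fixes a :: "nat \<Rightarrow> real" and x :: complex
  assumes "\<And>p. a p \<ge> 0" "\<And>p. a (Suc p) \<le> a p" "summable a"
  shows "exp (of_real (suminf a) * x) * (\<Prod>p. (1 + of_real (a p) * x) * exp (- (of_real (a p) * x)))
          = (\<Prod>p. 1 + of_real (a p) * x)"
    and "norm ((1 + of_real (a p) * x) * exp (- (of_real (a p) * x)) - 1) \<le>
           exp (2 * (suminf a * norm x)) * (suminf a * norm x)\<^sup>2 / (real p + 1) ^ 2"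
proof -
  let ?S = "suminf a" and ?w = "\<lambda>p. of_real (a p) * x"
  have S0: "?S \<ge> 0" using assms by (intro suminf_nonneg) auto
  show bd: "norm ((1 + ?w p) * exp (- ?w p) - 1) \<le> exp (2 * (?S * norm x)) * (?S * norm x)\<^sup>2 / (real p + 1) ^ 2" for p
  proof -
    have 1: "norm (?w p) \<le> ?S * norm x / (real p + 1)"
      using mult_right_mono[OF antimono_bound[of a p, OF assms] norm_ge_zero[of x]] assms(1)[of p] by (simp add: norm_mult)
    also have "\<dots> \<le> ?S * norm x" using S0 by (simp add: field_simps mult_left_mono)
    finally have 2: "norm (?w p) \<le> ?S * norm x" .
    have "exp (2 * norm (?w p)) * norm (?w p) ^ 2 \<le> exp (2 * (?S * norm x)) * (?S * norm x / (real p + 1)) ^ 2"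
      using 1 2 by (intro mult_mono power_mono) auto
    then show ?thesis using norm_genus1_factor[of "?w p"] by (simp add: power_divide)
  qed
  have "summable (\<lambda>p. norm ((1 + ?w p) * exp (- ?w p) - 1))"
    by (rule summable_comparison_test'[OF summable_const_over_square]) (use bd in auto)
  from prod_tendsto_prodinf[OF this]
  have l1: "(\<lambda>n. \<Prod>p<n. (1 + ?w p) * exp (- ?w p)) \<longlonglongrightarrow> (\<Prod>p. (1 + ?w p) * exp (- ?w p))" by simp
  have l2: "(\<lambda>n. \<Prod>p<n. 1 + ?w p) \<longlonglongrightarrow> (\<Prod>p. 1 + ?w p)"
    using assms by (intro prod_tendsto_prodinf) (simp add: norm_mult summable_mult2)
  have l3: "(\<lambda>n. exp (of_real (\<Sum>p<n. a p) * x)) \<longlonglongrightarrow> exp (of_real ?S * x)"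
    by (intro tendsto_intros summable_LIMSEQ assms)
  have eq: "exp (of_real (\<Sum>p<n. a p) * x) * (\<Prod>p<n. (1 + ?w p) * exp (- ?w p)) = (\<Prod>p<n. 1 + ?w p)" for n
  proof -
    have "(\<Prod>p<n. (1 + ?w p) * exp (- ?w p)) = (\<Prod>p<n. 1 + ?w p) * exp (- (of_real (\<Sum>p<n. a p) * x))"
      unfolding prod.distrib by (simp add: exp_sum[symmetric] sum_negf sum_distrib_right)
    then show ?thesis by (simp add: exp_minus)
  qed
  show "exp (of_real ?S * x) * (\<Prod>p. (1 + ?w p) * exp (- ?w p)) = (\<Prod>p. 1 + ?w p)"
    using tendsto_mult[OF l3 l1] unfolding eq by (rule LIMSEQ_unique[OF _ l2])
qed

text \<open>
  Closure under coefficientwise limits: \<open>\<sigma> + (\<Sum>p. a p)\<close> is the first coefficient and hence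
  converges, a subsequence of the \<open>a\<close> converges pointwise, and the mass lost in the limit of
  \<open>\<Sum>p. a p\<close> goes into the exponential factor.
\<close>
lemma q_laguerre_closed:
  assumes q: "q \<le> 1" and F: "\<And>k. q_laguerre q (F k)"
    and lim: "\<And>n. (\<lambda>k. fps_nth (F k) n) \<longlonglongrightarrow> fps_nth G n"
  shows "q_laguerre q G"
proof -
  have ent: "entire_fps (F k)" for k using F by (auto simp: q_laguerre_def)
  obtain \<sigma> a where sa: "\<And>k. \<sigma> k \<ge> 0" "\<And>k p. a k p \<ge> (0::real)" "\<And>k p. a k (Suc p) \<le> q * a k p"
    "\<And>k. summable (a k)" "\<And>k x. eval_fps (F k) x = exp (of_real (\<sigma> k) * x) * (\<Prod>p. 1 + of_real (a k p) * x)"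
    using F unfolding q_laguerre_def by metis
  have dec: "a k (Suc p) \<le> a k p" for k p
    using sa(3)[of k p] mult_right_mono[OF q sa(2)[of k p]] by simp
  define S where "S = (\<lambda>k. \<sigma> k + suminf (a k))"
  have sa0: "suminf (a k) \<ge> 0" for k using sa by (intro suminf_nonneg) auto
  have S0: "S k \<ge> 0" for k using sa(1)[of k] sa0[of k] by (simp add: S_def)
  have F1: "fps_nth (F k) 1 = of_real (S k)" for k
  proof -
    have "(eval_fps (F k) has_field_derivative fps_nth (F k) 1) (at 0)"
      using has_field_derivative_eval_fps[of 0 "F k" UNIV] ent[of k]
      by (simp add: entire_fps_def eval_fps_at_0)
    moreover have "(eval_fps (F k) has_field_derivative of_real (S k)) (at 0)"
      unfolding sa(5)[abs_def] S_def by (rule laguerre_deriv_0) (use sa in auto)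
    ultimately show ?thesis by (rule DERIV_unique)
  qed
  define s where "s = Re (fps_nth G 1)"
  have Ss: "S \<longlonglongrightarrow> s"
    using tendsto_Re[OF lim[of 1]] unfolding F1 s_def by simp
  then obtain K where K: "K > 0" "\<And>k. S k \<le> K"
    by (metis Bseq_def convergentI convergent_imp_Bseq abs_le_D1 real_norm_def)
  have bd: "norm (eval_fps (F k) x) \<le> exp (K * norm x)" for k x
  proof -
    have "norm (\<Prod>p. 1 + of_real (a k p) * x) \<le> exp (\<Sum>p. a k p * norm x)"
      using sa by (intro norm_prodinf_le_exp) (auto simp: norm_mult intro: summable_mult2)
    moreover have "norm (exp (of_real (\<sigma> k) * x)) \<le> exp (\<sigma> k * norm x)"
      using norm_exp[of "of_real (\<sigma> k) * x"] sa(1)[of k] by (simp add: norm_mult)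
    ultimately have "norm (eval_fps (F k) x) \<le> exp (\<sigma> k * norm x) * exp (\<Sum>p. a k p * norm x)"
      unfolding sa(5) norm_mult by (intro mult_mono) auto
    also have "\<dots> = exp (S k * norm x)"
      using sa(4)[of k] suminf_mult2[of "a k" "norm x"]
      by (simp add: S_def distrib_right exp_add)
    also have "\<dots> \<le> exp (K * norm x)" using K(2)[of k] by (simp add: mult_right_mono)
    finally show ?thesis .
  qed
  have Fn: "norm (fps_nth (F k) n) \<le> exp (K * R) / R ^ n" if "R > 0" for k n R
    by (rule fps_nth_cauchy_bound[OF ent that]) (use bd in auto)
  have Gn: "norm (fps_nth G n) \<le> exp (K * R) / R ^ n" if "R > 0" for n R
    by (rule Lim_bounded[OF tendsto_norm[OF lim]]) (use Fn[OF that] in auto)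
  have entG: "entire_fps G"
    by (rule entire_fpsI) (use Gn in \<open>force simp: field_simps\<close>)
  have Glim: "(\<lambda>k. eval_fps (F k) x) \<longlonglongrightarrow> eval_fps G x" for x
    unfolding eval_fps_def
  proof (rule tannerys_theorem[THEN conjunct2, THEN conjunct2])
    \<comment> \<open>Cauchy's estimate on a radius of more than \<open>2 * norm x\<close> makes the
      terms decay like \<open>(1/2) ^ n\<close>; the summand 1 keeps the radius positive for
      \<open>x = 0\<close>.\<close>
    let ?R = "2 * norm x + 1"
    have R: "?R > 0" using norm_ge_zero[of x] by linarith
    show "(\<lambda>k. fps_nth (F k) n * x ^ n) \<longlonglongrightarrow> fps_nth G n * x ^ n" for n by (intro tendsto_intros lim)
    have "norm (fps_nth (F k) n * x ^ n) \<le> exp (K * ?R) * (1/2) ^ n" for k n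
    proof -
      have "norm (fps_nth (F k) n * x ^ n) \<le> exp (K * ?R) / ?R ^ n * (?R / 2) ^ n"
        unfolding norm_mult norm_power using R by (intro mult_mono Fn power_mono) auto
      also have "\<dots> = exp (K * ?R) * (1/2) ^ n" using R by (simp add: power_divide)
      finally show ?thesis .
    qed
    then show "\<forall>\<^sub>F (n, k) in at_top \<times>\<^sub>F sequentially. norm (fps_nth (F k) n * x ^ n) \<le> exp (K * ?R) * (1/2) ^ n"
      by (intro always_eventually) auto
  qed (auto intro!: summable_mult summable_geometric)
  have aK: "norm (a k p) \<le> K" for k p
    using antimono_bound[of "a k" 0, OF sa(2) dec sa(4)] K(2)[of k] sa(1)[of k] sa(2)[of k p]
      decseqD[of "a k" 0 p] dec by (auto simp: S_def decseq_Suc_iff)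
  obtain r where r: "strict_mono (r::nat\<Rightarrow>nat)" "\<And>p. \<exists>l. (\<lambda>k. a (r k) p) \<longlonglongrightarrow> l"
    using function_convergent_subsequence[of UNIV a K] aK by auto
  then obtain \<alpha> where \<alpha>: "\<And>p. (\<lambda>k. a (r k) p) \<longlonglongrightarrow> \<alpha> p" by metis
  have Ssr: "(\<lambda>k. S (r k)) \<longlonglongrightarrow> s" using LIMSEQ_subseq_LIMSEQ[OF Ss r(1)] by (simp add: o_def)
  have \<alpha>0: "\<alpha> p \<ge> 0" for p by (rule LIMSEQ_le_const[OF \<alpha>]) (use sa in auto)
  have \<alpha>q: "\<alpha> (Suc p) \<le> q * \<alpha> p" for p
    by (rule LIMSEQ_le[OF \<alpha> tendsto_mult_left[OF \<alpha>]]) (use sa in auto)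
  have \<alpha>d: "\<alpha> (Suc p) \<le> \<alpha> p" for p
    by (rule LIMSEQ_le[OF \<alpha> \<alpha>]) (use dec in auto)
  have part: "(\<Sum>p<n. \<alpha> p) \<le> s" for n
  proof (rule LIMSEQ_le[OF tendsto_sum[OF \<alpha>] Ssr], intro exI allI impI)
    show "(\<Sum>p<n. a (r k) p) \<le> S (r k)" for k
      using sum_le_suminf[of "a (r k)" "{..<n}"] sa(1)[of "r k"] sa(2,4) by (force simp: S_def)
  qed
  have sm\<alpha>: "summable \<alpha>" by (rule summableI_nonneg_bounded[OF \<alpha>0 part])
  have le: "suminf \<alpha> \<le> s" by (rule suminf_le_const[OF sm\<alpha> part])
  have main: "eval_fps G x = exp (of_real (s - suminf \<alpha>) * x) * (\<Prod>p. 1 + of_real (\<alpha> p) * x)" for x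
  proof -
    let ?E = "\<lambda>t. (1 + of_real t * x) * exp (- (of_real t * x)) - 1"
    let ?M = "\<lambda>p. exp (2 * (K * norm x)) * (K * norm x)\<^sup>2 / (real p + 1)\<^sup>2"
    have Fr: "eval_fps (F k) x = exp (of_real (S k) * x) * (\<Prod>p. 1 + ?E (a k p))" for k
      unfolding sa(5) genus1_prodinf(1)[OF sa(2) dec sa(4), symmetric]
      by (simp add: S_def distrib_right exp_add)
    have "(\<lambda>k. eval_fps (F (r k)) x) \<longlonglongrightarrow> exp (of_real s * x) * (\<Prod>p. 1 + ?E (\<alpha> p))"
      unfolding Fr
    proof (intro tendsto_mult tendsto_prodinf[where M = ?M])
      show "(\<lambda>k. exp (of_real (S (r k)) * x)) \<longlonglongrightarrow> exp (of_real s * x)" by (intro tendsto_intros Ssr)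
      show "(\<lambda>k. ?E (a (r k) p)) \<longlonglongrightarrow> ?E (\<alpha> p)" for p by (intro tendsto_intros \<alpha>)
      show "norm (?E (a (r k) p)) \<le> ?M p" for k p
      proof (rule order.trans[OF genus1_prodinf(2)[of "a (r k)", OF sa(2) dec sa(4)]])
        have "suminf (a (r k)) \<le> K" using K(2)[of "r k"] sa(1)[of "r k"] by (simp add: S_def)
        then have le: "suminf (a (r k)) * norm x \<le> K * norm x" by (intro mult_right_mono) auto
        have ge: "0 \<le> suminf (a (r k)) * norm x" using sa0[of "r k"] by simp
        have "exp (2 * (suminf (a (r k)) * norm x)) * (suminf (a (r k)) * norm x)\<^sup>2 \<le>
              exp (2 * (K * norm x)) * (K * norm x)\<^sup>2"
        proof (rule mult_mono[OF _ power_mono[OF le ge]])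
          show "exp (2 * (suminf (a (r k)) * norm x)) \<le> exp (2 * (K * norm x))"
            unfolding exp_le_cancel_iff by (rule mult_left_mono[OF le]) simp
        qed simp_all
        then show "exp (2 * (suminf (a (r k)) * norm x)) * (suminf (a (r k)) * norm x)\<^sup>2 / (real p + 1)\<^sup>2 \<le> ?M p"
          by (rule divide_right_mono) auto
      qed
    qed (rule summable_const_over_square)
    moreover have "(\<lambda>k. eval_fps (F (r k)) x) \<longlonglongrightarrow> eval_fps G x"
      using LIMSEQ_subseq_LIMSEQ[OF Glim r(1)] by (simp add: o_def)
    ultimately have "eval_fps G x = exp (of_real s * x) * (\<Prod>p. 1 + ?E (\<alpha> p))" by (rule LIMSEQ_unique[rotated])
    also have "\<dots> = exp (of_real (s - suminf \<alpha>) * x) * (\<Prod>p. 1 + of_real (\<alpha> p) * x)"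
      unfolding genus1_prodinf(1)[OF \<alpha>0 \<alpha>d sm\<alpha>, of x, symmetric]
      by (simp add: mult.assoc[symmetric] exp_add[symmetric] distrib_right[symmetric])
    finally show ?thesis .
  qed
  have "0 \<le> s - suminf \<alpha>" using le by simp
  then show ?thesis unfolding q_laguerre_def using entG \<alpha>0 \<alpha>q sm\<alpha> main by blast
qed

section \<open>From polynomials to infinite products\<close>

lemma uniform_limit_prod_linear:
  fixes a :: "nat \<Rightarrow> real"
  assumes "\<And>p. a p \<ge> 0" "summable a"
  shows "uniform_limit (cball 0 R) (\<lambda>n x::complex. \<Prod>p<n. 1 + of_real (a p) * x)
           (\<lambda>x. \<Prod>p. 1 + of_real (a p) * x) sequentially"
proof -
  let ?u = "\<lambda>p x::complex. of_real (a p) * x * (\<Prod>j<p. 1 + of_real (a j) * x)"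
  have b: "norm (of_real (a p) * x) \<le> a p * \<bar>R\<bar>" if "x \<in> cball 0 R" for p and x :: complex
  proof -
    have "norm x \<le> \<bar>R\<bar>" using that by (simp add: dist_norm)
    then show ?thesis using assms(1)[of p] by (simp add: norm_mult mult_left_mono)
  qed
  have "uniform_limit (cball 0 R) (\<lambda>n x. \<Sum>p<n. ?u p x) (\<lambda>x. \<Sum>p. ?u p x) sequentially"
  proof (rule Weierstrass_m_test)
    show "norm (?u p x) \<le> a p * \<bar>R\<bar> * exp (\<Sum>p. a p * \<bar>R\<bar>)" if "x \<in> cball 0 R" for p x
      unfolding norm_mult[of "of_real (a p) * x"]
      by (intro mult_mono norm_prod_le_exp b[OF that] summable_mult2 assms)
         (use assms(1)[of p] in auto)
    show "summable (\<lambda>p. a p * \<bar>R\<bar> * exp (\<Sum>p. a p * \<bar>R\<bar>))"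
      by (intro summable_mult2 assms)
  qed
  then have "uniform_limit (cball 0 R) (\<lambda>n x. 1 + (\<Sum>p<n. ?u p x)) (\<lambda>x. 1 + (\<Sum>p. ?u p x)) sequentially"
    by (intro uniform_limit_intros)
  moreover have "1 + (\<Sum>p<n. ?u p x) = (\<Prod>p<n. 1 + of_real (a p) * x)" for n x
    by (rule prod_telescope[symmetric])
  moreover have "1 + (\<Sum>p. ?u p x) = (\<Prod>p. 1 + of_real (a p) * x)" for x
  proof -
    have "summable (\<lambda>p. norm (of_real (a p) * x))"
      using assms by (simp add: norm_mult summable_mult2)
    from prodinf_eq_suminf[OF this] show ?thesis by (simp add: sums_iff)
  qed
  ultimately show ?thesis by (simp only:)
qed

lemma holomorphic_prodinf_linear:
  fixes a :: "nat \<Rightarrow> real"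
  assumes "\<And>p. a p \<ge> 0" "summable a"
  shows "(\<lambda>x::complex. \<Prod>p. 1 + of_real (a p) * x) holomorphic_on A"
proof -
  have "(\<lambda>x::complex. \<Prod>p. 1 + of_real (a p) * x) holomorphic_on UNIV"
  proof (rule holomorphic_uniform_sequence[OF open_UNIV])
    show "(\<lambda>x. \<Prod>p<n. 1 + of_real (a p) * x) holomorphic_on UNIV" for n
      by (intro holomorphic_intros)
    fix x :: complex
    have "cball x 1 \<subseteq> cball 0 (norm x + 1)"
      by (metis cball_subset_cball_iff dist_0_norm dist_commute le_less_linear order_refl add.commute)
    then show "\<exists>d>0. cball x d \<subseteq> UNIV \<and> uniform_limit (cball x d) (\<lambda>n x. \<Prod>p<n. 1 + of_real (a p) * x)
        (\<lambda>x. \<Prod>p. 1 + of_real (a p) * x) sequentially"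
      by (intro exI[of _ 1] conjI uniform_limit_on_subset[OF uniform_limit_prod_linear[OF assms]]) auto
  qed
  then show ?thesis by (rule holomorphic_on_subset) auto
qed

text \<open>The multiplier of \<open>B\<close>, applied to a given series. It is multiplicative in
  \<open>q\<close>, so that passing from a member of the set to a smaller parameter is one
  application.\<close>

definition B_fps :: "real \<Rightarrow> complex fps \<Rightarrow> complex fps" where
  "B_fps q F = Abs_fps (\<lambda>n. fps_nth F n * of_real q ^ (n * (n + 1) div 2))"

lemma coeff_prod_of_real:
  fixes c :: "nat \<Rightarrow> real"
  shows
  "coeff (\<Prod>i<d. [:1, of_real (c i):] :: complex poly) n = of_real (coeff (\<Prod>i<d. [:1, c i:]) n)"
proof (induction d arbitrary: n)
  case (Suc d)
  have *: "coeff (p * [:1, s:]) n = coeff p n + (case n of 0 \<Rightarrow> 0 | Suc m \<Rightarrow> coeff p m * s)"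
    for p :: "'a::comm_ring_1 poly" and s
    by (simp add: mult.commute[of p] coeff_pCons split: nat.split)
  show ?case unfolding prod.lessThan_Suc * Suc by (auto split: nat.split)
qed (auto simp: coeff_1)

lemma q_laguerre_q_poly:
  fixes a :: "nat \<Rightarrow> real"
  assumes q: "0 < q" "q < 1" and a: "\<And>p. a p \<ge> 0" "\<And>p. a (Suc p) \<le> a p"
  shows "q_laguerre q (B_fps q (fps_of_poly (\<Prod>i<d. [:1, of_real (a i):])))"
proof -
  \<comment> \<open>Since \<open>a\<close> decreases, its zeros come last; \<open>e\<close> counts
    the positive terms among the first \<open>d\<close>, and the other factors are 1. Padding the
    new sequence with zeros respects the ratio condition.\<close>
  define e where "e = (LEAST e. e = d \<or> a e = 0)"
  have dec: "a j \<le> a i" if "i \<le> j" for i j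
    using decseqD[of a i j] a(2) that by (auto simp: decseq_Suc_iff)
  have e: "e = d \<or> a e = 0" unfolding e_def by (rule LeastI[of _ d]) simp
  have "e \<le> d" unfolding e_def by (rule Least_le) simp
  have pos: "a i > 0" if "i < e" for i
    using not_less_Least[of i "\<lambda>e. e = d \<or> a e = 0"] that a(1)[of i] by (fastforce simp: e_def)
  have z: "a i = 0" if "e \<le> i" "i < d" for i
    using e dec[of e i] a(1)[of i] that by auto
  have "(\<Prod>i<d. [:1, of_real (a i):] :: complex poly) = (\<Prod>i<e. [:1, of_real (a i):])"
    by (rule prod.mono_neutral_right) (use \<open>e \<le> d\<close> z in \<open>auto simp: one_pCons\<close>)
  moreover obtain b where b: "\<And>i. i < e \<Longrightarrow> b i > 0" "\<And>i. Suc i < e \<Longrightarrow> b (Suc i) < q * b i"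
    "q_poly q (\<Prod>i<e. [:1, a i:]) = (\<Prod>i<e. [:1, b i:])"
    using q_poly_prod_pos[where q = q and d = e and a = a] q pos by blast
  have "B_fps q (fps_of_poly (\<Prod>i<e. [:1, of_real (a i):])) = fps_of_poly (\<Prod>i<e. [:1, of_real (b i):])"
    by (rule fps_ext) (simp add: B_fps_def coeff_prod_of_real flip: b(3))
  ultimately have eq: "B_fps q (fps_of_poly (\<Prod>i<d. [:1, of_real (a i):])) = fps_of_poly (\<Prod>i<e. [:1, of_real (b i):])"
    by simp
  define b' where "b' = (\<lambda>i. if i < e then b i else 0)"
  have "(\<Prod>p. 1 + of_real (b' p) * x) = (\<Prod>i<e. 1 + of_real (b i) * x)" for x :: complex
    by (subst prodinf_finite[of "{..<e}"]) (auto simp: b'_def)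
  moreover have "poly (\<Prod>i<e. [:1, of_real (b i):]) x = (\<Prod>i<e. 1 + of_real (b i) * x)" for x :: complex
    by (simp add: poly_prod mult.commute)
  ultimately have ev: "eval_fps (fps_of_poly (\<Prod>i<e. [:1, of_real (b i):])) x = exp (of_real 0 * x) * (\<Prod>p. 1 + of_real (b' p) * x)" for x :: complex
    by simp
  have "b' p \<ge> 0" for p using b(1) by (auto simp: b'_def less_imp_le)
  moreover have "b' (Suc p) \<le> q * b' p" for p using b q by (force simp: b'_def less_imp_le)
  moreover have "summable b'" by (rule summable_finite[of "{..<e}"]) (auto simp: b'_def)
  moreover have "entire_fps (fps_of_poly (\<Prod>i<e. [:1, of_real (b i):]))"
    by (simp add: entire_fps_def)
  ultimately show ?thesis unfolding eq q_laguerre_def using ev by blast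
qed

text \<open>The partial products converge uniformly near 0, hence coefficientwise, and the
  multiplier acts on coefficients. The closure under coefficientwise limits then delivers the
  entireness of the image together with its factorisation.\<close>

lemma q_laguerre_B_fps:
  fixes a :: "nat \<Rightarrow> real"
  assumes q: "0 < q" "q < 1" and a: "\<And>p. a p \<ge> 0" "\<And>p. a (Suc p) \<le> a p" "summable a"
    and F: "entire_fps F" "\<And>x. eval_fps F x = (\<Prod>p. 1 + of_real (a p) * x)"
  shows "q_laguerre q (B_fps q F)"
proof (rule q_laguerre_closed)
  show "q_laguerre q (B_fps q (fps_of_poly (\<Prod>i<N. [:1, of_real (a i):])))" for N
    by (rule q_laguerre_q_poly) (use q a in auto)
  show "q \<le> 1" using q by simp
  fix n
  let ?P = "\<lambda>N. \<Prod>i<N. [:1, of_real (a i):] :: complex poly"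
  have Fn: "fps_nth F n = (deriv ^^ n) (\<lambda>x. \<Prod>p. 1 + of_real (a p) * x) 0 / fact n"
    unfolding F(2)[symmetric] using F(1) by (intro fps_nth_conv_deriv) (simp add: entire_fps_def)
  have Pn: "coeff (?P N) n = (deriv ^^ n) (\<lambda>x. \<Prod>p<N. 1 + of_real (a p) * x) 0 / fact n" for N
  proof -
    have "fps_nth (fps_of_poly (?P N)) n = (deriv ^^ n) (eval_fps (fps_of_poly (?P N))) 0 / fact n"
      by (intro fps_nth_conv_deriv) simp
    moreover have "eval_fps (fps_of_poly (?P N)) = (\<lambda>x. \<Prod>p<N. 1 + of_real (a p) * x)"
      by (simp add: fun_eq_iff poly_prod mult.commute)
    ultimately show ?thesis by simp
  qed
  have "(\<lambda>N. coeff (?P N) n) \<longlonglongrightarrow> fps_nth F n"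
    unfolding Fn Pn
  proof (intro tendsto_divide tendsto_const higher_deriv_complex_uniform_limit[where A = "ball 0 1"])
    show "uniform_limit (ball 0 1) (\<lambda>N x::complex. \<Prod>p<N. 1 + of_real (a p) * x) (\<lambda>x. \<Prod>p. 1 + of_real (a p) * x) sequentially"
      by (rule uniform_limit_on_subset[OF uniform_limit_prod_linear[OF a(1,3), of 1]]) auto
  qed (auto intro!: always_eventually holomorphic_intros)
  then show "(\<lambda>N. fps_nth (B_fps q (fps_of_poly (?P N))) n) \<longlonglongrightarrow> fps_nth (B_fps q F) n"
    unfolding B_fps_def by (simp add: tendsto_mult_right)
qed

section \<open>Position and order of the zeros of Laguerre functions\<close>

lemma prodinf_linear_eq_0D:
  fixes a :: "nat \<Rightarrow> real"
  assumes "\<And>p. a p \<ge> 0" "summable a" "(\<Prod>p. 1 + of_real (a p) * x) = (0::complex)"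
  obtains p where "a p > 0" "x = - 1 / of_real (a p)"
proof -
  have "abs_convergent_prod (\<lambda>p. 1 + of_real (a p) * x)"
    by (intro summable_imp_abs_convergent_prod) (use assms in \<open>simp add: norm_mult summable_mult2\<close>)
  then have "convergent_prod (\<lambda>p. 1 + of_real (a p) * x)" by (rule abs_convergent_prod_imp_convergent_prod)
  then have "\<exists>p. 1 + of_real (a p) * x = 0" using prodinf_nonzero[of "\<lambda>p. 1 + of_real (a p) * x"] assms(3) by blast
  then obtain p where p: "1 + of_real (a p) * x = 0" by blast
  then have "a p \<noteq> 0" by auto
  moreover have "x = - 1 / of_real (a p)" using p calculation
    by (simp add: field_simps add_eq_0_iff)
  ultimately show ?thesis using that[of p] assms(1)[of p] by simp
qed

lemma q_laguerre_negative_zeros: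
  assumes "q_laguerre q F"
  shows "only_negative_zeros (eval_fps F)"
proof -
  obtain \<sigma> a where a: "\<And>p. a p \<ge> (0::real)" "summable a"
    "\<And>x. eval_fps F x = exp (of_real \<sigma> * x) * (\<Prod>p. 1 + of_real (a p) * x)"
    using assms unfolding q_laguerre_def by auto
  show ?thesis unfolding only_negative_zeros_def
  proof (intro allI impI)
    fix z assume "eval_fps F z = 0"
    then have "(\<Prod>p. 1 + of_real (a p) * z) = 0" by (simp add: a)
    from prodinf_linear_eq_0D[OF a(1,2) this] obtain p where "a p > 0" "z = - 1 / of_real (a p)" .
    then have "z = of_real (- 1 / a p)" "a p > 0" by auto
    then show "z \<in> \<real> \<and> Re z < 0" by (simp only: Reals_of_real Re_complex_of_real) simp
  qed
qed

text \<open>With \<open>q < 1\<close> the positive \<open>a p\<close> decrease strictly, so exactly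
  one factor vanishes at a given zero.\<close>

lemma q_laguerre_simple_zeros:
  assumes q: "q < 1" and F: "q_laguerre q F" and C: "C \<noteq> 0"
  shows "only_simple_zeros (\<lambda>x. C * eval_fps F x)"
proof -
  obtain \<sigma> a where a: "\<And>p. a p \<ge> (0::real)" "\<And>p. a (Suc p) \<le> q * a p" "summable a"
    "\<And>x. eval_fps F x = exp (of_real \<sigma> * x) * (\<Prod>p. 1 + of_real (a p) * x)"
    using F unfolding q_laguerre_def by blast
  have lt: "a (Suc p) < a p" if "a p > 0" for p
    using a(2)[of p] mult_strict_right_mono[OF q that] by simp
  have "a (Suc p) \<le> a p" for p
    using lt[of p] a(1)[of p] a(2)[of p] by (cases "a p = 0") auto
  then have dec: "a j \<le> a i" if "i \<le> j" for i j
    using decseqD[of a i j] that by (auto simp: decseq_Suc_iff)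
  have neq: "a i \<noteq> a j" if "i < j" "a i > 0" for i j
    using lt[OF that(2)] dec[of "Suc i" j] that by auto
  show ?thesis unfolding only_simple_zeros_def
  proof (intro allI impI)
    fix z assume "C * eval_fps F z = 0"
    then have "(\<Prod>p. 1 + of_real (a p) * z) = 0" using C by (simp add: a)
    from prodinf_linear_eq_0D[OF a(1,3) this] obtain k where k: "a k > 0" "z = - 1 / of_real (a k)" .
    \<comment> \<open>The \<open>k\<close>-th factor is removed by making its coefficient 0 instead
      of reindexing; the cofactor is then again a product of the same shape.\<close>
    define c where "c = (\<lambda>p. if p = k then 0 else a p)"
    have c: "\<And>p. c p \<ge> 0" "summable c"
      using a(1,3) by (auto simp: c_def intro: summable_comparison_test'[OF a(3), where N = 0])
    have split: "(\<Prod>p. 1 + of_real (a p) * x) = (1 + of_real (a k) * x) * (\<Prod>p. 1 + of_real (c p) * x)" for x :: complex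
    proof -
      have cv: "convergent_prod (\<lambda>p. 1 + of_real (c p) * x)"
        by (intro abs_convergent_prod_imp_convergent_prod summable_imp_abs_convergent_prod)
           (use c in \<open>simp add: norm_mult summable_mult2\<close>)
      have hp: "(\<lambda>p. if p = k then 1 + of_real (a k) * x else 1) has_prod (1 + of_real (a k) * x)"
        using has_prod_single[of k "\<lambda>_. 1 + of_real (a k) * x"] by simp
      have "(1 + of_real (a k) * x) * (\<Prod>p. 1 + of_real (c p) * x) =
        (\<Prod>p. (if p = k then 1 + of_real (a k) * x else 1) * (1 + of_real (c p) * x))"
        using prodinf_mult[OF _ cv, of "\<lambda>p. if p = k then 1 + of_real (a k) * x else 1"] hp
        by (simp add: has_prod_iff)
      also have "\<dots> = (\<Prod>p. 1 + of_real (a p) * x)"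
        by (intro prodinf_cong) (auto simp: c_def)
      finally show ?thesis ..
    qed
    \<comment> \<open>The factor \<open>a k\<close> comes from
      \<open>1 + a k * w = a k * (w - z)\<close>.\<close>
    define g where "g = (\<lambda>x::complex. C * of_real (a k) * (exp (of_real \<sigma> * x) * (\<Prod>p. 1 + of_real (c p) * x)))"
    show "zorder (\<lambda>x. C * eval_fps F x) z = 1"
    proof (rule zorder_eqI[where S = UNIV and g = g])
      show "g holomorphic_on UNIV"
        unfolding g_def by (intro holomorphic_intros holomorphic_prodinf_linear c)
      show "g z \<noteq> 0"
      proof
        assume "g z = 0"
        then have "(\<Prod>p. 1 + of_real (c p) * z) = 0" using k C by (simp add: g_def)
        from prodinf_linear_eq_0D[OF c this] obtain j where j: "c j > 0" "z = - 1 / of_real (c j)" .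
        have "z * of_real (c j) = - 1" "z * of_real (a k) = - 1" using j k by auto
        then have "of_real (c j) = (of_real (a k) :: complex)"
          by (metis mult_cancel_left mult_zero_left zero_neq_neg_one)
        then have "c j = a k" by (simp only: of_real_eq_iff)
        then show False using j neq[of j k] neq[of k j] k by (cases j k rule: linorder_cases) (auto simp: c_def split: if_splits)
      qed
      show "C * eval_fps F w = g w * (w - z) powi 1" for w
      proof -
        have "of_real (a k) * (w - z) = 1 + of_real (a k) * w" using k by (simp add: field_simps)
        then show ?thesis unfolding a(4) split g_def by (simp add: mult_ac)
      qed
    qed auto
  qed
qed

section \<open>Hadamard factorisation for negative zeros\<close>

text \<open>The Moebius map \<open>w / (2 * A - w)\<close> takes the half-plane
  \<open>Re w < A\<close> into the unit disc and fixes 0. So the Schwarz lemma applies to its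
  composition with the rescaled \<open>g\<close>, and the resulting inequality is solved for
  \<open>norm (g x)\<close>.\<close>

lemma Borel_Caratheodory:
  assumes hol: "g holomorphic_on ball 0 R" and g0: "g 0 = 0"
    and Re: "\<And>x. norm x < R \<Longrightarrow> Re (g x) < A" and x: "norm x < R"
  shows "norm (g x) \<le> 2 * A * norm x / (R - norm x)"
proof -
  have R: "R > 0" using x norm_ge_zero[of x] by linarith
  have A: "A > 0" using Re[of 0] R g0 by simp
  define h where "h = (\<lambda>z. g (of_real R * z) / (2 * of_real A - g (of_real R * z)))"
  have in_ball: "norm (of_real R * z) < R" if "norm z < 1" for z :: complex
    using that R by (simp add: norm_mult)
  have nz: "2 * of_real A - g (of_real R * z) \<noteq> 0" if "norm z < 1" for z
  proof
    assume "2 * of_real A - g (of_real R * z) = 0"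
    then have "Re (2 * of_real A - g (of_real R * z)) = 0" by simp
    then show False using Re[OF in_ball[OF that]] A by simp
  qed
  have "norm (h (x / of_real R)) \<le> norm (x / of_real R)"
  proof (rule Schwarz_Lemma(1))
    have "(\<lambda>z. g (of_real R * z)) holomorphic_on ball 0 1"
    proof -
      have "(\<lambda>z::complex. of_real R * z) ` ball 0 1 \<subseteq> ball 0 R" using in_ball by auto
      then show ?thesis
        using holomorphic_on_compose_gen[of "\<lambda>z. of_real R * z" "ball 0 1" g "ball 0 R"] hol
        by (simp add: o_def holomorphic_intros)
    qed
    then show "h holomorphic_on ball 0 1"
      unfolding h_def using nz by (intro holomorphic_intros) auto
    show "h 0 = 0" by (simp add: h_def g0)
    show "norm (h z) < 1" if "norm z < 1" for z
    proof -
      let ?w = "g (of_real R * z)"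
      have "0 < 4 * A * (A - Re ?w)" using A Re[OF in_ball[OF that]] by simp
      then have "(Re ?w)\<^sup>2 + (Im ?w)\<^sup>2 < (2 * A - Re ?w)\<^sup>2 + (Im ?w)\<^sup>2"
        by (simp add: power2_eq_square algebra_simps)
      then have "norm ?w ^ 2 < norm (2 * of_real A - ?w) ^ 2"
        by (simp add: cmod_power2)
      then have "norm ?w < norm (2 * of_real A - ?w)" by (rule power_less_imp_less_base) simp
      then show ?thesis by (simp add: h_def norm_divide divide_less_eq)
    qed
    show "norm (x / of_real R) < 1" using x R by (simp add: norm_divide)
  qed
  moreover have "h (x / of_real R) = g x / (2 * of_real A - g x)" using R by (simp add: h_def)
  moreover have "2 * of_real A - g x \<noteq> 0" using nz[of "x / of_real R"] x R by (simp add: norm_divide)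
  ultimately have "norm (g x) \<le> norm x / R * norm (2 * of_real A - g x)"
    using R by (simp add: norm_divide field_simps)
  also have "\<dots> \<le> norm x / R * (2 * A + norm (g x))"
    using norm_triangle_ineq4[of "2 * of_real A" "g x"] A R by (intro mult_left_mono) auto
  finally have "norm (g x) * (R - norm x) \<le> 2 * A * norm x" using R by (simp add: field_simps)
  then show ?thesis using x by (simp add: field_simps)
qed

definition negative_zeros_entire :: "(complex \<Rightarrow> complex) \<Rightarrow> bool" where
  "negative_zeros_entire f \<longleftrightarrow> f holomorphic_on UNIV \<and> f 0 = 1 \<and> only_negative_zeros f"

text \<open>The value \<open>a = 0\<close> encodes that there is no zero, so that splitting can be
  iterated forever; the condition \<open>1 \<le> a * norm w\<close> says that the zero split off is
  one of least modulus.\<close>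

lemma split_off_zero:
  assumes "negative_zeros_entire f"
  shows "\<exists>a\<ge>0. \<exists>g. negative_zeros_entire g \<and> (\<forall>w. f w = (1 + of_real a * w) * g w) \<and>
           (\<forall>w. f w = 0 \<longrightarrow> 1 \<le> a * norm w) \<and> (a \<noteq> 0 \<longrightarrow> f (- 1 / of_real a) = 0)"
proof (cases "\<exists>z. f z = 0")
  case False
  then show ?thesis using assms by (intro exI[of _ 0]) auto
next
  case True
  have hol: "f holomorphic_on UNIV" and f0: "f 0 = 1" and neg: "\<And>z. f z = 0 \<Longrightarrow> z \<in> \<real> \<and> Re z < 0"
    using assms by (auto simp: negative_zeros_entire_def only_negative_zeros_def)
  have "closed (f -` {0})"
    using hol by (intro closed_vimage) (auto simp: holomorphic_on_imp_continuous_on)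
  then obtain z where z: "f z = 0" "\<And>w. f w = 0 \<Longrightarrow> dist 0 z \<le> dist 0 w"
    using distance_attains_inf[of "f -` {0}" 0] True by auto
  then obtain t where t: "z = - of_real t" "t > 0"
    using neg[OF z(1)] by (metis Re_complex_of_real Reals_cases add.inverse_inverse neg_0_less_iff_less of_real_minus)
  define h where "h = (\<lambda>w. if w = z then deriv f z else (f w - f z) / (w - z))"
  have h: "h holomorphic_on UNIV" unfolding h_def by (rule pole_lemma[OF hol]) auto
  have fh: "f w = (w - z) * h w" for w by (simp add: h_def z)
  define g where "g = (\<lambda>w. - z * h w)"
  have fg: "f w = (1 + of_real (1 / t) * w) * g w" for w
    using t unfolding fh g_def by (simp add: field_simps)
  have "negative_zeros_entire g"
    unfolding negative_zeros_entire_def only_negative_zeros_def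
  proof (intro conjI allI impI)
    show "g holomorphic_on UNIV" unfolding g_def by (intro holomorphic_intros h)
    show "g 0 = 1" using fg[of 0] f0 by simp
    fix w assume "g w = 0"
    then show "w \<in> \<real>" "Re w < 0" using neg[of w] fg[of w] by auto
  qed
  moreover have "1 \<le> 1 / t * norm w" if "f w = 0" for w
    using z(2)[OF that] t by (simp add: field_simps)
  moreover have "f (- 1 / of_real (1 / t)) = 0" using z(1) t by simp
  ultimately show ?thesis using fg t(2) by (intro exI[of _ "1 / t"]) auto
qed

lemma norm_prod_linear_ge:
  fixes a :: "nat \<Rightarrow> real" and w :: complex
  assumes "\<And>p. p < N \<Longrightarrow> c \<le> a p * norm w - 1" "c \<ge> 0"
  shows "norm (\<Prod>p<N. 1 + of_real (a p) * w) \<ge> c ^ N"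
proof -
  have "c ^ N = (\<Prod>p<N. c)" by simp
  also have "\<dots> \<le> (\<Prod>p<N. norm (1 + of_real (a p) * w))"
  proof (intro prod_mono conjI)
    fix p assume "p \<in> {..<N}"
    then have "c \<le> a p * norm w - 1" using assms(1) by auto
    also have "\<dots> \<le> norm (of_real (a p) * w) - norm (1::complex)" by (simp add: norm_mult mult_right_mono)
    also have "\<dots> \<le> norm (1 + of_real (a p) * w)"
      by (metis add.commute norm_diff_ineq)
    finally show "c \<le> norm (1 + of_real (a p) * w)" .
  qed (use assms in auto)
  finally show ?thesis by (simp add: prod_norm)
qed

text \<open>Each factor is at least \<open>1 - x\<close> with \<open>x = a p * norm w\<close>, and
  \<open>1 - x \<ge> exp (- 2 * x)\<close> on \<open>[0, 1 / 2]\<close> because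
  \<open>(1 - x) * (1 + 2 * x) \<ge> 1\<close> there.\<close>

lemma norm_prodinf_linear_ge:
  fixes a :: "nat \<Rightarrow> real" and w :: complex
  assumes "\<And>p. a p \<ge> 0" "summable a" "\<And>p. a p * norm w \<le> 1 / 2"
  shows "norm (\<Prod>p. 1 + of_real (a p) * w) \<ge> exp (- 2 * norm w * suminf a)"
proof -
  have f: "norm (1 + of_real (a p) * w) \<ge> exp (- 2 * norm w * a p)" for p
  proof -
    define x where "x = a p * norm w"
    have x: "0 \<le> x" "x \<le> 1 / 2" using assms(1,3)[of p] by (auto simp: x_def)
    have "1 + 2 * x \<le> exp (2 * x)" by (rule exp_ge_add_one_self)
    then have "(1 - x) * (1 + 2 * x) \<le> (1 - x) * exp (2 * x)" using x by (intro mult_left_mono) auto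
    moreover have "x * x \<le> x * (1 / 2)" using x by (intro mult_left_mono) auto
    then have "1 \<le> (1 - x) * (1 + 2 * x)" by (simp add: algebra_simps)
    ultimately have "exp (- 2 * x) \<le> 1 - x" by (simp add: exp_minus field_simps)
    also have "\<dots> = norm (1::complex) - norm (of_real (a p) * w)" using assms(1)[of p] by (simp add: x_def norm_mult)
    also have "\<dots> \<le> norm (1 + of_real (a p) * w)" by (rule norm_diff_ineq)
    finally show ?thesis by (simp add: x_def mult_ac)
  qed
  show ?thesis
  proof (rule LIMSEQ_le_const)
    show "(\<lambda>n. norm (\<Prod>p<n. 1 + of_real (a p) * w)) \<longlonglongrightarrow> norm (\<Prod>p. 1 + of_real (a p) * w)"
      using assms(1,2) by (intro tendsto_norm prod_tendsto_prodinf) (simp add: norm_mult summable_mult2)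
    show "\<exists>N. \<forall>n\<ge>N. exp (- 2 * norm w * suminf a) \<le> norm (\<Prod>p<n. 1 + of_real (a p) * w)"
    proof (intro exI allI impI)
      fix n
      have "exp (- 2 * norm w * suminf a) \<le> exp (- 2 * norm w * (\<Sum>p<n. a p))"
        using sum_le_suminf[OF assms(2), of "{..<n}"] assms(1) by (simp add: mult_left_mono)
      also have "\<dots> = (\<Prod>p<n. exp (- 2 * norm w * a p))"
        by (simp add: exp_sum[symmetric] sum_distrib_left sum_negf)
      also have "\<dots> \<le> norm (\<Prod>p<n. 1 + of_real (a p) * w)"
        unfolding prod_norm[symmetric] using f by (intro prod_mono) auto
      finally show "exp (- 2 * norm w * suminf a) \<le> norm (\<Prod>p<n. 1 + of_real (a p) * w)" .
    qed
  qed
qed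

lemma max_modulus_cball:
  assumes "f holomorphic_on UNIV" "\<And>w. norm w = R \<Longrightarrow> norm (f w) \<le> M" "norm z \<le> R"
  shows "norm (f z) \<le> M"
proof (cases "R > 0")
  case True
  show ?thesis
  proof (rule maximum_modulus_frontier[of f "cball 0 R"])
    show "continuous_on (closure (cball 0 R)) f"
      using assms(1) by (intro holomorphic_on_imp_continuous_on) (rule holomorphic_on_subset, auto)
  qed (use assms True in \<open>auto intro: holomorphic_on_subset\<close>)
next
  case False
  then have "norm z = R" using assms(3) norm_ge_zero[of z] by linarith
  then show ?thesis using assms by auto
qed

text \<open>
  The zeros are split off one by one in the order of their moduli. Jensen's counting argument
  makes the reciprocals summable, and the Borel-Caratheodory inequality shows that the
  zero-free quotient on the disc of radius \<open>R\<close> tends to \<open>1\<close> as \<open>R \<rightarrow> \<infinity>\<close>.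
\<close>
theorem Hadamard_negative_zeros:
  assumes f: "negative_zeros_entire f"
    and growth: "\<And>w. norm (f w) \<le> exp (C * (1 + norm w) powr (3 / 4))"
  obtains a where "\<And>p. a p \<ge> (0::real)" "\<And>p. a (Suc p) \<le> a p" "summable a"
    "\<And>w. f w = (\<Prod>p. 1 + of_real (a p) * w)"
proof -
  obtain A G where AG: "\<And>f. negative_zeros_entire f \<Longrightarrow> A f \<ge> (0::real) \<and> negative_zeros_entire (G f) \<and>
     (\<forall>w. f w = (1 + of_real (A f) * w) * G f w) \<and> (\<forall>w. f w = 0 \<longrightarrow> 1 \<le> A f * norm w) \<and>
     (A f \<noteq> 0 \<longrightarrow> f (- 1 / of_real (A f)) = 0)"
    using split_off_zero by metis
  define F where "F = (\<lambda>n. (G ^^ n) f)"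
  define a where "a = (\<lambda>n. A (F n))"
  have Fn: "negative_zeros_entire (F n)" for n by (induction n) (use f AG in \<open>auto simp: F_def\<close>)
  have a0: "a n \<ge> 0" for n using AG[OF Fn] by (simp add: a_def)
  have Fs: "F n w = (1 + of_real (a n) * w) * F (Suc n) w" for n w
    using AG[OF Fn] by (simp add: a_def F_def)
  have Fz: "1 \<le> a n * norm w" if "F n w = 0" for n w using AG[OF Fn] that by (simp add: a_def)
  have Fa: "F n (- 1 / of_real (a n)) = 0" if "a n \<noteq> 0" for n using AG[OF Fn] that by (simp add: a_def)
  have Fhol: "F n holomorphic_on UNIV" and F0: "F n 0 = 1" for n
    using Fn[of n] by (auto simp: negative_zeros_entire_def)
  have fF: "f w = (\<Prod>p<n. 1 + of_real (a p) * w) * F n w" for n w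
  proof (induction n)
    case (Suc n)
    show ?case unfolding Suc Fs[of n] prod.lessThan_Suc by (simp only: mult_ac)
  qed (simp add: F_def)
  have dec1: "a (Suc n) \<le> a n" for n
  proof (cases "a (Suc n) = 0")
    case False
    then have "F (Suc n) (- 1 / of_real (a (Suc n))) = 0" by (rule Fa)
    then have "F n (- 1 / of_real (a (Suc n))) = 0" using Fs[of n "- 1 / of_real (a (Suc n))"] by simp
    then have "1 \<le> a n * norm (- 1 / complex_of_real (a (Suc n)))" by (rule Fz)
    then show ?thesis using False a0[of "Suc n"] by (simp add: norm_divide field_simps)
  qed (use a0 in simp)
  then have dec: "a j \<le> a i" if "i \<le> j" for i j
    using decseqD[of a i j] that by (auto simp: decseq_Suc_iff)

  \<comment> \<open>On the circle of radius \<open>3 / a n\<close> each of the first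
    \<open>n + 1\<close> factors has modulus at least \<open>3 - 1 = 2\<close>, whereas the quotient
    of \<open>f\<close> by them still has the value 1 at 0. The maximum principle turns this into
    \<open>2 ^ Suc n \<le> M\<close>.\<close>
  have count: "(real n + 1) * ln 2 \<le> C * (1 + 3 / a n) powr (3 / 4)" if "a n > 0" for n
  proof -
    define R where "R = 3 / a n"
    define M where "M = exp (C * (1 + R) powr (3 / 4))"
    have "norm (F (Suc n) 0) \<le> M / 2 ^ Suc n"
    proof (rule max_modulus_cball[where R = R and f = "F (Suc n)"])
      fix w :: complex assume w: "norm w = R"
      have "2 ^ Suc n * norm (F (Suc n) w) \<le> norm (\<Prod>p<Suc n. 1 + of_real (a p) * w) * norm (F (Suc n) w)"
      proof (intro mult_right_mono norm_prod_linear_ge)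
        fix p assume "p < Suc n"
        then have "a n * R \<le> a p * R" using that by (intro mult_right_mono dec) (auto simp: R_def)
        then show "2 \<le> a p * norm w - 1" using that w by (simp add: R_def)
      qed auto
      also have "\<dots> = norm (f w)" by (simp only: norm_mult[symmetric] fF[of w "Suc n"])
      also have "\<dots> \<le> M" using growth[of w] w by (simp add: M_def)
      finally show "norm (F (Suc n) w) \<le> M / 2 ^ Suc n" by (simp add: field_simps)
    qed (use Fhol that in \<open>auto simp: R_def\<close>)
    then have "2 ^ Suc n \<le> M" by (simp add: F0 field_simps)
    then have "ln (2 ^ Suc n) \<le> ln M" by (subst ln_le_cancel_iff) (auto simp: M_def)
    then show ?thesis by (simp add: M_def R_def ln_realpow algebra_simps del: power_Suc)
  qed
  \<comment> \<open>Solving \<open>count\<close> for \<open>a n\<close> inverts the exponent 3/4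
    into 4/3 > 1, whence the summability; \<open>a 0 + 3\<close> comes from
    \<open>1 + 3 / a n \<le> (a 0 + 3) / a n\<close>.\<close>
  define K where "K = (\<bar>C\<bar> / ln 2) powr (4 / 3) * (a 0 + 3)"
  have abound: "a n \<le> K * (real n + 1) powr (- 4 / 3)" for n
  proof (cases "a n = 0")
    case True then show ?thesis using a0[of 0] by (simp add: K_def)
  next
    case False
    then have an: "a n > 0" using a0[of n] by simp
    have "1 + 3 / a n \<le> (a 0 + 3) / a n" using dec[of 0 n] an by (simp add: field_simps)
    then have "(1 + 3 / a n) powr (3 / 4) \<le> ((a 0 + 3) / a n) powr (3 / 4)"
      using an by (intro powr_mono2) auto
    then have "\<bar>C\<bar> * (1 + 3 / a n) powr (3 / 4) \<le> \<bar>C\<bar> * ((a 0 + 3) / a n) powr (3 / 4)" by (intro mult_left_mono) auto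
    moreover have "C * (1 + 3 / a n) powr (3 / 4) \<le> \<bar>C\<bar> * (1 + 3 / a n) powr (3 / 4)" by (intro mult_right_mono) auto
    ultimately have "(real n + 1) * ln 2 \<le> \<bar>C\<bar> * ((a 0 + 3) / a n) powr (3 / 4)"
      using count[OF an] by linarith
    then have "real n + 1 \<le> \<bar>C\<bar> / ln 2 * ((a 0 + 3) / a n) powr (3 / 4)" by (simp add: field_simps)
    then have "(real n + 1) powr (4 / 3) \<le> (\<bar>C\<bar> / ln 2 * ((a 0 + 3) / a n) powr (3 / 4)) powr (4 / 3)"
      by (intro powr_mono2) auto
    also have "\<dots> = K / a n"
    proof -
      have "(((a 0 + 3) / a n) powr (3 / 4)) powr (4 / 3) = (a 0 + 3) / a n"
        using an a0[of 0] by (simp add: powr_powr)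
      then show ?thesis by (subst powr_mult) (auto simp: K_def)
    qed
    finally have "a n \<le> K / (real n + 1) powr (4 / 3)" using an by (simp add: field_simps)
    then show ?thesis by (simp add: powr_minus field_simps)
  qed
  have sma: "summable a"
    by (rule summable_comparison_test'[OF summable_mult[OF summable_Suc_powr[of "4/3"], of K]])
       (use abound a0 in auto)
  have alim: "a \<longlonglongrightarrow> 0" using sma by (rule summable_LIMSEQ_zero)

  \<comment> \<open>\<open>m R\<close> counts the zeros of modulus less than \<open>2 * R\<close>.
    On the circle of radius \<open>4 * R\<close> their factors have modulus at least 1, so the
    growth of \<open>f\<close> there bounds the cofactor; in the disc of radius \<open>R\<close> the
    remaining factors have \<open>a p * norm w \<le> 1 / 2\<close>, which keeps the tail product
    away from 0.\<close>
  define m where "m = (\<lambda>R::real. LEAST p. a p \<le> 1 / (2 * R))"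
  have m: "a (m R) \<le> 1 / (2 * R)" if "R > 0" for R
  proof -
    have "\<forall>\<^sub>F p in sequentially. a p < 1 / (2 * R)" using alim that by (intro order_tendstoD) auto
    then have "\<exists>p. a p \<le> 1 / (2 * R)" by (metis eventually_sequentially less_imp_le order_refl)
    then show ?thesis unfolding m_def by (rule LeastI_ex)
  qed
  have m': "a p > 1 / (2 * R)" if "p < m R" for p R
    using not_less_Least[of p "\<lambda>p. a p \<le> 1 / (2 * R)"] that by (auto simp: m_def)
  define T where "T = (\<lambda>R. \<Sum>p. a (p + m R))"
  define P where "P = (\<lambda>w::complex. \<Prod>p. 1 + of_real (a p) * w)"
  \<comment> \<open>\<open>E R\<close> bounds the real part of the logarithm of the zero-free
    quotient of \<open>f\<close> and \<open>P\<close> on the disc of radius \<open>R\<close>: the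
    first summand is the growth on radius \<open>4 * R\<close>, the second the loss in the tail
    product, and 1 makes the bound strict, as \<open>Borel_Caratheodory\<close> demands. Divided by
    \<open>R\<close> it tends to 0, because 3/4 < 1 and the tails \<open>T\<close> tend to
    0.\<close>
  define E where "E = (\<lambda>R. C * (1 + 4 * R) powr (3 / 4) + 2 * R * T R + 1)"
  have main: "\<exists>g. norm g \<le> 2 * E R * norm w / (R - norm w) \<and> f w = P w * exp g" if w: "norm w < R" for w R
  proof -
    have R: "R > 0" using w norm_ge_zero[of w] by linarith
    let ?b = "\<lambda>p. a (p + m R)"
    define L where "L = (\<lambda>w::complex. \<Prod>p. 1 + of_real (?b p) * w)"
    have b: "\<And>p. ?b p \<ge> 0" "summable ?b" using a0 sma by (auto simp: summable_iff_shift)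
    have PL: "P w = (\<Prod>p<m R. 1 + of_real (a p) * w) * L w" for w
    proof -
      have "(\<lambda>n. \<Prod>p<n + m R. 1 + of_real (a p) * w) \<longlonglongrightarrow> P w"
        unfolding P_def
        by (intro LIMSEQ_ignore_initial_segment prod_tendsto_prodinf) (use a0 sma in \<open>simp add: norm_mult summable_mult2\<close>)
      moreover have "(\<Prod>p<n + m R. 1 + of_real (a p) * w) =
         (\<Prod>p<m R. 1 + of_real (a p) * w) * (\<Prod>p<n. 1 + of_real (?b p) * w)" for n
        by (induction n) (auto simp: mult_ac)
      moreover have "(\<lambda>n. (\<Prod>p<m R. 1 + of_real (a p) * w) * (\<Prod>p<n. 1 + of_real (?b p) * w)) \<longlonglongrightarrow>
          (\<Prod>p<m R. 1 + of_real (a p) * w) * L w"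
        unfolding L_def
        by (intro tendsto_mult tendsto_const prod_tendsto_prodinf) (use b in \<open>simp add: norm_mult summable_mult2\<close>)
      ultimately show ?thesis by (simp add: LIMSEQ_unique)
    qed
    have Lge: "norm (L w) \<ge> exp (- 2 * norm w * T R)" if "norm w < R" for w
      unfolding L_def T_def
    proof (rule norm_prodinf_linear_ge[OF b])
      fix p
      have "a (p + m R) \<le> 1 / (2 * R)" using m[OF R] dec[of "m R" "p + m R"] by simp
      then have "a (p + m R) * norm w \<le> 1 / (2 * R) * R" using that a0 R by (intro mult_mono) auto
      then show "a (p + m R) * norm w \<le> 1 / 2" using R by simp
    qed
    have Lnz: "L w \<noteq> 0" if "norm w < R" for w using Lge[OF that] by auto
    have T0: "T R \<ge> 0" unfolding T_def by (rule suminf_nonneg[OF b(2,1)])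
    have Fm: "norm (F (m R) w) \<le> exp (C * (1 + 4 * R) powr (3 / 4))" if "norm w < R" for w
    proof (rule max_modulus_cball[where R = "4 * R" and f = "F (m R)"])
      fix w :: complex assume w: "norm w = 4 * R"
      have "1 ^ m R * norm (F (m R) w) \<le> norm (\<Prod>p<m R. 1 + of_real (a p) * w) * norm (F (m R) w)"
      proof (intro mult_right_mono norm_prod_linear_ge)
        fix p assume "p < m R"
        then show "1 \<le> a p * norm w - 1" using m'[of p R] w R by (simp add: field_simps)
      qed auto
      also have "\<dots> = norm (f w)" by (simp only: norm_mult[symmetric] fF[of w "m R"])
      also have "\<dots> \<le> exp (C * (1 + 4 * R) powr (3 / 4))" using growth[of w] w by simp
      finally show "norm (F (m R) w) \<le> exp (C * (1 + 4 * R) powr (3 / 4))" by simp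
    qed (use Fhol that R in auto)
    have Fnz: "F (m R) w \<noteq> 0" if "norm w < R" for w
    proof
      assume "F (m R) w = 0"
      then have "1 \<le> a (m R) * norm w" by (rule Fz)
      also have "\<dots> \<le> 1 / (2 * R) * R" using that m[OF R] R by (intro mult_mono) auto
      finally show False using R by simp
    qed
    define h where "h = (\<lambda>w. F (m R) w / L w)"
    have hhol: "h holomorphic_on ball 0 R"
      unfolding h_def L_def using Lnz
      by (intro holomorphic_on_divide holomorphic_prodinf_linear[OF b] holomorphic_on_subset[OF Fhol]) (auto simp: L_def)
    obtain g where g: "g holomorphic_on ball 0 R" "\<And>w. w \<in> ball 0 R \<Longrightarrow> exp (g w) = h w"
      using holomorphic_logarithm_exists[OF _ _ hhol, of 0] Fnz Lnz R by (auto simp: h_def)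
    have "L 0 = 1" by (simp add: L_def)
    then have eg0: "exp (g 0) = 1" using g(2)[of 0] R by (simp add: h_def F0)
    define g' where "g' = (\<lambda>w. g w - g 0)"
    have eg': "exp (g' w) = h w" if "norm w < R" for w
      using g(2)[of w] that by (simp add: g'_def exp_diff eg0)
    have "norm (g' w) \<le> 2 * E R * norm w / (R - norm w)"
    proof (rule Borel_Caratheodory)
      show "g' holomorphic_on ball 0 R" unfolding g'_def by (intro holomorphic_intros g)
      show "g' 0 = 0" by (simp add: g'_def)
      fix x :: complex assume x: "norm x < R"
      have "exp (Re (g' x)) = norm (h x)" using eg'[OF x] by (metis norm_exp_eq_Re)
      also have "\<dots> \<le> exp (C * (1 + 4 * R) powr (3 / 4)) / exp (- 2 * norm x * T R)"
        unfolding h_def norm_divide using Fm[OF x] Lge[OF x] by (intro frac_le) auto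
      also have "\<dots> = exp (C * (1 + 4 * R) powr (3 / 4) + 2 * norm x * T R)"
        by (simp add: exp_diff[symmetric])
      finally have "Re (g' x) \<le> C * (1 + 4 * R) powr (3 / 4) + 2 * norm x * T R" by simp
      also have "2 * norm x * T R \<le> 2 * R * T R" using x T0 by (intro mult_right_mono) auto
      finally show "Re (g' x) < E R" by (simp add: E_def)
    qed fact
    moreover have "f w = P w * exp (g' w)"
      using Lnz[OF w] by (simp add: eg'[OF w] PL fF[of w "m R"] h_def)
    ultimately show ?thesis by blast
  qed

  have Tlim: "(\<lambda>n. T (real n)) \<longlonglongrightarrow> 0"
  proof -
    \<comment> \<open>The tail \<open>T n\<close> starts at a varying index. Written as a sum over
      all \<open>p\<close> with the terms above \<open>1 / (2 * n)\<close> set to 0, it has the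
      fixed majorant \<open>a\<close>.\<close>
    let ?c = "\<lambda>p n. if a p \<le> 1 / (2 * real n) then a p else 0"
    have "(\<lambda>n. suminf (\<lambda>p. ?c p n)) \<longlonglongrightarrow> (\<Sum>p::nat. 0)"
    proof (rule tannerys_theorem[where M = a, THEN conjunct2, THEN conjunct2])
      show "(\<lambda>n. ?c p n) \<longlonglongrightarrow> 0" for p
      proof (cases "a p = 0")
        case False
        have "(\<lambda>n. 1 / (2 * real n)) \<longlonglongrightarrow> 0" by real_asymp
        then have "\<forall>\<^sub>F n in sequentially. 1 / (2 * real n) < a p"
          using False a0[of p] by (intro order_tendstoD) auto
        then have "\<forall>\<^sub>F n in sequentially. ?c p n = 0" by eventually_elim auto
        then show ?thesis by (rule tendsto_eventually)
      qed auto
    qed (use sma a0 in \<open>auto intro!: always_eventually\<close>)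
    moreover have "suminf (\<lambda>p. ?c p n) = T (real n)" if "n > 0" for n
    proof -
      have sc: "summable (\<lambda>p. ?c p n)" by (rule summable_comparison_test'[OF sma]) (use a0 in auto)
      have "suminf (\<lambda>p. ?c p n) = (\<Sum>p. ?c (p + m (real n)) n) + (\<Sum>p<m (real n). ?c p n)"
        by (rule suminf_split_initial_segment[OF sc])
      also have "(\<Sum>p<m (real n). ?c p n) = 0"
        using m'[of _ "real n"] by (intro sum.neutral) force
      also have "(\<lambda>p. ?c (p + m (real n)) n) = (\<lambda>p. a (p + m (real n)))"
      proof
        fix p
        have "a (p + m (real n)) \<le> 1 / (2 * real n)"
          using m[of "real n"] dec[of "m (real n)" "p + m (real n)"] that by simp
        then show "?c (p + m (real n)) n = a (p + m (real n))" by simp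
      qed
      finally show ?thesis by (simp add: T_def)
    qed
    then have "\<forall>\<^sub>F n in sequentially. suminf (\<lambda>p. ?c p n) = T (real n)"
      using eventually_gt_at_top[of 0] by (rule eventually_mono[rotated])
    ultimately show ?thesis by (simp add: tendsto_cong)
  qed
  have Elim: "(\<lambda>n. 2 * E (real n) * norm w / (real n - norm w)) \<longlonglongrightarrow> 0" for w :: complex
  proof -
    define t where "t = norm w"
    have "(\<lambda>n. 2 * t * C * ((1 + 4 * real n) powr (3/4) / (real n - t)) +
        4 * t * (real n / (real n - t)) * T (real n) + 2 * t / (real n - t)) \<longlonglongrightarrow>
        2 * t * C * 0 + 4 * t * 1 * 0 + 0"
    proof (intro tendsto_add tendsto_mult tendsto_const Tlim)
      show "(\<lambda>n. (1 + 4 * real n) powr (3/4) / (real n - t)) \<longlonglongrightarrow> 0" by real_asymp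
      show "(\<lambda>n. real n / (real n - t)) \<longlonglongrightarrow> 1" by real_asymp
      show "(\<lambda>n. 2 * t / (real n - t)) \<longlonglongrightarrow> 0" by real_asymp
    qed
    moreover have "2 * t * C * ((1 + 4 * real n) powr (3/4) / (real n - t)) +
        4 * t * (real n / (real n - t)) * T (real n) + 2 * t / (real n - t) = 2 * E (real n) * t / (real n - t)" for n
      by (simp add: E_def add_divide_distrib[symmetric] algebra_simps)
    ultimately show ?thesis by (simp add: t_def)
  qed
  have "f w = P w" for w
  proof -
    have "\<forall>n. \<exists>g. norm w < real n \<longrightarrow> norm g \<le> 2 * E (real n) * norm w / (real n - norm w) \<and> f w = P w * exp g"
      using main by blast
    then obtain g where g: "\<And>n. norm w < real n \<Longrightarrow>
        norm (g n) \<le> 2 * E (real n) * norm w / (real n - norm w) \<and> f w = P w * exp (g n)"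
      by metis
    have ev: "\<forall>\<^sub>F n in sequentially. norm w < real n"
      using filterlim_real_sequentially by (simp add: filterlim_at_top_dense)
    have "g \<longlonglongrightarrow> 0"
      by (rule Lim_null_comparison[OF _ Elim[of w]]) (use ev in \<open>eventually_elim, use g in blast\<close>)
    then have "(\<lambda>n. P w * exp (g n)) \<longlonglongrightarrow> P w * exp 0" by (intro tendsto_intros)
    moreover have "\<forall>\<^sub>F n in sequentially. P w * exp (g n) = f w" using ev by eventually_elim (use g in metis)
    ultimately have "(\<lambda>n. f w) \<longlonglongrightarrow> P w * exp 0" by (simp add: tendsto_cong)
    then show ?thesis by (simp add: LIMSEQ_const_iff)
  qed
  then show ?thesis using that[of a] a0 dec1 sma by (simp add: P_def)
qed

section \<open>The functional equation of the theta function\<close>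

text \<open>For \<open>\<bar>t\<bar> \<le> 2\<close> the quartic Taylor term
  \<open>t ^ 4 / 24\<close> is at most \<open>t^2 / 6\<close>, which leaves
  \<open>1 - t^2 / 3\<close>. The Gaussian bound is to dominate high powers of cosines in Tannery's
  theorem.\<close>

lemma cos_le_exp:
  fixes t :: real
  assumes "\<bar>t\<bar> \<le> pi / 2"
  shows "cos t \<le> exp (- t\<^sup>2 / 3)"
proof -
  obtain s where "cos t = (\<Sum>k<4. cos_coeff k * t ^ k) + cos (s + 1/2 * real 4 * pi) / fact 4 * t ^ 4"
    using Maclaurin_cos_expansion[of t 4] by blast
  moreover have "(\<Sum>k<4. cos_coeff k * t ^ k) = 1 - t\<^sup>2 / 2"
    by (simp add: lessThan_nat_numeral lessThan_Suc cos_coeff_def fact_numeral)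
  moreover have "cos (s + 1/2 * real 4 * pi) / fact 4 * t ^ 4 \<le> 1 / 24 * t ^ 4"
    by (intro mult_right_mono) (auto simp: fact_numeral)
  moreover have "t\<^sup>2 \<le> 2\<^sup>2" using assms pi_less_4 by (intro power2_le_iff_abs_le[THEN iffD2]) auto
  then have "t\<^sup>2 * t\<^sup>2 \<le> 4 * t\<^sup>2" by (intro mult_right_mono) auto
  then have "t ^ 4 \<le> 4 * t\<^sup>2" by (simp add: power_add[symmetric])
  ultimately have "cos t \<le> 1 + (- t\<^sup>2 / 3)" by simp
  also have "\<dots> \<le> exp (- t\<^sup>2 / 3)" by (rule exp_ge_add_one_self)
  finally show ?thesis .
qed

lemma sum_symmetric_split:
  fixes g :: "nat \<Rightarrow> real"
  shows "(\<Sum>j\<le>2 * m. g j) = g m + (\<Sum>i=1..m. g (m + i) + g (m - i))"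
proof -
  have "{..2 * m} = insert m ({m<..2 * m} \<union> {..<m})" by auto
  then have "(\<Sum>j\<le>2 * m. g j) = g m + (\<Sum>j\<in>{m<..2 * m} \<union> {..<m}. g j)" by simp
  also have "(\<Sum>j\<in>{m<..2 * m} \<union> {..<m}. g j) = (\<Sum>j\<in>{m<..2 * m}. g j) + (\<Sum>j\<in>{..<m}. g j)"
    by (rule sum.union_disjoint) auto
  also have "(\<Sum>j\<in>{m<..2 * m}. g j) = (\<Sum>i=1..m. g (m + i))"
    by (rule sum.reindex_bij_witness[of _ "\<lambda>i. m + i" "\<lambda>j. j - m"]) auto
  also have "(\<Sum>j\<in>{..<m}. g j) = (\<Sum>i=1..m. g (m - i))"
    by (rule sum.reindex_bij_witness[of _ "\<lambda>i. m - i" "\<lambda>j. m - j"]) auto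
  finally show ?thesis by (simp add: sum.distrib)
qed

lemma cos_power_binomial:
  "(2 * cos a) ^ (2 * m) =
     real (2 * m choose m) + 2 * (\<Sum>i=1..m. real (2 * m choose (m + i)) * cos (2 * real i * a))"
proof -
  have "complex_of_real ((2 * cos a) ^ (2 * m)) = (cis a + cis (- a)) ^ (2 * m)"
    by (simp add: complex_eq_iff cis.ctr flip: of_real_power)
  also have "\<dots> = (\<Sum>j\<le>2 * m. of_nat (2 * m choose j) * cis a ^ j * cis (- a) ^ (2 * m - j))"
    by (rule binomial_ring)
  also have "\<dots> = (\<Sum>j\<le>2 * m. of_nat (2 * m choose j) * cis (2 * (real j - real m) * a))"
  proof (intro sum.cong refl)
    fix j assume "j \<in> {..2 * m}"
    then have "cis a ^ j * cis (- a) ^ (2 * m - j) = cis (2 * (real j - real m) * a)"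
    proof -
      have "cis a ^ j * cis (- a) ^ (2 * m - j) = cis (real j * a + real (2 * m - j) * (- a))"
        by (simp only: Complex.DeMoivre cis_mult)
      also have "real j * a + real (2 * m - j) * (- a) = 2 * (real j - real m) * a"
        using \<open>j \<in> {..2 * m}\<close> by (simp add: of_nat_diff algebra_simps)
      finally show ?thesis .
    qed
    then show "of_nat (2 * m choose j) * cis a ^ j * cis (- a) ^ (2 * m - j) =
        of_nat (2 * m choose j) * cis (2 * (real j - real m) * a)" by (simp add: mult.assoc)
  qed
  finally have "Re (complex_of_real ((2 * cos a) ^ (2 * m))) =
      Re (\<Sum>j\<le>2 * m. of_nat (2 * m choose j) * cis (2 * (real j - real m) * a))" by simp
  then have "(2 * cos a) ^ (2 * m) = (\<Sum>j\<le>2 * m. real (2 * m choose j) * cos (2 * (real j - real m) * a))"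
    by simp
  also have "\<dots> = real (2 * m choose m) +
      (\<Sum>i=1..m. real (2 * m choose (m + i)) * cos (2 * (real (m + i) - real m) * a) +
                real (2 * m choose (m - i)) * cos (2 * (real (m - i) - real m) * a))"
    by (subst sum_symmetric_split) simp
  also have "(\<Sum>i=1..m. real (2 * m choose (m + i)) * cos (2 * (real (m + i) - real m) * a) +
                real (2 * m choose (m - i)) * cos (2 * (real (m - i) - real m) * a)) =
             (\<Sum>i=1..m. 2 * (real (2 * m choose (m + i)) * cos (2 * real i * a)))"
  proof (intro sum.cong refl)
    fix i assume i: "i \<in> {1..m}"
    have "2 * m choose (m - i) = 2 * m choose (m + i)"
      using i by (subst binomial_symmetric) (auto simp: Suc_diff_le intro!: arg_cong2[of _ _ _ _ binomial])
    moreover have "cos (2 * (real (m - i) - real m) * a) = cos (2 * real i * a)"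
    proof -
      have "2 * (real (m - i) - real m) * a = - (2 * real i * a)" using i by (simp add: of_nat_diff)
      then show ?thesis by (simp only: cos_minus)
    qed
    ultimately show "real (2 * m choose (m + i)) * cos (2 * (real (m + i) - real m) * a) +
                real (2 * m choose (m - i)) * cos (2 * (real (m - i) - real m) * a) =
              2 * (real (2 * m choose (m + i)) * cos (2 * real i * a))" by simp
  qed
  finally show ?thesis by (simp add: sum_distrib_left)
qed

lemma sum_cos_multiples:
  assumes "n > 0"
  shows "(\<Sum>l<n. cos (2 * real i * (pi * real l / real n))) = (if n dvd i then real n else 0)"
proof -
  define w where "w = cis (2 * pi * real i / real n)"
  have w1: "w = 1 \<longleftrightarrow> n dvd i"
    using complex_root_unity_eq_1[of n i] assms by (simp add: w_def cis_conv_exp mult_ac)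
  have wn: "w ^ n = 1"
  proof -
    have "real n * (2 * pi * real i / real n) = 2 * pi * real i" using assms by simp
    then have "w ^ n = cis (2 * pi * real i)" unfolding w_def Complex.DeMoivre by (rule arg_cong)
    then show ?thesis by (simp add: cis_multiple_2pi)
  qed
  have "(\<Sum>l<n. w ^ l) = (if n dvd i then of_nat n else 0)"
  proof (cases "w = 1")
    case False
    then show ?thesis using w1 wn by (simp add: geometric_sum)
  qed (use w1 in simp)
  then have "Re (\<Sum>l<n. w ^ l) = (if n dvd i then real n else 0)" by simp
  moreover have "Re (w ^ l) = cos (2 * real i * (pi * real l / real n))" for l
    by (simp add: w_def Complex.DeMoivre mult_ac)
  ultimately show ?thesis by simp
qed

text \<open>Summation over \<open>n\<close>-th roots of unity keeps from the binomial expansion only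
  the indices divisible by \<open>n\<close>. After division by \<open>4 ^ m\<close>, the left side
  will tend to the theta series at \<open>x\<close> and the right side to a multiple of the one at
  \<open>1 / x\<close>.\<close>

lemma Polya_identity:
  assumes "n > 0"
  shows "(\<Sum>l<n. (2 * cos (pi * real l / real n)) ^ (2 * m)) =
    real n * (real (2 * m choose m) + 2 * (\<Sum>i\<in>{i\<in>{1..m}. n dvd i}. real (2 * m choose (m + i))))"
proof -
  have "(\<Sum>l<n. (2 * cos (pi * real l / real n)) ^ (2 * m)) =
     real n * real (2 * m choose m) +
     2 * (\<Sum>l<n. \<Sum>i=1..m. real (2 * m choose (m + i)) * cos (2 * real i * (pi * real l / real n)))"
    by (simp only: cos_power_binomial sum.distrib sum_distrib_left[symmetric] sum_constant card_lessThan)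
  also have "(\<Sum>l<n. \<Sum>i=1..m. real (2 * m choose (m + i)) * cos (2 * real i * (pi * real l / real n))) =
     (\<Sum>i=1..m. real (2 * m choose (m + i)) * (\<Sum>l<n. cos (2 * real i * (pi * real l / real n))))"
    by (subst sum.swap) (simp only: sum_distrib_left)
  also have "\<dots> = (\<Sum>i=1..m. if n dvd i then real (2 * m choose (m + i)) * real n else 0)"
    by (simp only: sum_cos_multiples[OF assms]) (intro sum.cong, auto)
  also have "\<dots> = real n * (\<Sum>i\<in>{i\<in>{1..m}. n dvd i}. real (2 * m choose (m + i)))"
    by (subst sum.inter_filter[symmetric]) (auto simp: sum_distrib_left mult.commute)
  finally show ?thesis by (simp add: algebra_simps)
qed

text \<open>For an odd modulus the reflection of \<open>l\<close> to \<open>2 * r + 1 - l\<close>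
  pairs the nonzero indices without a fixed point, and an even power of the cosine is invariant
  under it.\<close>

lemma sum_cos_fold:
  "(\<Sum>l<2 * r + 1. cos (pi * real l / real (2 * r + 1)) ^ (2 * m)) =
   1 + 2 * (\<Sum>k<r. cos (pi * real (k + 1) / real (2 * r + 1)) ^ (2 * m))"
proof -
  let ?h = "\<lambda>l. cos (pi * real l / real (2 * r + 1)) ^ (2 * m)"
  have "{..<2 * r + 1} = insert 0 ({1..r} \<union> {r<..2 * r})" by auto
  then have "(\<Sum>l<2 * r + 1. ?h l) = ?h 0 + (\<Sum>l\<in>{1..r} \<union> {r<..2 * r}. ?h l)" by simp
  also have "(\<Sum>l\<in>{1..r} \<union> {r<..2 * r}. ?h l) = (\<Sum>l=1..r. ?h l) + (\<Sum>l\<in>{r<..2 * r}. ?h l)"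
    by (rule sum.union_disjoint) auto
  also have "(\<Sum>l\<in>{r<..2 * r}. ?h l) = (\<Sum>l=1..r. ?h l)"
  proof (rule sum.reindex_bij_witness[of _ "\<lambda>l. 2 * r + 1 - l" "\<lambda>l. 2 * r + 1 - l"])
    fix l assume l: "l \<in> {r<..2 * r}"
    have "pi * real (2 * r + 1 - l) / real (2 * r + 1) = pi - pi * real l / real (2 * r + 1)"
      using l by (simp add: of_nat_diff field_simps)
    then show "?h (2 * r + 1 - l) = ?h l" by (simp only: cos_pi_minus power_mult power2_minus)
  qed auto
  also have "(\<Sum>l=1..r. ?h l) = (\<Sum>k<r. ?h (k + 1))"
    by (rule sum.reindex_bij_witness[of _ "\<lambda>l. l + 1" "\<lambda>l. l - 1"]) auto
  finally show ?thesis by simp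
qed

text \<open>An infinite series over \<open>k\<close>, with index \<open>k\<close> standing for the
  multiple \<open>k + 1\<close>, is the form to which Tannery's theorem applies.\<close>

lemma sum_multiples:
  fixes g :: "nat \<Rightarrow> real"
  assumes "n > 0"
  shows "(\<Sum>i\<in>{i\<in>{1..m}. n dvd i}. g i) = (\<Sum>k. if (k + 1) * n \<le> m then g ((k + 1) * n) else 0)"
proof -
  have kn: "k < m" if "(k + 1) * n \<le> m" for k
  proof -
    have "(k + 1) * 1 \<le> (k + 1) * n" using assms by (intro mult_le_mono) auto
    from order.trans[OF this that] show ?thesis by simp
  qed
  have "(\<Sum>k. if (k + 1) * n \<le> m then g ((k + 1) * n) else 0) = (\<Sum>k<m. if (k + 1) * n \<le> m then g ((k + 1) * n) else 0)"
    by (rule suminf_finite) (use kn in auto)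
  also have "\<dots> = (\<Sum>k\<in>{k\<in>{..<m}. (k + 1) * n \<le> m}. g ((k + 1) * n))"
    by (subst sum.inter_filter) auto
  also have "\<dots> = (\<Sum>i\<in>{i\<in>{1..m}. n dvd i}. g i)"
  proof (rule sum.reindex_bij_witness[of _ "\<lambda>i. i div n - 1" "\<lambda>k. (k + 1) * n"])
    fix i assume i: "i \<in> {i\<in>{1..m}. n dvd i}"
    then obtain k' where k': "i = n * k'" by (auto simp: dvd_def)
    then obtain k where "k' = Suc k" using i by (cases k') auto
    then have k: "i = Suc k * n" using k' by simp
    show "(i div n - 1 + 1) * n = i" "i div n - 1 \<in> {k\<in>{..<m}. (k + 1) * n \<le> m}"
      using assms i k kn[of k] by auto
  qed (use assms in auto)
  finally show ?thesis ..
qed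

section \<open>Binomial coefficients near the centre\<close>

lemma central_binomial_ratio:
  assumes "j \<le> m"
  shows "real (2 * m choose (m + j)) / real (2 * m choose m) = (\<Prod>i<j. real (m - i) / real (m + i + 1))"
  using assms
proof (induction j)
  case (Suc j)
  have "Suc (m + j) * (2 * m choose Suc (m + j)) = (2 * m - (m + j)) * (2 * m choose (m + j))"
    using binomial_absorption[of "m + j" "2 * m"] binomial_absorb_comp[of "2 * m" "m + j"] by simp
  then have "real (Suc (m + j)) * real (2 * m choose Suc (m + j)) = real (m - j) * real (2 * m choose (m + j))"
    by (metis add_diff_cancel_left diff_diff_add mult_2 of_nat_mult)
  then have "real (2 * m choose (m + Suc j)) = real (2 * m choose (m + j)) * (real (m - j) / real (m + j + 1))"
    by (simp add: field_simps)
  then have "real (2 * m choose (m + Suc j)) / real (2 * m choose m) =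
      real (2 * m choose (m + j)) / real (2 * m choose m) * (real (m - j) / real (m + j + 1))"
    by (simp only: times_divide_eq_left)
  then show ?case using Suc by (simp only: prod.lessThan_Suc Suc_leD)
qed simp

lemma sum_odd_real: "(\<Sum>i<j. 2 * real i + 1) = (real j)\<^sup>2"
  by (induction j) (auto simp: power2_eq_square algebra_simps)

text \<open>Each factor is \<open>1 - (2 * i + 1) / (m + i + 1)\<close>; the inequality
  \<open>1 + v \<le> exp v\<close> and the sum of the odd numbers give the exponent. The lower bound
  below treats the reciprocal factors alike, and both exponents are close to
  \<open>- j^2 / m\<close> when \<open>j\<close> is small against \<open>m\<close>.\<close>

lemma central_binomial_ratio_le:
  assumes "j \<le> m"
  shows "real (2 * m choose (m + j)) / real (2 * m choose m) \<le> exp (- (real j)\<^sup>2 / (real m + real j))"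
proof -
  have "(\<Prod>i<j. real (m - i) / real (m + i + 1)) \<le> (\<Prod>i<j. exp (- (2 * real i + 1) / (real m + real j)))"
  proof (intro prod_mono conjI)
    fix i assume "i \<in> {..<j}"
    then have i: "i < j" "i < m" using assms by auto
    have "real (m - i) / real (m + i + 1) = 1 + (- (2 * real i + 1) / (real m + real i + 1))"
      using i by (simp add: of_nat_diff field_simps)
    also have "\<dots> \<le> exp (- (2 * real i + 1) / (real m + real i + 1))" by (rule exp_ge_add_one_self)
    also have "\<dots> \<le> exp (- (2 * real i + 1) / (real m + real j))"
    proof -
      have "(2 * real i + 1) / (real m + real j) \<le> (2 * real i + 1) / (real m + real i + 1)"
        using i by (intro divide_left_mono mult_pos_pos) auto
      then show ?thesis by (simp only: exp_le_cancel_iff minus_divide_left[symmetric] neg_le_iff_le)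
    qed
    finally show "real (m - i) / real (m + i + 1) \<le> exp (- (2 * real i + 1) / (real m + real j))" .
  qed auto
  also have "\<dots> = exp (- (\<Sum>i<j. 2 * real i + 1) / (real m + real j))"
    by (simp only: exp_sum[OF finite_lessThan, symmetric] sum_divide_distrib[symmetric] sum_negf)
  finally show ?thesis unfolding central_binomial_ratio[OF assms] sum_odd_real .
qed

lemma central_binomial_ratio_ge:
  assumes "j < m"
  shows "real (2 * m choose (m + j)) / real (2 * m choose m) \<ge> exp (- (real j)\<^sup>2 / (real m - real j))"
proof -
  have "exp (- (\<Sum>i<j. 2 * real i + 1) / (real m - real j)) = (\<Prod>i<j. exp (- (2 * real i + 1) / (real m - real j)))"
    by (simp only: exp_sum[OF finite_lessThan, symmetric] sum_divide_distrib[symmetric] sum_negf)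
  also have "\<dots> \<le> (\<Prod>i<j. real (m - i) / real (m + i + 1))"
  proof (intro prod_mono conjI)
    fix i assume "i \<in> {..<j}"
    then have i: "i < j" "i < m" using assms by auto
    have "real (m + i + 1) / real (m - i) = 1 + (2 * real i + 1) / (real m - real i)"
      using i by (simp add: of_nat_diff field_simps)
    also have "\<dots> \<le> exp ((2 * real i + 1) / (real m - real i))" by (rule exp_ge_add_one_self)
    also have "\<dots> \<le> exp ((2 * real i + 1) / (real m - real j))"
      using i assms by (simp add: frac_le)
    finally have "inverse (exp ((2 * real i + 1) / (real m - real j))) \<le> inverse (real (m + i + 1) / real (m - i))"
      using i by (intro le_imp_inverse_le) auto
    then show "exp (- (2 * real i + 1) / (real m - real j)) \<le> real (m - i) / real (m + i + 1)"
      by (simp only: exp_minus[symmetric] inverse_divide minus_divide_left[symmetric])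
  qed auto
  finally show ?thesis using central_binomial_ratio[of j m] assms by (simp add: sum_odd_real)
qed

text \<open>An exact identity at every stage: the central binomial coefficient is governed by the
  partial Wallis products, so the limit follows without Stirling's formula.\<close>

lemma central_binomial_wallis:
  "(real (2 * m choose m) / 4 ^ m)\<^sup>2 * (2 * real m + 1) * (\<Prod>k=1..m. (4 * real k ^ 2) / (4 * real k ^ 2 - 1)) = 1"
proof (induction m)
  case (Suc m)
  have "Suc m * (2 * Suc m choose Suc m) = 2 * Suc m * (Suc (2 * m) choose m)"
    using binomial_absorption[of m "2 * Suc m"] by simp
  then have 1: "2 * Suc m choose Suc m = 2 * (Suc (2 * m) choose m)" 
  proof -
    assume "Suc m * (2 * Suc m choose Suc m) = 2 * Suc m * (Suc (2 * m) choose m)"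
    then have "Suc m * (2 * Suc m choose Suc m) = Suc m * (2 * (Suc (2 * m) choose m))"
      by (simp only: mult_ac)
    then show ?thesis by (simp only: Suc_mult_cancel1)
  qed
  have "(Suc (2 * m) - m) * (Suc (2 * m) choose m) = Suc (2 * m) * (2 * m choose m)"
    using binomial_absorb_comp[of "Suc (2 * m)" m] by simp
  then have 2: "Suc m * (Suc (2 * m) choose m) = Suc (2 * m) * (2 * m choose m)" by (simp add: Suc_diff_le)
  have "real (Suc m) * real (Suc (2 * m) choose m) = real (Suc (2 * m)) * real (2 * m choose m)"
    using 2 by (simp only: of_nat_mult[symmetric])
  then have "real (Suc (2 * m) choose m) = real (Suc (2 * m)) * real (2 * m choose m) / real (Suc m)"
    by (simp add: field_simps del: of_nat_Suc)
  then have h: "real (2 * Suc m choose Suc m) = 2 * (real (Suc (2 * m)) * real (2 * m choose m) / real (Suc m))"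
    unfolding 1 by simp
  have e: "real (2 * Suc m choose Suc m) / 4 ^ Suc m = real (2 * m choose m) / 4 ^ m * ((2 * real m + 1) / (2 * real m + 2))"
  proof -
    have "2 * (s * b / t) / (4 * F) = b / F * (s / (2 * t))" for s b t F :: real by simp
    moreover have "real (Suc (2 * m)) = 2 * real m + 1" "2 * real (Suc m) = 2 * real m + 2" by simp_all
    ultimately show ?thesis unfolding h power_Suc by metis
  qed
  have "4 * real (Suc m) ^ 2 / (4 * real (Suc m) ^ 2 - 1) = (2 * real m + 2)\<^sup>2 / ((2 * real m + 1) * (2 * real m + 3))"
    by (simp add: power2_eq_square algebra_simps)
  moreover have "(\<Prod>k=1..Suc m. (4 * real k ^ 2) / (4 * real k ^ 2 - 1)) =
      (\<Prod>k=1..m. (4 * real k ^ 2) / (4 * real k ^ 2 - 1)) * (4 * real (Suc m) ^ 2 / (4 * real (Suc m) ^ 2 - 1))"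
    by (subst prod.nat_ivl_Suc') (simp, rule mult.commute)
  moreover have "2 * real (Suc m) + 1 = 2 * real m + 3" by simp
  ultimately have "(real (2 * Suc m choose Suc m) / 4 ^ Suc m)\<^sup>2 * (2 * real (Suc m) + 1) * (\<Prod>k=1..Suc m. (4 * real k ^ 2) / (4 * real k ^ 2 - 1)) =
    (real (2 * m choose m) / 4 ^ m * ((2 * real m + 1) / (2 * real m + 2)))\<^sup>2 * (2 * real m + 3) *
    ((\<Prod>k=1..m. (4 * real k ^ 2) / (4 * real k ^ 2 - 1)) * ((2 * real m + 2)\<^sup>2 / ((2 * real m + 1) * (2 * real m + 3))))"
    unfolding e by (simp only:)
  also have "\<dots> = ((real (2 * m choose m) / 4 ^ m)\<^sup>2 * (2 * real m + 1) * (\<Prod>k=1..m. (4 * real k ^ 2) / (4 * real k ^ 2 - 1))) *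
     (((2 * real m + 1) / (2 * real m + 2))\<^sup>2 * (2 * real m + 3) * ((2 * real m + 2)\<^sup>2 / ((2 * real m + 1) * (2 * real m + 3))) / (2 * real m + 1))"
  proof -
    have gen: "(c * r)\<^sup>2 * s3 * (W * q) = (c\<^sup>2 * s1 * W) * (r\<^sup>2 * s3 * q / s1)" if "s1 \<noteq> 0" for c r s3 W q s1 :: real
      using that by (simp add: power_mult_distrib)
    show ?thesis by (rule gen) linarith
  qed
  also have "((2 * real m + 1) / (2 * real m + 2))\<^sup>2 * (2 * real m + 3) * ((2 * real m + 2)\<^sup>2 / ((2 * real m + 1) * (2 * real m + 3))) / (2 * real m + 1) = 1"
  proof -
    have "2 * real m + 1 \<noteq> 0" "2 * real m + 2 \<noteq> 0" "2 * real m + 3 \<noteq> 0" by linarith+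
    then show ?thesis by (simp add: power_divide power2_eq_square)
  qed
  finally show ?case by (simp only: Suc.IH mult_1_left)
qed simp

lemma central_binomial_limit: "(\<lambda>m. (real (2 * m choose m) / 4 ^ m)\<^sup>2 * (2 * real m + 1)) \<longlonglongrightarrow> 2 / pi"
proof -
  have "(\<lambda>m. inverse (\<Prod>k=1..m. (4 * real k ^ 2) / (4 * real k ^ 2 - 1))) \<longlonglongrightarrow> inverse (pi / 2)"
    by (intro tendsto_inverse wallis) simp
  moreover have "inverse (\<Prod>k=1..m. (4 * real k ^ 2) / (4 * real k ^ 2 - 1)) = (real (2 * m choose m) / 4 ^ m)\<^sup>2 * (2 * real m + 1)" for m
    using central_binomial_wallis[of m] by (intro inverse_unique) (simp only: mult_ac)
  ultimately show ?thesis by simp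
qed

definition theta_tail :: "real \<Rightarrow> real" where
  "theta_tail x = (\<Sum>k. exp (- pi * (real k + 1)\<^sup>2 * x))"

lemma summable_exp_linear: "c > 0 \<Longrightarrow> summable (\<lambda>k. exp (- c * (real k + 1)))"
proof -
  assume c: "c > 0"
  have "summable (\<lambda>k. exp (- c) * exp (- c) ^ k)"
    using c by (intro summable_mult summable_geometric) simp
  moreover have "exp (- c) * exp (- c) ^ k = exp (- c * (real k + 1))" for k
    by (simp add: exp_of_nat_mult[symmetric] exp_add[symmetric] algebra_simps)
  ultimately show ?thesis by simp
qed

lemma exp_square_le_linear: "c \<ge> 0 \<Longrightarrow> exp (- c * (real k + 1)\<^sup>2) \<le> exp (- c * (real k + 1))"
  by (simp add: power2_eq_square mult_left_mono)

text \<open>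
  Polya's proof: evaluate \<open>\<Sum>l<n. (2 cos (\<pi> l / n)) ^ (2 m)\<close> by the binomial theorem and let
  \<open>n \<rightarrow> \<infinity>\<close> with \<open>m \<approx> x n\<^sup>2 / \<pi>\<close>.
\<close>
theorem theta_functional_equation:
  assumes x: "x > 0"
  shows "1 + 2 * theta_tail x = (1 + 2 * theta_tail (1 / x)) / sqrt x"
proof -
  define n where "n = (\<lambda>r::nat. 2 * r + 1)"
  \<comment> \<open>This choice serves both sides: \<open>cos (pi k / n) ^ (2 m)\<close> behaves
    like \<open>exp (- pi^2 k^2 m / n^2)\<close> and tends to \<open>exp (- pi k^2 x)\<close>, while
    the binomial ratio at distance \<open>k n\<close> from the centre behaves like
    \<open>exp (- k^2 n^2 / m)\<close> and tends to \<open>exp (- pi k^2 / x)\<close>.\<close>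
  define m where "m = (\<lambda>r. nat \<lfloor>x * real (n r) ^ 2 / pi\<rfloor>)"
  define u where "u = (\<lambda>r. real (m r) / real (n r) ^ 2)"
  have n0: "n r > 0" for r by (simp add: n_def)
  have u_le: "u r \<le> x / pi" for r
  proof -
    have "real (m r) \<le> x * real (n r) ^ 2 / pi" using x by (simp add: m_def)
    then show ?thesis using n0[of r] by (simp add: u_def field_simps)
  qed
  have u_ge: "x / pi - 1 / real (n r) ^ 2 \<le> u r" for r
  proof -
    have "x * real (n r) ^ 2 / pi - 1 \<le> real (m r)" using x by (simp add: m_def)
    then have "(x * real (n r) ^ 2 / pi - 1) / real (n r) ^ 2 \<le> u r"
      unfolding u_def by (intro divide_right_mono) auto
    then show ?thesis using n0[of r] by (simp add: diff_divide_distrib)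
  qed
  have ulim: "u \<longlonglongrightarrow> x / pi"
  proof (rule tendsto_sandwich)
    show "(\<lambda>r. x / pi - 1 / real (n r) ^ 2) \<longlonglongrightarrow> x / pi" unfolding n_def by real_asymp
  qed (use u_le u_ge in auto)
  have u_half: "\<forall>\<^sub>F r in sequentially. u r \<ge> x / (2 * pi)"
    using order_tendstoD(1)[OF ulim, of "x / (2 * pi)"] x by (auto elim!: eventually_mono simp: field_simps)
  have mu: "real (m r) = u r * real (n r) ^ 2" for r using n0[of r] by (simp add: u_def)
  have mlim: "filterlim m at_top sequentially"
  proof -
    have "filterlim (\<lambda>r. real (m r)) at_top sequentially"
      unfolding mu
      by (rule filterlim_tendsto_pos_mult_at_top[OF ulim]) (use x in \<open>auto simp: n_def\<close>, real_asymp)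
    then show ?thesis by (simp add: filterlim_sequentially_iff_filterlim_real)
  qed

  define c where "c = (\<lambda>k r. if k < r then cos (pi * real (k + 1) / real (n r)) ^ (2 * m r) else 0)"
  have clim: "(\<lambda>r. c k r) \<longlonglongrightarrow> exp (- pi * (real k + 1)\<^sup>2 * x)" for k
  proof -
    define b where "b = pi * (real k + 1)"
    have b: "b > 0" by (simp add: b_def add_pos_pos)
    have "(\<lambda>r. 2 * u r * (real (n r) ^ 2 * ln (cos (b / real (n r))))) \<longlonglongrightarrow> 2 * (x / pi) * (- (b * b / 2))"
    proof (intro tendsto_mult tendsto_const ulim)
      show "(\<lambda>r. real (n r) ^ 2 * ln (cos (b / real (n r)))) \<longlonglongrightarrow> - (b * b / 2)"
        unfolding n_def using b by real_asymp
    qed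
    then have "(\<lambda>r. exp (2 * u r * (real (n r) ^ 2 * ln (cos (b / real (n r)))))) \<longlonglongrightarrow> exp (2 * (x / pi) * (- (b * b / 2)))"
      by (rule tendsto_exp)
    moreover have "2 * (x / pi) * (- (b * b / 2)) = - pi * (real k + 1)\<^sup>2 * x"
      by (simp add: b_def power2_eq_square)
    moreover have "\<forall>\<^sub>F r in sequentially. exp (2 * u r * (real (n r) ^ 2 * ln (cos (b / real (n r))))) = c k r"
      using eventually_gt_at_top[of k]
    proof eventually_elim
      case (elim r)
      have "b / real (n r) < pi / 2"
      proof -
        have "(real k + 1) / real (n r) < 1 / 2" using elim by (simp add: n_def field_simps)
        from mult_strict_left_mono[OF this pi_gt_zero] show ?thesis by (simp add: b_def)
      qed
      then have "cos (b / real (n r)) > 0" using b n0[of r] pi_gt_zero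
        by (intro cos_gt_zero_pi) (auto intro: less_trans[of _ 0])
      then have "cos (b / real (n r)) ^ (2 * m r) = exp (real (2 * m r) * ln (cos (b / real (n r))))"
        by (subst exp_of_nat_mult) simp
      also have "real (2 * m r) = 2 * u r * real (n r) ^ 2" by (simp add: mu)
      finally show ?case using elim by (simp add: c_def b_def mult.assoc add.commute)
    qed
    ultimately show ?thesis by (simp add: tendsto_cong)
  qed
  have cbound: "\<forall>\<^sub>F r in sequentially. \<forall>k. norm (c k r) \<le> exp (- (pi * x / 3) * (real k + 1))"
    using u_half
  proof (eventually_elim, intro allI)
    fix r k assume u: "u r \<ge> x / (2 * pi)"
    show "norm (c k r) \<le> exp (- (pi * x / 3) * (real k + 1))"
    proof (cases "k < r")
      case True
      define t where "t = pi * real (k + 1) / real (n r)"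
      have "real (k + 1) / real (n r) \<le> 1 / 2" using True by (simp add: n_def field_simps)
      from mult_left_mono[OF this pi_ge_zero] have t: "0 \<le> t" "t \<le> pi / 2" by (simp_all add: t_def)
      have "norm (c k r) = cos t ^ (2 * m r)" using True by (simp add: c_def t_def)
      also have "\<dots> \<le> exp (- t\<^sup>2 / 3) ^ (2 * m r)"
        using t by (intro power_mono cos_le_exp cos_ge_zero) auto
      also have "\<dots> = exp (- (2 * real (m r) * t\<^sup>2 / 3))" by (simp add: exp_of_nat_mult[symmetric])
      also have "real (m r) * t\<^sup>2 = u r * pi\<^sup>2 * (real k + 1)\<^sup>2"
        using n0[of r] unfolding mu t_def by (simp add: power_divide power_mult_distrib add.commute)
      then have "exp (- (2 * real (m r) * t\<^sup>2 / 3)) = exp (- (2 * (u r * pi\<^sup>2 * (real k + 1)\<^sup>2) / 3))"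
        by (simp only: mult.assoc)
      also have "\<dots> \<le> exp (- (pi * x / 3) * (real k + 1)\<^sup>2)"
      proof -
        have "x \<le> 2 * pi * u r" using u by (simp add: field_simps)
        then have "pi * (real k + 1)\<^sup>2 * x \<le> pi * (real k + 1)\<^sup>2 * (2 * pi * u r)" by (intro mult_left_mono) auto
        then have "pi * x * (real k + 1)\<^sup>2 \<le> 2 * (u r * pi\<^sup>2 * (real k + 1)\<^sup>2)"
          by (simp only: power2_eq_square mult_ac)
        moreover have "pi * x / 3 * (real k + 1)\<^sup>2 = pi * x * (real k + 1)\<^sup>2 / 3" by simp
        ultimately show ?thesis unfolding exp_le_cancel_iff by linarith
      qed
      also have "\<dots> \<le> exp (- (pi * x / 3) * (real k + 1))" using x by (intro exp_square_le_linear) simp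
      finally show ?thesis .
    qed (simp add: c_def)
  qed
  have L: "(\<lambda>r. suminf (\<lambda>k. c k r)) \<longlonglongrightarrow> theta_tail x"
    unfolding theta_tail_def
  proof (rule tannerys_theorem[THEN conjunct2, THEN conjunct2])
    show "\<forall>\<^sub>F (k, r) in at_top \<times>\<^sub>F sequentially. norm (c k r) \<le> exp (- (pi * x / 3) * (real k + 1))"
      unfolding eventually_prod_filter using cbound
      by (intro exI[of _ "\<lambda>_. True"] exI[of _ "\<lambda>r. \<forall>k. norm (c k r) \<le> exp (- (pi * x / 3) * (real k + 1))"]) auto
    show "summable (\<lambda>k. exp (- (pi * x / 3) * (real k + 1)))"
      using x by (intro summable_exp_linear) simp
  qed (use clim in auto)

  have kn: "real ((k + 1) * n r) = (real k + 1) * real (n r)" for k r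
    by (simp add: distrib_right)
  define d where "d = (\<lambda>k r. if (k + 1) * n r \<le> m r then
     real (2 * m r choose (m r + (k + 1) * n r)) / real (2 * m r choose m r) else 0)"
  have dlim: "(\<lambda>r. d k r) \<longlonglongrightarrow> exp (- pi * (real k + 1)\<^sup>2 * (1 / x))" for k
  proof (rule tendsto_sandwich)
    have inv: "(\<lambda>r. 1 / real (n r)) \<longlonglongrightarrow> 0" unfolding n_def by real_asymp
    have ne: "x / pi \<noteq> 0" using x by simp
    have val: "- pi * (real k + 1)\<^sup>2 * (1 / x) = - (real k + 1)\<^sup>2 / (x / pi)" by simp
    have "(\<lambda>r. exp (- (real k + 1)\<^sup>2 / (u r - (real k + 1) * (1 / real (n r))))) \<longlonglongrightarrow>
            exp (- (real k + 1)\<^sup>2 / (x / pi - (real k + 1) * 0))"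
      by (intro tendsto_intros ulim inv) (use ne in simp)
    then show "(\<lambda>r. exp (- (real k + 1)\<^sup>2 / (u r - (real k + 1) * (1 / real (n r))))) \<longlonglongrightarrow>
            exp (- pi * (real k + 1)\<^sup>2 * (1 / x))" unfolding val by simp
    have "(\<lambda>r. exp (- (real k + 1)\<^sup>2 / (u r + (real k + 1) * (1 / real (n r))))) \<longlonglongrightarrow>
            exp (- (real k + 1)\<^sup>2 / (x / pi + (real k + 1) * 0))"
      by (intro tendsto_intros ulim inv) (use ne in simp)
    then show "(\<lambda>r. exp (- (real k + 1)\<^sup>2 / (u r + (real k + 1) * (1 / real (n r))))) \<longlonglongrightarrow>
            exp (- pi * (real k + 1)\<^sup>2 * (1 / x))" unfolding val by simp
    have ev: "\<forall>\<^sub>F r in sequentially. (k + 1) * n r < m r"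
    proof -
      have "(\<lambda>r. u r - (real k + 1) * (1 / real (n r))) \<longlonglongrightarrow> x / pi - (real k + 1) * 0"
        by (intro tendsto_intros ulim inv)
      then have "\<forall>\<^sub>F r in sequentially. u r - (real k + 1) * (1 / real (n r)) > 0"
        by (rule order_tendstoD(1)) (use x in simp)
      then show ?thesis
      proof eventually_elim
        case (elim r)
        have "0 < (u r - (real k + 1) * (1 / real (n r))) * real (n r) ^ 2"
          using elim n0[of r] by simp
        also have "\<dots> = real (m r) - real ((k + 1) * n r)"
          using n0[of r] unfolding mu by (simp add: field_simps power2_eq_square)
        finally have "real ((k + 1) * n r) < real (m r)" by linarith
        then show ?case by (simp only: of_nat_less_iff)
      qed
    qed
    \<comment> \<open>The values \<open>-1\<close> and \<open>1\<close> of \<open>s\<close> give the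
      exponents in the lower and the upper bound of the binomial ratio.\<close>
    have scale: "(real ((k + 1) * n r))\<^sup>2 / (real (m r) + s * real ((k + 1) * n r)) =
        (real k + 1)\<^sup>2 / (u r + s * (real k + 1) * (1 / real (n r)))" for r s
    proof -
      have "real (m r) + s * real ((k + 1) * n r) = (u r + s * (real k + 1) * (1 / real (n r))) * real (n r) ^ 2"
        using n0[of r] unfolding mu by (simp add: field_simps power2_eq_square)
      moreover have "(real ((k + 1) * n r))\<^sup>2 = (real k + 1)\<^sup>2 * real (n r) ^ 2"
        by (simp only: kn power_mult_distrib)
      ultimately show ?thesis using n0[of r] by simp
    qed
    show "\<forall>\<^sub>F r in sequentially. exp (- (real k + 1)\<^sup>2 / (u r - (real k + 1) * (1 / real (n r)))) \<le> d k r"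
      using ev
    proof eventually_elim
      case (elim r)
      show ?case using central_binomial_ratio_ge[OF elim] scale[of r "-1"] elim
        by (simp only: d_def less_imp_le if_True minus_divide_left[symmetric]) (simp only: mult_minus1 mult_minus_left mult_1_left add_uminus_conv_diff)
    qed
    show "\<forall>\<^sub>F r in sequentially. d k r \<le> exp (- (real k + 1)\<^sup>2 / (u r + (real k + 1) * (1 / real (n r))))"
      using ev
    proof eventually_elim
      case (elim r)
      show ?case using central_binomial_ratio_le[OF less_imp_le[OF elim]] scale[of r 1] elim
        by (simp only: d_def less_imp_le if_True minus_divide_left[symmetric]) (simp only: mult_1_left)
    qed
  qed
  have dbound: "norm (d k r) \<le> exp (- (pi / (2 * x)) * (real k + 1))" for k r
  proof (cases "(k + 1) * n r \<le> m r")
    case True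
    let ?j = "real ((k + 1) * n r)"
    have j: "?j > 0" unfolding kn using n0[of r] by (intro mult_pos_pos) auto
    have jm: "?j \<le> real (m r)" using True by (simp only: of_nat_le_iff)
    have "norm (d k r) = real (2 * m r choose (m r + (k + 1) * n r)) / real (2 * m r choose m r)"
      using True by (simp add: d_def)
    also have "\<dots> \<le> exp (- ?j\<^sup>2 / (real (m r) + ?j))" by (rule central_binomial_ratio_le[OF True])
    also have "\<dots> \<le> exp (- (pi / (2 * x)) * (real k + 1)\<^sup>2)"
    proof -
      have jj: "?j\<^sup>2 = (real k + 1)\<^sup>2 * real (n r) ^ 2" by (simp only: kn power_mult_distrib)
      have "real (m r) * pi \<le> x * real (n r) ^ 2"
        using u_le[of r] n0[of r] unfolding u_def by (simp add: field_simps)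
      then have "(real (m r) + ?j) * pi \<le> 2 * x * real (n r) ^ 2"
        using mult_right_mono[OF jm, of pi] by (simp only: distrib_right) (use pi_gt_zero in linarith)
      then have "(real k + 1)\<^sup>2 * ((real (m r) + ?j) * pi) \<le> (real k + 1)\<^sup>2 * (2 * x * real (n r) ^ 2)"
        by (intro mult_left_mono) auto
      then have h1: "pi * (real k + 1)\<^sup>2 * (real (m r) + ?j) \<le> ?j\<^sup>2 * (2 * x)" unfolding jj by (simp only: mult_ac)
      have h2: "real (m r) + ?j > 0" using j jm by linarith
      have "pi * (real k + 1)\<^sup>2 / (2 * x) \<le> ?j\<^sup>2 / (real (m r) + ?j)"
      proof -
        have gen: "a / y \<le> b / z" if "a * z \<le> b * y" "z > 0" "y > 0" for a b y z :: real
          using that by (simp add: field_simps)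
        show ?thesis by (rule gen[OF h1 h2]) (use x in simp)
      qed
      then show ?thesis by simp
    qed
    also have "\<dots> \<le> exp (- (pi / (2 * x)) * (real k + 1))" using x by (intro exp_square_le_linear) simp
    finally show ?thesis .
  qed (simp add: d_def)
  have R: "(\<lambda>r. suminf (\<lambda>k. d k r)) \<longlonglongrightarrow> theta_tail (1 / x)"
    unfolding theta_tail_def
  proof (rule tannerys_theorem[THEN conjunct2, THEN conjunct2])
    show "\<forall>\<^sub>F (k, r) in at_top \<times>\<^sub>F sequentially. norm (d k r) \<le> exp (- (pi / (2 * x)) * (real k + 1))"
      using dbound by (intro always_eventually) auto
    show "summable (\<lambda>k. exp (- (pi / (2 * x)) * (real k + 1)))"
      using x by (intro summable_exp_linear) simp
  qed (use dlim in auto)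

  \<comment> \<open>The factor left over once the central binomial coefficient is taken out. Its
    square tends to \<open>(2 / pi) / (2 * x / pi) = 1 / x\<close> by the Wallis limit, which is the
    origin of \<open>1 / sqrt x\<close>.\<close>
  define w where "w = (\<lambda>r. real (n r) * (real (2 * m r choose m r) / 4 ^ m r))"
  have wlim: "w \<longlonglongrightarrow> 1 / sqrt x"
  proof -
    have "(\<lambda>r. (real (2 * m r choose m r) / 4 ^ m r)\<^sup>2 * (2 * real (m r) + 1)) \<longlonglongrightarrow> 2 / pi"
      using filterlim_compose[OF central_binomial_limit mlim] .
    moreover have "(\<lambda>r. 1 / real (n r) ^ 2) \<longlonglongrightarrow> 0" unfolding n_def by real_asymp
    ultimately have "(\<lambda>r. (real (2 * m r choose m r) / 4 ^ m r)\<^sup>2 * (2 * real (m r) + 1) / (2 * u r + 1 / real (n r) ^ 2))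
        \<longlonglongrightarrow> 2 / pi / (2 * (x / pi) + 0)"
      by (intro tendsto_intros ulim) (use x in auto)
    moreover have "(real (2 * m r choose m r) / 4 ^ m r)\<^sup>2 * (2 * real (m r) + 1) / (2 * u r + 1 / real (n r) ^ 2) = w r ^ 2" for r
    proof -
      have "2 * real (m r) + 1 = (2 * u r + 1 / real (n r) ^ 2) * real (n r) ^ 2"
        using n0[of r] unfolding mu by (simp add: field_simps)
      moreover have "2 * u r + 1 / real (n r) ^ 2 > 0" using n0[of r] by (simp add: u_def add_nonneg_pos)
      ultimately show ?thesis by (simp add: w_def power_mult_distrib power_divide mult_ac)
    qed
    ultimately have "(\<lambda>r. sqrt (w r ^ 2)) \<longlonglongrightarrow> sqrt (1 / x)" using tendsto_real_sqrt by fastforce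
    moreover have "w r \<ge> 0" for r by (simp add: w_def)
    ultimately show ?thesis by (simp add: real_sqrt_divide)
  qed
  have "1 + 2 * suminf (\<lambda>k. c k r) = w r * (1 + 2 * suminf (\<lambda>k. d k r))" for r
  proof -
    have "suminf (\<lambda>k. c k r) = (\<Sum>k<r. c k r)" by (rule suminf_finite) (auto simp: c_def)
    also have "\<dots> = (\<Sum>k<r. cos (pi * real (k + 1) / real (n r)) ^ (2 * m r))" by (simp add: c_def)
    finally have "1 + 2 * suminf (\<lambda>k. c k r) = (\<Sum>l<n r. cos (pi * real l / real (n r)) ^ (2 * m r))"
      unfolding n_def by (simp only: sum_cos_fold)
    also have "4 ^ m r * \<dots> = (\<Sum>l<n r. (2 * cos (pi * real l / real (n r))) ^ (2 * m r))"
      by (simp add: power_mult_distrib sum_distrib_left power_mult)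
    also have "\<dots> = real (n r) * (real (2 * m r choose m r) + 2 * (\<Sum>k. if (k + 1) * n r \<le> m r then real (2 * m r choose (m r + (k + 1) * n r)) else 0))"
      unfolding Polya_identity[OF n0] sum_multiples[OF n0] ..
    also have "(\<Sum>k. if (k + 1) * n r \<le> m r then real (2 * m r choose (m r + (k + 1) * n r)) else 0) =
       real (2 * m r choose m r) * suminf (\<lambda>k. d k r)"
    proof -
      have "summable (\<lambda>k. d k r)"
        by (rule summable_comparison_test'[OF summable_exp_linear[of "pi / (2 * x)"]]) (use dbound x in auto)
      then have "real (2 * m r choose m r) * suminf (\<lambda>k. d k r) = (\<Sum>k. real (2 * m r choose m r) * d k r)"
        by (rule suminf_mult[symmetric])
      also have "(\<lambda>k. real (2 * m r choose m r) * d k r) = (\<lambda>k. if (k + 1) * n r \<le> m r then real (2 * m r choose (m r + (k + 1) * n r)) else 0)"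
        by (auto simp: d_def fun_eq_iff)
      finally show ?thesis ..
    qed
    finally have "4 ^ m r * (1 + 2 * suminf (\<lambda>k. c k r)) =
        real (n r) * (real (2 * m r choose m r) + 2 * (real (2 * m r choose m r) * suminf (\<lambda>k. d k r)))" .
    also have "\<dots> = (4 ^ m r * w r) * (1 + 2 * suminf (\<lambda>k. d k r))"
    proof -
      have "4 ^ m r * w r = real (n r) * real (2 * m r choose m r)" by (simp add: w_def)
      then show ?thesis by (simp add: algebra_simps)
    qed
    finally have "4 ^ m r * (1 + 2 * suminf (\<lambda>k. c k r)) = 4 ^ m r * (w r * (1 + 2 * suminf (\<lambda>k. d k r)))"
      by (simp only: mult.assoc)
    then show ?thesis by simp
  qed
  moreover have "(\<lambda>r. 1 + 2 * suminf (\<lambda>k. c k r)) \<longlonglongrightarrow> 1 + 2 * theta_tail x" by (intro tendsto_intros L)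
  moreover have "(\<lambda>r. w r * (1 + 2 * suminf (\<lambda>k. d k r))) \<longlonglongrightarrow> 1 / sqrt x * (1 + 2 * theta_tail (1 / x))"
    by (intro tendsto_intros R wlim)
  ultimately show ?thesis by (simp add: LIMSEQ_unique)
qed

section \<open>Riemann's integral\<close>

lemma power_le_fact_exp:
  fixes t :: real
  assumes "t \<ge> 0"
  shows "t ^ n \<le> fact n * exp t"
proof -
  have "(\<lambda>k. t ^ k /\<^sub>R fact k) sums exp t" by (rule exp_converges)
  then have "(\<Sum>k\<in>{n}. t ^ k /\<^sub>R fact k) \<le> exp t"
    using sum_le_suminf[OF sums_summable, of "\<lambda>k. t ^ k /\<^sub>R fact k" "exp t" "{n}"] assms by (simp add: sums_iff)
  then show ?thesis by (simp add: field_simps)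
qed

text \<open>Up to the factor \<open>(- pi) ^ j\<close> this is the \<open>j\<close>-th derivative of
  \<open>theta_tail\<close>.\<close>

definition theta_mom :: "nat \<Rightarrow> real \<Rightarrow> real" where
  "theta_mom j x = (\<Sum>k. (real k + 1) ^ (2 * j) * exp (- pi * (real k + 1)\<^sup>2 * x))"

lemma theta_tail_eq: "theta_tail = theta_mom 0"
  by (simp add: theta_tail_def theta_mom_def fun_eq_iff)

lemma summable_theta_mom:
  assumes "x > 0"
  shows "summable (\<lambda>k. (real k + 1) ^ (2 * j) * exp (- pi * (real k + 1)\<^sup>2 * x))"
proof (rule summable_comparison_test'[OF summable_const_over_square])
  fix k :: nat
  define y where "y = (real k + 1)\<^sup>2"
  have y: "y > 0" by (simp add: y_def add_pos_pos)
  have "(pi * x * y) ^ Suc j \<le> fact (Suc j) * exp (pi * x * y)"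
    using assms y by (intro power_le_fact_exp) simp
  then have "(pi * x) ^ Suc j * (y ^ j * y) * exp (- (pi * x * y)) \<le> fact (Suc j)"
    by (simp add: power_mult_distrib exp_minus field_simps)
  then have "y ^ j * exp (- (pi * x * y)) \<le> fact (Suc j) / (pi * x) ^ Suc j / y"
    using assms y by (simp add: field_simps)
  moreover have "norm ((real k + 1) ^ (2 * j) * exp (- pi * (real k + 1)\<^sup>2 * x)) = y ^ j * exp (- (pi * x * y))"
  proof -
    have "(real k + 1) ^ (2 * j) = y ^ j" unfolding y_def by (rule power_mult)
    moreover have "- pi * (real k + 1)\<^sup>2 * x = - (pi * x * y)" by (simp add: y_def)
    ultimately show ?thesis using y by (simp only: norm_mult real_norm_def abs_exp_cancel) simp
  qed
  ultimately show "norm ((real k + 1) ^ (2 * j) * exp (- pi * (real k + 1)\<^sup>2 * x)) \<le> fact (Suc j) / (pi * x) ^ Suc j / (real k + 1)\<^sup>2"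
    by (simp only: y_def)
qed

lemma has_field_derivative_theta_mom:
  assumes x: "x > 0"
  shows "(theta_mom j has_field_derivative - pi * theta_mom (Suc j) x) (at x)"
proof -
  let ?f = "\<lambda>k x. (real k + 1) ^ (2 * j) * exp (- pi * (real k + 1)\<^sup>2 * x)"
  let ?f' = "\<lambda>k x. - pi * ((real k + 1) ^ (2 * Suc j) * exp (- pi * (real k + 1)\<^sup>2 * x))"
  have "((\<lambda>x. \<Sum>k. ?f k x) has_field_derivative (\<Sum>k. ?f' k x)) (at x)"
  proof (rule has_field_derivative_series'(2))
    show "convex {x / 2<..}" by simp
    show "(?f k has_field_derivative ?f' k y) (at y within {x / 2<..})" for k y
      by (auto intro!: derivative_eq_intros simp: power2_eq_square)
    show "uniformly_convergent_on {x / 2<..} (\<lambda>n y. \<Sum>i<n. ?f' i y)"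
    proof (rule Weierstrass_m_test')
      show "summable (\<lambda>k. pi * ((real k + 1) ^ (2 * Suc j) * exp (- pi * (real k + 1)\<^sup>2 * (x / 2))))"
        using x by (intro summable_mult summable_theta_mom) simp
      fix k y assume "y \<in> {x / 2<..}"
      then have "pi * (real k + 1)\<^sup>2 * (x / 2) \<le> pi * (real k + 1)\<^sup>2 * y" by (intro mult_left_mono) auto
      then show "norm (?f' k y) \<le> pi * ((real k + 1) ^ (2 * Suc j) * exp (- pi * (real k + 1)\<^sup>2 * (x / 2)))"
        by (simp add: abs_mult)
    qed
    show "summable (\<lambda>k. ?f k x)" using x by (rule summable_theta_mom)
    show "x \<in> interior {x / 2<..}" using x by (subst interior_open) auto
  qed (use x in auto)
  moreover have "(\<Sum>k. ?f' k x) = - pi * theta_mom (Suc j) x"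
    unfolding theta_mom_def by (rule suminf_mult[OF summable_theta_mom[OF x]])
  ultimately show ?thesis by (simp add: theta_mom_def[abs_def])
qed

lemma continuous_on_theta_mom: "continuous_on {0<..} (theta_mom j)"
  by (rule DERIV_continuous_on) (auto intro: has_field_derivative_at_within has_field_derivative_theta_mom)

lemma theta_reciprocal:
  assumes "x > 0"
  shows "1 + 2 * theta_mom 0 (1 / x) = sqrt x * (1 + 2 * theta_mom 0 x)"
  using theta_functional_equation[OF assms] assms by (simp add: theta_tail_eq field_simps)

text \<open>The derivative of \<open>theta_reciprocal\<close>, solved for the moment at
  \<open>1 / x\<close>; one more differentiation gives the second moment.\<close>

lemma theta_mom_1_reciprocal:
  assumes x: "x > 0"
  shows "theta_mom 1 (1 / x) = x * sqrt x * (1 + 2 * theta_mom 0 x) / (4 * pi) - x\<^sup>2 * sqrt x * theta_mom 1 x"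
proof -
  note D = has_field_derivative_theta_mom
  have 1: "((\<lambda>x. 1 + 2 * theta_mom 0 (1 / x)) has_field_derivative (2 * pi * theta_mom 1 (1 / x) / x\<^sup>2)) (at x)"
    using x by (auto intro!: derivative_eq_intros DERIV_chain2[OF D] simp: power2_eq_square field_simps)
  have "((\<lambda>x. sqrt x * (1 + 2 * theta_mom 0 x)) has_field_derivative
      ((1 + 2 * theta_mom 0 x) / (2 * sqrt x) - 2 * pi * sqrt x * theta_mom 1 x)) (at x)"
    using x by (auto intro!: derivative_eq_intros D simp: field_simps)
  then have "((\<lambda>x. 1 + 2 * theta_mom 0 (1 / x)) has_field_derivative
      ((1 + 2 * theta_mom 0 x) / (2 * sqrt x) - 2 * pi * sqrt x * theta_mom 1 x)) (at x)"
    by (rule has_field_derivative_transform_within_open[where S = "{0<..}"]) (use x theta_reciprocal in auto)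
  with 1 have "2 * pi * theta_mom 1 (1 / x) / x\<^sup>2 = (1 + 2 * theta_mom 0 x) / (2 * sqrt x) - 2 * pi * sqrt x * theta_mom 1 x"
    by (rule DERIV_unique)
  then have "theta_mom 1 (1 / x) = x\<^sup>2 / (2 * pi) * ((1 + 2 * theta_mom 0 x) / (2 * sqrt x) - 2 * pi * sqrt x * theta_mom 1 x)"
    using x by (simp add: field_simps)
  also have "\<dots> = (x / sqrt x) * x * (1 + 2 * theta_mom 0 x) / (4 * pi) - x\<^sup>2 * sqrt x * theta_mom 1 x"
    by (simp add: power2_eq_square right_diff_distrib)
  also have "x / sqrt x = sqrt x" using x by (simp add: real_div_sqrt)
  finally show ?thesis by (simp add: mult_ac)
qed

lemma theta_mom_2_reciprocal:
  assumes x: "x > 0"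
  shows "pi * theta_mom 2 (1 / x) = 3 * x\<^sup>2 * sqrt x * (1 + 2 * theta_mom 0 x) / (8 * pi)
     - 3 * x ^ 3 * sqrt x * theta_mom 1 x + pi * x ^ 4 * sqrt x * theta_mom 2 x"
proof -
  note D0 = has_field_derivative_theta_mom[of _ 0, simplified]
  note D1 = has_field_derivative_theta_mom[of _ "Suc 0", simplified]
  define s where "s = sqrt x"
  have s: "s > 0" "x = s * s" using x by (simp_all add: s_def)
  have 1: "((\<lambda>x. theta_mom 1 (1 / x)) has_field_derivative (pi * theta_mom 2 (1 / x) / x\<^sup>2)) (at x)"
  proof -
    have "((\<lambda>x. 1 / x) has_field_derivative - 1 / x\<^sup>2) (at x)"
      using x by (auto intro!: derivative_eq_intros simp: power2_eq_square)
    from DERIV_chain2[OF D1[of "1 / x"] this] show ?thesis using x by (simp add: numeral_2_eq_2)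
  qed
  have "((\<lambda>x. x * sqrt x * (1 + 2 * theta_mom 0 x) / (4 * pi) - x\<^sup>2 * sqrt x * theta_mom 1 x) has_field_derivative
      (3 * s * (1 + 2 * theta_mom 0 x) / (8 * pi) - 3 * x * s * theta_mom 1 x + pi * x\<^sup>2 * s * theta_mom 2 x)) (at x)"
  proof -
    have "((\<lambda>x. x * sqrt x) has_field_derivative 3 / 2 * s) (at x)"
      using x by (auto intro!: derivative_eq_intros simp: s_def real_div_sqrt field_simps)
    moreover have "((\<lambda>x. x\<^sup>2 * sqrt x) has_field_derivative 5 / 2 * (x * s)) (at x)"
    proof -
      have "((\<lambda>x. x\<^sup>2 * sqrt x) has_field_derivative (2 * x * s + x\<^sup>2 / (2 * s))) (at x)"
        using x by (auto intro!: derivative_eq_intros simp: s_def field_simps)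
      moreover have "x\<^sup>2 / (2 * s) = x * s / 2" unfolding s using s(1) by (simp add: power2_eq_square)
      moreover have "2 * x * s + x * s / 2 = 5 / 2 * (x * s)" by simp
      ultimately show ?thesis by metis
    qed
    ultimately have "((\<lambda>x. x * sqrt x * (1 + 2 * theta_mom 0 x) / (4 * pi) - x\<^sup>2 * sqrt x * theta_mom 1 x) has_field_derivative
       ((3 / 2 * s * (1 + 2 * theta_mom 0 x) + 2 * (- pi * theta_mom 1 x) * (x * sqrt x)) / (4 * pi) -
        (5 / 2 * (x * s) * theta_mom 1 x + (- pi * theta_mom 2 x) * (x\<^sup>2 * sqrt x)))) (at x)"
      using D0[OF x] D1[OF x]
      by (intro DERIV_diff DERIV_cdivide DERIV_mult) (auto intro!: derivative_eq_intros simp: numeral_2_eq_2)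
    moreover have "((3 / 2 * s * (1 + 2 * theta_mom 0 x) + 2 * (- pi * theta_mom 1 x) * (x * sqrt x)) / (4 * pi) -
        (5 / 2 * (x * s) * theta_mom 1 x + (- pi * theta_mom 2 x) * (x\<^sup>2 * sqrt x))) =
        3 * s * (1 + 2 * theta_mom 0 x) / (8 * pi) - 3 * x * s * theta_mom 1 x + pi * x\<^sup>2 * s * theta_mom 2 x"
      unfolding s_def[symmetric] by (simp add: field_simps)
    ultimately show ?thesis by simp
  qed
  then have "((\<lambda>x. theta_mom 1 (1 / x)) has_field_derivative
      (3 * s * (1 + 2 * theta_mom 0 x) / (8 * pi) - 3 * x * s * theta_mom 1 x + pi * x\<^sup>2 * s * theta_mom 2 x)) (at x)"
    by (rule has_field_derivative_transform_within_open[where S = "{0<..}"]) (use x theta_mom_1_reciprocal in auto)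
  with 1 have "pi * theta_mom 2 (1 / x) / x\<^sup>2 =
     3 * s * (1 + 2 * theta_mom 0 x) / (8 * pi) - 3 * x * s * theta_mom 1 x + pi * x\<^sup>2 * s * theta_mom 2 x"
    by (rule DERIV_unique)
  then have "pi * theta_mom 2 (1 / x) = x\<^sup>2 *
     (3 * s * (1 + 2 * theta_mom 0 x) / (8 * pi) - 3 * x * s * theta_mom 1 x + pi * x\<^sup>2 * s * theta_mom 2 x)"
    using x by (simp add: field_simps)
  then show ?thesis unfolding s_def[symmetric]
    by (simp add: right_diff_distrib distrib_left power_add[symmetric] power2_eq_square eval_nat_numeral mult_ac)
qed

text \<open>The kernel of Riemann's integral for \<open>\<Xi>\<close>, in the variable \<open>x = exp (2 u)\<close>.\<close>
definition Psi :: "real \<Rightarrow> real" where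
  "Psi x = 4 * pi\<^sup>2 * x\<^sup>2 * theta_mom 2 x - 6 * pi * x * theta_mom 1 x"

text \<open>The coefficients of \<open>Psi\<close> are such that the two contributions of
  \<open>1 + 2 * theta_mom 0 x\<close>, each \<open>3 / 2 * sqrt x\<close> times it, cancel. So the
  constant term of the theta series leaves no trace and the symmetry is exact.\<close>

lemma Psi_reciprocal:
  assumes x: "x > 0"
  shows "Psi (1 / x) = sqrt x * Psi x"
proof -
  have "Psi (1 / x) = 4 * pi / x\<^sup>2 * (pi * theta_mom 2 (1 / x)) - 6 * pi / x * theta_mom 1 (1 / x)"
    by (simp add: Psi_def power_divide power2_eq_square)
  also have "\<dots> = 4 * pi / x\<^sup>2 * (3 * x\<^sup>2 * sqrt x * (1 + 2 * theta_mom 0 x) / (8 * pi)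
     - 3 * x ^ 3 * sqrt x * theta_mom 1 x + pi * x ^ 4 * sqrt x * theta_mom 2 x)
     - 6 * pi / x * (x * sqrt x * (1 + 2 * theta_mom 0 x) / (4 * pi) - x\<^sup>2 * sqrt x * theta_mom 1 x)"
    unfolding theta_mom_1_reciprocal[OF x] theta_mom_2_reciprocal[OF x] ..
  also have "\<dots> = sqrt x * Psi x"
  proof -
    have "4 * p / x\<^sup>2 * (3 * x\<^sup>2 * s * t / (8 * p) - 3 * x ^ 3 * s * a + p * x ^ 4 * s * b)
       - 6 * p / x * (x * s * t / (4 * p) - x\<^sup>2 * s * a) = s * (4 * p\<^sup>2 * x\<^sup>2 * b - 6 * p * x * a)"
      if "p > 0" for p s t a b :: real
      using x that by (simp add: field_simps eval_nat_numeral)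
    from this[of pi] show ?thesis by (simp add: Psi_def)
  qed
  finally show ?thesis .
qed

lemma continuous_on_Psi: "continuous_on {0<..} Psi"
  unfolding Psi_def[abs_def] by (intro continuous_intros continuous_on_theta_mom)

lemma Psi_sums:
  assumes "x > 0"
  shows "(\<lambda>k. 4 * pi\<^sup>2 * x\<^sup>2 * ((real k + 1) ^ 4 * exp (- pi * (real k + 1)\<^sup>2 * x)) -
              6 * pi * x * ((real k + 1)\<^sup>2 * exp (- pi * (real k + 1)\<^sup>2 * x))) sums Psi x"
  unfolding Psi_def theta_mom_def
  using summable_theta_mom[OF assms, of 2] summable_theta_mom[OF assms, of 1]
  by (intro sums_diff sums_mult) (simp_all add: summable_sums)

text \<open>For \<open>x \<ge> 1\<close> every term of the series is positive by itself: its sign is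
  that of \<open>2 * pi * x * (k + 1)^2 - 3\<close>. For small \<open>x\<close> single terms are
  negative, and positivity is transported by the symmetry instead.\<close>

lemma Psi_pos_ge_1:
  assumes "x \<ge> 1"
  shows "Psi x > 0"
proof -
  have x: "x > 0" using assms by simp
  note sums = Psi_sums[OF x]
  have "4 * pi\<^sup>2 * x\<^sup>2 * ((real k + 1) ^ 4 * exp (- pi * (real k + 1)\<^sup>2 * x)) -
              6 * pi * x * ((real k + 1)\<^sup>2 * exp (- pi * (real k + 1)\<^sup>2 * x)) > 0" for k
  proof -
    define y where "y = (real k + 1)\<^sup>2"
    have "1 ^ 2 \<le> (real k + 1)\<^sup>2" by (intro power_mono) auto
    then have y: "y \<ge> 1" by (simp add: y_def)
    have "pi * 1 \<le> pi * (x * y)" using assms y mult_mono[of 1 x 1 y] by (intro mult_left_mono) auto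
    then have gt: "2 * (pi * x * y) - 3 > 0" using pi_gt3 by (simp only: mult.assoc mult_1_right)
    have "(real k + 1) ^ 4 = y\<^sup>2" by (simp add: y_def power_mult[symmetric])
    then have "4 * pi\<^sup>2 * x\<^sup>2 * ((real k + 1) ^ 4 * exp (- pi * (real k + 1)\<^sup>2 * x)) -
              6 * pi * x * ((real k + 1)\<^sup>2 * exp (- pi * (real k + 1)\<^sup>2 * x)) =
          2 * pi * x * y * (2 * (pi * x * y) - 3) * exp (- pi * y * x)"
      unfolding y_def[symmetric] by (simp add: power2_eq_square algebra_simps)
    also have "\<dots> > 0" using gt x y by (intro mult_pos_pos) auto
    finally show ?thesis .
  qed
  then show ?thesis using suminf_pos[OF sums_summable[OF sums]] sums_unique[OF sums] by simp
qed

lemma Psi_pos: "x > 0 \<Longrightarrow> Psi x > 0"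
proof (cases "x \<ge> 1")
  case False
  assume x: "x > 0"
  then have "Psi (1 / x) > 0" using False by (intro Psi_pos_ge_1) simp
  then show ?thesis using x by (simp add: Psi_reciprocal zero_less_mult_iff)
qed (rule Psi_pos_ge_1)

lemma Psi_le_exp: "\<exists>C>0. \<forall>x\<ge>1. Psi x \<le> C * exp (- x)"
proof (intro exI conjI allI impI)
  let ?S = "\<Sum>k. exp (- 1 * (real k + 1))"
  have sS: "summable (\<lambda>k. exp (- 1 * (real k + 1)))" by (intro summable_exp_linear) simp
  show "8 * pi\<^sup>2 * ?S > 0" using suminf_pos[OF sS] by simp
  fix x :: real assume x1: "x \<ge> 1"
  then have x: "x > 0" by simp
  have sm: "summable (\<lambda>k. (real k + 1) ^ 4 * exp (- pi * (real k + 1)\<^sup>2 * x))"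
    using summable_theta_mom[OF x, of 2] by simp
  have "theta_mom 1 x \<ge> 0" unfolding theta_mom_def by (intro suminf_nonneg summable_theta_mom x) auto
  then have "Psi x \<le> 4 * pi\<^sup>2 * (x\<^sup>2 * theta_mom 2 x)" using x by (simp add: Psi_def)
  also have "x\<^sup>2 * theta_mom 2 x = (\<Sum>k. x\<^sup>2 * ((real k + 1) ^ 4 * exp (- pi * (real k + 1)\<^sup>2 * x)))"
    unfolding theta_mom_def using suminf_mult[OF sm, of "x\<^sup>2"] by simp
  also have "\<dots> \<le> (\<Sum>k. 2 * exp (- x) * exp (- 1 * (real k + 1)))"
  proof (intro suminf_le summable_mult sm sS)
    fix k :: nat
    define y where "y = (real k + 1)\<^sup>2"
    have yk: "y \<ge> real k + 1" by (simp add: y_def power2_eq_square)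
    have y1: "y \<ge> 1" using yk by linarith
    have "x\<^sup>2 * (y\<^sup>2 * exp (- pi * y * x)) = (x * y) ^ 2 * exp (- pi * y * x)" by (simp add: power_mult_distrib)
    \<comment> \<open>One unit of the rate \<open>pi\<close> pays for the polynomial factor. The
      remaining exponent, at least \<open>2 * (x * y)\<close>, splits into decay in \<open>x\<close>
      and decay in \<open>k\<close>.\<close>
    also have "\<dots> \<le> (fact 2 * exp (x * y)) * exp (- pi * y * x)"
      using x y1 by (intro mult_right_mono power_le_fact_exp) auto
    also have "\<dots> = 2 * exp (- ((pi - 1) * (x * y)))" by (simp add: exp_add[symmetric] algebra_simps)
    also have "\<dots> \<le> 2 * exp (- x + - 1 * (real k + 1))"
    proof -
      have "2 * (x * y) \<le> (pi - 1) * (x * y)" using pi_gt3 x y1 by (intro mult_right_mono) auto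
      moreover have "x * 1 \<le> x * y" using x y1 by (intro mult_left_mono) auto
      moreover have "1 * y \<le> x * y" using x1 y1 by (intro mult_right_mono) auto
      moreover have "- w \<le> - x + - 1 * (real k + 1)" if "2 * z \<le> w" "x * 1 \<le> z" "1 * y \<le> z" for z w
        using that yk by simp
      ultimately have "- ((pi - 1) * (x * y)) \<le> - x + - 1 * (real k + 1)" by blast
      then show ?thesis by simp
    qed
    finally show "x\<^sup>2 * ((real k + 1) ^ 4 * exp (- pi * (real k + 1)\<^sup>2 * x)) \<le> 2 * exp (- x) * exp (- 1 * (real k + 1))"
      unfolding exp_add by (simp add: y_def power_mult[symmetric] mult.assoc)
  qed
  also have "\<dots> = 2 * exp (- x) * ?S" by (rule suminf_mult[OF sS])
  finally show "Psi x \<le> 8 * pi\<^sup>2 * ?S * exp (- x)" by (simp add: mult_ac)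
qed

section \<open>Termwise integration and Mellin transforms\<close>

lemma absolutely_integrable_cong:
  assumes "f absolutely_integrable_on S" "\<And>x. x \<in> S \<Longrightarrow> f x = g x"
  shows "g absolutely_integrable_on S"
proof -
  have "(\<lambda>x. indicator S x *\<^sub>R f x) = (\<lambda>x. indicator S x *\<^sub>R g x)"
    using assms(2) by (auto simp: fun_eq_iff indicator_def)
  then show ?thesis using assms(1) by (simp only: set_integrable_def)
qed

lemma absolutely_integrable_suminf:
  fixes f :: "nat \<Rightarrow> real \<Rightarrow> real"
  assumes S: "S \<in> sets lebesgue"
    and int: "\<And>k. f k absolutely_integrable_on S"
    and nn: "\<And>k x. x \<in> S \<Longrightarrow> f k x \<ge> 0"
    and sm: "\<And>x. x \<in> S \<Longrightarrow> summable (\<lambda>k. f k x)"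
    and sums: "summable (\<lambda>k. integral S (f k))"
  shows "(\<lambda>x. \<Sum>k. f k x) absolutely_integrable_on S"
    and "(\<lambda>k. integral S (f k)) sums integral S (\<lambda>x. \<Sum>k. f k x)"
proof -
  let ?M = "lebesgue_on S"
  have i: "integrable ?M (f k)" for k using absolutely_integrable_imp_integrable[OF int S] .
  have ae: "AE x in ?M. summable (\<lambda>k. norm (f k x))"
    by (rule AE_I2) (use nn sm in \<open>simp add: space_restrict_space abs_of_nonneg\<close>)
  have "(\<integral>x. norm (f k x) \<partial>?M) = integral S (f k)" for k
  proof -
    have "(\<integral>x. norm (f k x) \<partial>?M) = (\<integral>x. f k x \<partial>?M)"
      by (rule Bochner_Integration.integral_cong) (use nn in \<open>auto simp: space_restrict_space\<close>)
    then show ?thesis by (simp add: lebesgue_integral_eq_integral[OF i S])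
  qed
  then have s: "summable (\<lambda>k. \<integral>x. norm (f k x) \<partial>?M)" using sums by simp
  have I: "integrable ?M (\<lambda>x. \<Sum>k. f k x)" by (rule integrable_suminf[OF i ae s])
  show "(\<lambda>x. \<Sum>k. f k x) absolutely_integrable_on S"
    by (rule nonnegative_absolutely_integrable_1[OF integrable_on_lebesgue_on[OF I S]])
       (use nn sm in \<open>auto intro: suminf_nonneg\<close>)
  show "(\<lambda>k. integral S (f k)) sums integral S (\<lambda>x. \<Sum>k. f k x)"
    using sums_integral[OF i ae s] by (simp add: lebesgue_integral_eq_integral[OF _ S] i I)
qed

text \<open>As the terms are nonnegative, the sum \<open>F\<close> dominates each term and each
  partial sum, so its integral bounds the sums of their integrals.\<close>

lemma sums_integral_dominated:
  fixes f :: "nat \<Rightarrow> real \<Rightarrow> real"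
  assumes S: "S \<in> sets lebesgue"
    and meas: "\<And>k. continuous_on S (f k)"
    and nn: "\<And>k x. x \<in> S \<Longrightarrow> f k x \<ge> 0"
    and sums: "\<And>x. x \<in> S \<Longrightarrow> (\<lambda>k. f k x) sums F x"
    and F: "F absolutely_integrable_on S"
  shows "f k absolutely_integrable_on S" and "(\<lambda>k. integral S (f k)) sums integral S F"
proof -
  have Fi: "F integrable_on S" using F by (simp add: absolutely_integrable_on_def)
  have le: "(\<Sum>k<n. f k x) \<le> F x" if "x \<in> S" for x n
    using sum_le_suminf[OF sums_summable[OF sums[OF that]], of "{..<n}"] nn[OF that] sums_unique[OF sums[OF that]] by simp
  have le1: "f k x \<le> F x" if "x \<in> S" for x k
    using sum_le_suminf[OF sums_summable[OF sums[OF that]], of "{k}"] nn[OF that] sums_unique[OF sums[OF that]] by simp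
  have int: "f k absolutely_integrable_on S" for k
  proof (rule measurable_bounded_by_integrable_imp_absolutely_integrable[OF _ S Fi])
    show "f k \<in> borel_measurable (lebesgue_on S)"
      by (rule continuous_imp_measurable_on_sets_lebesgue[OF meas S])
    show "norm (f k x) \<le> F x" if "x \<in> S" for x using nn[OF that] le1[OF that] by simp
  qed
  show "f k absolutely_integrable_on S" by (rule int)
  have inti: "f k integrable_on S" for k using int by (simp add: absolutely_integrable_on_def)
  have "summable (\<lambda>k. integral S (f k))"
  proof (rule summableI_nonneg_bounded)
    show "integral S (f k) \<ge> 0" for k by (rule integral_nonneg[OF inti]) (use nn in auto)
    show "(\<Sum>k<n. integral S (f k)) \<le> integral S F" for n
    proof -
      have "(\<Sum>k<n. integral S (f k)) = integral S (\<lambda>x. \<Sum>k<n. f k x)"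
        by (rule integral_sum[symmetric]) (use inti in auto)
      also have "\<dots> \<le> integral S F"
        by (rule integral_le) (use inti Fi le in \<open>auto intro: integrable_sum\<close>)
      finally show ?thesis .
    qed
  qed
  from absolutely_integrable_suminf(2)[OF S int nn sums_summable[OF sums] this]
  have "(\<lambda>k. integral S (f k)) sums integral S (\<lambda>x. \<Sum>k. f k x)" .
  moreover have "integral S (\<lambda>x. \<Sum>k. f k x) = integral S F"
    by (rule integral_cong) (use sums in \<open>simp add: sums_iff\<close>)
  ultimately show "(\<lambda>k. integral S (f k)) sums integral S F" by simp
qed

lemma powr_exp_integral:
  fixes c l :: real
  assumes c: "c > 0" and l: "l > 0"
  shows "(\<lambda>x. x powr (c - 1) * exp (- l * x)) absolutely_integrable_on {0<..}"
    and "integral {0<..} (\<lambda>x. x powr (c - 1) * exp (- l * x)) = Gamma c / l powr c"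
proof -
  let ?f = "\<lambda>t::real. t powr (c - 1) / exp t"
  have "((\<lambda>t. if t \<in> {0<..} then ?f t else 0) has_integral Gamma c) {0..}"
    by (rule has_integral_spike[of "{0}", rotated 2, OF Gamma_integral_real[OF c]]) auto
  then have G: "(?f has_integral Gamma c) {0<..}" by (subst (asm) has_integral_restrict) auto
  then have abs: "?f absolutely_integrable_on {0<..}"
    by (intro nonnegative_absolutely_integrable_1) (auto simp: integrable_on_def)
  have img: "(\<lambda>x. l * x) ` {0<..} = {0<..}"
  proof safe
    fix x :: real assume "0 < x"
    then show "x \<in> (\<lambda>x. l * x) ` {0<..}" using l by (intro image_eqI[of _ _ "x / l"]) auto
  qed (use l in auto)
  have A: "(\<lambda>x. \<bar>l\<bar> * ?f (l * x)) absolutely_integrable_on {0<..} \<and>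
        integral {0<..} (\<lambda>x. \<bar>l\<bar> * ?f (l * x)) = Gamma c"
    using has_absolute_integral_change_of_variables_1'[of "{0<..}" "\<lambda>x. l * x" "\<lambda>_. l" ?f "Gamma c"]
      abs integral_unique[OF G] l unfolding img
    by (auto intro!: derivative_eq_intros simp: inj_on_def)
  have E: "\<bar>l\<bar> * ?f (l * x) = l powr c * (x powr (c - 1) * exp (- l * x))" if "x \<in> {0<..}" for x
    using l that by (simp add: powr_mult powr_diff exp_minus field_simps)
  have *: "(\<lambda>x. l powr c * (x powr (c - 1) * exp (- l * x))) absolutely_integrable_on {0<..}"
    "integral {0<..} (\<lambda>x. l powr c * (x powr (c - 1) * exp (- l * x))) = Gamma c"
  proof -
    show "(\<lambda>x. l powr c * (x powr (c - 1) * exp (- l * x))) absolutely_integrable_on {0<..}"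
      by (rule absolutely_integrable_cong[OF conjunct1[OF A] E])
    have "integral {0<..} (\<lambda>x. l powr c * (x powr (c - 1) * exp (- l * x))) = integral {0<..} (\<lambda>x. \<bar>l\<bar> * ?f (l * x))"
      by (rule integral_cong) (rule E[symmetric])
    then show "integral {0<..} (\<lambda>x. l powr c * (x powr (c - 1) * exp (- l * x))) = Gamma c"
      by (simp only: conjunct2[OF A])
  qed
  show "(\<lambda>x. x powr (c - 1) * exp (- l * x)) absolutely_integrable_on {0<..}"
    using *(1) l by (subst (asm) set_integrable_mult_right_iff) auto
  show "integral {0<..} (\<lambda>x. x powr (c - 1) * exp (- l * x)) = Gamma c / l powr c"
    using *(2) l by (simp add: field_simps)
qed

text \<open>The weight \<open>x ^ j\<close> shifts the argument of Gamma by \<open>j\<close>, and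
  the additional negative power of \<open>k + 1\<close> cancels the factor
  \<open>(k + 1) ^ (2 * j)\<close>. So all moments lead to the same Dirichlet series.\<close>

lemma theta_mom_Mellin:
  fixes s :: real
  assumes s: "s > 1"
  defines "Z \<equiv> \<Sum>k. (real k + 1) powr (- s)"
  shows "(\<lambda>x. x ^ j * theta_mom j x * x powr (s / 2 - 1)) absolutely_integrable_on {0<..}"
    and "integral {0<..} (\<lambda>x. x ^ j * theta_mom j x * x powr (s / 2 - 1)) = Gamma (s / 2 + real j) / pi powr (s / 2 + real j) * Z"
proof -
  let ?f = "\<lambda>k x. (real k + 1) ^ (2 * j) * (x powr ((s / 2 + real j) - 1) * exp (- (pi * (real k + 1)\<^sup>2) * x))"
  have S: "{0<..} \<in> sets (lebesgue :: real measure)" by simp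
  have l: "pi * (real k + 1)\<^sup>2 > 0" for k by (simp add: add_pos_pos)
  have c: "s / 2 + real j > 0" using s by (simp add: add_pos_nonneg)
  have i: "?f k absolutely_integrable_on {0<..}" for k
    by (intro set_integrable_mult_right powr_exp_integral c l)
  have v: "integral {0<..} (?f k) = Gamma (s / 2 + real j) / pi powr (s / 2 + real j) * (real k + 1) powr (- s)" for k
  proof -
    have "(real k + 1)\<^sup>2 powr (s / 2 + real j) = (real k + 1) powr s * (real k + 1) ^ (2 * j)"
    proof -
      have "(real k + 1)\<^sup>2 = (real k + 1) powr 2" by simp
      then have "(real k + 1)\<^sup>2 powr (s / 2 + real j) = (real k + 1) powr (2 * (s / 2 + real j))"
        by (simp only: powr_powr)
      also have "2 * (s / 2 + real j) = s + real (2 * j)" by simp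
      also have "(real k + 1) powr (s + real (2 * j)) = (real k + 1) powr s * (real k + 1) ^ (2 * j)"
        by (simp only: powr_add) (subst powr_realpow, auto simp: add_pos_pos)
      finally show ?thesis .
    qed
    then have "(pi * (real k + 1)\<^sup>2) powr (s / 2 + real j) = pi powr (s / 2 + real j) * ((real k + 1) powr s * (real k + 1) ^ (2 * j))"
      by (simp add: powr_mult)
    then have "integral {0<..} (?f k) = (real k + 1) ^ (2 * j) * (Gamma (s / 2 + real j) / (pi powr (s / 2 + real j) * ((real k + 1) powr s * (real k + 1) ^ (2 * j))))"
      using powr_exp_integral(2)[OF c l[of k]] by (simp only: integral_mult_right)
    also have "\<dots> = Gamma (s / 2 + real j) / pi powr (s / 2 + real j) * (real k + 1) powr (- s)"
    proof -
      have gen: "p * (g / (q * (r * p))) = g / q * inverse r" if "p \<noteq> 0" for p g q r :: real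
        using that by (simp add: divide_inverse)
      have "real k + 1 \<noteq> 0" by linarith
      then have "(real k + 1) ^ (2 * j) \<noteq> 0" by (rule power_not_zero)
      then show ?thesis unfolding powr_minus by (rule gen)
    qed
    finally show ?thesis .
  qed
  have Zs: "summable (\<lambda>k. (real k + 1) powr (- s))"
    by (rule summable_Suc_powr[OF s])
  have sm: "summable (\<lambda>k. integral {0<..} (?f k))" unfolding v by (intro summable_mult Zs)
  have eq: "(\<lambda>k. ?f k x) sums (x ^ j * theta_mom j x * x powr (s / 2 - 1))" if x: "x \<in> {0<..}" for x
  proof -
    have "(\<lambda>k. x powr (s / 2 + real j - 1) * ((real k + 1) ^ (2 * j) * exp (- pi * (real k + 1)\<^sup>2 * x))) sums
       (x powr (s / 2 + real j - 1) * theta_mom j x)"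
      unfolding theta_mom_def using x by (intro sums_mult summable_sums summable_theta_mom) auto
    moreover have "x powr (s / 2 + real j - 1) = x ^ j * x powr (s / 2 - 1)"
    proof -
      have "s / 2 + real j - 1 = real j + (s / 2 - 1)" by simp
      then show ?thesis using x by (simp only: powr_add powr_realpow greaterThan_iff)
    qed
    ultimately show ?thesis by (simp add: mult_ac)
  qed
  have nn: "?f k x \<ge> 0" for k x by simp
  note A = absolutely_integrable_suminf[OF S i nn sums_summable[OF eq] sm]
  have cong: "(\<Sum>k. ?f k x) = x ^ j * theta_mom j x * x powr (s / 2 - 1)" if "x \<in> {0<..}" for x
    using eq[OF that] by (simp only: sums_iff)
  show "(\<lambda>x. x ^ j * theta_mom j x * x powr (s / 2 - 1)) absolutely_integrable_on {0<..}"
    by (rule absolutely_integrable_cong[OF A(1) cong])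
  have "integral {0<..} (\<lambda>x. x ^ j * theta_mom j x * x powr (s / 2 - 1)) = integral {0<..} (\<lambda>x. \<Sum>k. ?f k x)"
    by (rule integral_cong) (use cong in simp)
  also have "\<dots> = (\<Sum>k. integral {0<..} (?f k))" using A(2) by (simp only: sums_iff)
  also have "\<dots> = Gamma (s / 2 + real j) / pi powr (s / 2 + real j) * Z"
    unfolding v Z_def by (rule suminf_mult[OF Zs])
  finally show "integral {0<..} (\<lambda>x. x ^ j * theta_mom j x * x powr (s / 2 - 1)) = Gamma (s / 2 + real j) / pi powr (s / 2 + real j) * Z" .
qed

text \<open>With \<open>b = s / 2\<close> the recurrence of Gamma reduces the two moments to
  \<open>(4 * (b + 1) - 6) * b = s * (s - 1)\<close>: the kernel itself supplies the polynomial
  factor of the completed zeta function.\<close>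

lemma Psi_Mellin:
  fixes s :: real
  assumes s: "s > 1"
  shows "(\<lambda>x. Psi x * x powr (s / 2 - 1)) absolutely_integrable_on {0<..}"
    and "integral {0<..} (\<lambda>x. Psi x * x powr (s / 2 - 1)) =
           s * (s - 1) * pi powr (- s / 2) * Gamma (s / 2) * (\<Sum>k. (real k + 1) powr (- s))"
proof -
  define Z where "Z = (\<Sum>k. (real k + 1) powr (- s))"
  let ?g = "\<lambda>j x. x ^ j * theta_mom j x * x powr (s / 2 - 1)"
  note M = theta_mom_Mellin[OF s, folded Z_def]
  have M': "?g j integrable_on {0<..}" for j using M(1)[of j] by (simp add: absolutely_integrable_on_def)
  have eq: "(\<lambda>x. Psi x * x powr (s / 2 - 1)) = (\<lambda>x. 4 * pi\<^sup>2 * ?g 2 x - 6 * pi * ?g 1 x)"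
    by (simp add: Psi_def fun_eq_iff algebra_simps)
  show "(\<lambda>x. Psi x * x powr (s / 2 - 1)) absolutely_integrable_on {0<..}"
    unfolding eq using M(1) by (intro set_integral_diff set_integrable_mult_right)
  define b where "b = s / 2"
  have b: "b > 0" using s by (simp add: b_def)
  have nI: "b \<notin> \<int>\<^sub>\<le>\<^sub>0" "b + 1 \<notin> \<int>\<^sub>\<le>\<^sub>0"
    using b by (auto elim!: nonpos_Ints_cases simp del: of_int_add)
  have "integral {0<..} (\<lambda>x. Psi x * x powr (s / 2 - 1)) =
      4 * pi\<^sup>2 * (Gamma (b + 2) / pi powr (b + 2) * Z) - 6 * pi * (Gamma (b + 1) / pi powr (b + 1) * Z)"
    unfolding eq using M'[of 2] M'[of 1] M(2)[of 2] M(2)[of 1]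
    by (subst integral_diff) (auto simp: b_def intro!: integrable_on_mult_right)
  also have "Gamma (b + 2) = (b + 1) * Gamma (b + 1)"
    using Gamma_plus1[OF nI(2)] by (simp add: add.assoc)
  also have "Gamma (b + 1) = b * Gamma b" by (rule Gamma_plus1[OF nI(1)])
  also have "pi powr (b + 2) = pi\<^sup>2 * pi powr b" by (simp add: powr_add)
  also have "pi powr (b + 1) = pi * pi powr b" by (simp add: powr_add)
  also have "4 * pi\<^sup>2 * ((b + 1) * (b * Gamma b) / (pi\<^sup>2 * pi powr b) * Z) - 6 * pi * (b * Gamma b / (pi * pi powr b) * Z) =
      (4 * (b + 1) - 6) * b * Gamma b * Z / pi powr b"
    by (simp add: field_simps)
  also have "\<dots> = s * (s - 1) * pi powr (- s / 2) * Gamma (s / 2) * Z"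
    by (simp add: b_def powr_minus_divide field_simps)
  finally show "integral {0<..} (\<lambda>x. Psi x * x powr (s / 2 - 1)) =
           s * (s - 1) * pi powr (- s / 2) * Gamma (s / 2) * (\<Sum>k. (real k + 1) powr (- s))" by (simp add: Z_def)
qed

section \<open>The kernel on \<open>[1, \<infinity>)\<close> and its moments\<close>

definition xi_kernel :: "real \<Rightarrow> real" where "xi_kernel x = Psi x * x powr (- 3 / 4)"

lemma continuous_on_xi_kernel: "continuous_on {0<..} xi_kernel"
  unfolding xi_kernel_def[abs_def] by (intro continuous_intros continuous_on_Psi) auto

lemma xi_kernel_pos: "x > 0 \<Longrightarrow> xi_kernel x > 0"
  by (simp add: xi_kernel_def Psi_pos)

text \<open>Inversion maps \<open>(0, 1]\<close> to \<open>[1, \<infinity>)\<close>, and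
  \<open>Psi_reciprocal\<close> turns the exponent \<open>s / 2 - 1\<close> into
  \<open>(1 - s) / 2 - 1\<close>. The two exponents are \<open>- 3 / 4\<close> plus and minus
  \<open>(s - 1 / 2) / 2\<close>; hence the exponent in \<open>xi_kernel\<close> and the
  cosh.\<close>

lemma xi_kernel_fold:
  fixes s :: real
  assumes s: "s > 1"
  shows "integral {1..} (\<lambda>x. xi_kernel x * cosh ((s - 1 / 2) * (ln x / 2))) =
           1 / 2 * s * (s - 1) * pi powr (- s / 2) * Gamma (s / 2) * (\<Sum>k. (real k + 1) powr (- s))"
proof -
  let ?f = "\<lambda>x. Psi x * x powr (s / 2 - 1)"
  let ?h = "\<lambda>x. Psi x * x powr (- s / 2 - 1 / 2)"
  have abs: "?f absolutely_integrable_on T" if "T \<subseteq> {0<..}" "T \<in> sets lebesgue" for T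
    using set_integrable_subset[OF Psi_Mellin(1)[OF s] that(2,1)] .
  have img: "(\<lambda>x::real. 1 / x) ` {1..} = {0<..1}"
  proof safe
    fix x :: real assume "x \<in> {0<..1}"
    then show "x \<in> (\<lambda>x. 1 / x) ` {1..}" by (intro image_eqI[of _ _ "1 / x"]) auto
  qed auto
  have der: "((\<lambda>x. 1 / x) has_field_derivative - 1 / x\<^sup>2) (at x within {1..})" if "x \<in> {1..}" for x :: real
    using that by (auto intro!: derivative_eq_intros simp: power2_eq_square)
  have inj: "inj_on (\<lambda>x::real. 1 / x) {1..}" by (auto simp: inj_on_def)
  have "?f absolutely_integrable_on {0<..1}" by (rule abs) auto
  then have "(\<lambda>x. \<bar>- 1 / x\<^sup>2\<bar> * ?f (1 / x)) absolutely_integrable_on {1..} \<and>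
    integral {1..} (\<lambda>x. \<bar>- 1 / x\<^sup>2\<bar> * ?f (1 / x)) = integral {0<..1} ?f"
    using has_absolute_integral_change_of_variables_1'[OF _ der inj, of ?f "integral {0<..1} ?f"]
    unfolding img by simp
  then have A: "(\<lambda>x. \<bar>- 1 / x\<^sup>2\<bar> * ?f (1 / x)) absolutely_integrable_on {1..}"
    "integral {1..} (\<lambda>x. \<bar>- 1 / x\<^sup>2\<bar> * ?f (1 / x)) = integral {0<..1} ?f" by auto
  have hx: "\<bar>- 1 / x\<^sup>2\<bar> * ?f (1 / x) = ?h x" if "x \<in> {1..}" for x
  proof -
    have x: "x > 0" using that by simp
    have "1 / x\<^sup>2 * (sqrt x * (1 / x) powr (s / 2 - 1)) = x powr (- s / 2 - 1 / 2)"
    proof -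
      have "1 / x\<^sup>2 = x powr (- 2)" using x by (simp add: powr_minus_divide)
      moreover have "sqrt x = x powr (1 / 2)" using x by (simp add: powr_half_sqrt)
      moreover have "(1 / x) powr (s / 2 - 1) = x powr (- (s / 2 - 1))" unfolding powr_minus inverse_eq_divide using x by (simp add: powr_divide)
      ultimately show ?thesis by (simp only: powr_add[symmetric]) (rule arg_cong[where f = "(powr) x"], simp add: field_simps)
    qed
    moreover have "\<bar>- 1 / x\<^sup>2\<bar> * ?f (1 / x) = Psi x * (1 / x\<^sup>2 * (sqrt x * (1 / x) powr (s / 2 - 1)))"
      by (simp add: Psi_reciprocal[OF x])
    ultimately show ?thesis by (simp only:)
  qed
  have h: "?h absolutely_integrable_on {1..}" by (rule absolutely_integrable_cong[OF A(1) hx])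
  have h2: "integral {1..} ?h = integral {0<..1} ?f"
    unfolding A(2)[symmetric] by (rule integral_cong) (rule hx[symmetric])
  have sub: "{0<..1} \<subseteq> {0::real<..}" "{1..} \<subseteq> {0::real<..}" by auto
  have fi: "?f integrable_on {0<..1}" "?f integrable_on {1..}" "?h integrable_on {1..}"
    using abs[OF sub(1)] abs[OF sub(2)] h by (auto simp: absolutely_integrable_on_def)
  have "(?f has_integral integral {0<..1} ?f + integral {1..} ?f) ({0<..1} \<union> {1..})"
  proof (rule has_integral_Un)
    have "{0<..1} \<inter> {1..} = {1::real}" by auto
    then show "negligible ({0<..1} \<inter> {1..} :: real set)" by simp
  qed (use fi in \<open>auto simp: has_integral_integral\<close>)
  moreover have "{0<..1} \<union> {1..} = {0::real<..}" by auto
  ultimately have "(?f has_integral integral {0<..1} ?f + integral {1..} ?f) {0<..}" by (simp only:)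
  then have "integral {0<..} ?f = integral {1..} ?h + integral {1..} ?f"
    unfolding h2 by (rule integral_unique)
  also have "\<dots> = integral {1..} (\<lambda>x. ?h x + ?f x)" using fi by (simp add: integral_add)
  also have "\<dots> = integral {1..} (\<lambda>x. 2 * (xi_kernel x * cosh ((s - 1 / 2) * (ln x / 2))))"
  proof (rule integral_cong)
    fix x :: real assume "x \<in> {1..}"
    then have x: "x > 0" by simp
    define e where "e = (s - 1 / 2) / 2"
    have "2 * cosh ((s - 1 / 2) * (ln x / 2)) = x powr e + x powr (- e)"
    proof -
      have ee: "(s - 1 / 2) * (ln x / 2) = e * ln x" by (simp add: e_def)
      show ?thesis unfolding ee using x by (simp add: cosh_field_def powr_def)
    qed
    then have "2 * (xi_kernel x * cosh ((s - 1 / 2) * (ln x / 2))) = Psi x * (x powr (- 3 / 4) * (x powr e + x powr (- e)))"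
      by (simp add: xi_kernel_def)
    also have "x powr (- 3 / 4) * (x powr e + x powr (- e)) = x powr (s / 2 - 1) + x powr (- s / 2 - 1 / 2)"
    proof -
      have "- 3 / 4 + e = s / 2 - 1" "- 3 / 4 + - e = - s / 2 - 1 / 2" by (simp_all add: e_def field_simps)
      then show ?thesis by (simp only: distrib_left powr_add[symmetric])
    qed
    finally show "?h x + ?f x = 2 * (xi_kernel x * cosh ((s - 1 / 2) * (ln x / 2)))" by (simp add: distrib_left)
  qed
  also have "\<dots> = 2 * integral {1..} (\<lambda>x. xi_kernel x * cosh ((s - 1 / 2) * (ln x / 2)))" by simp
  finally show ?thesis using Psi_Mellin(2)[OF s] by simp
qed

text \<open>The coefficient \<open>A_n\<close> of the power series of \<open>f_flat\<close>,
  obtained by expanding the cosh in the integral.\<close>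

definition xi_coeff :: "nat \<Rightarrow> real" where
  "xi_coeff n = integral {1..} (\<lambda>x. xi_kernel x * ((ln x / 2) ^ (2 * n) / fact (2 * n)))"

lemma cosh_sums_even: "(\<lambda>n. t ^ (2 * n) / fact (2 * n)) sums cosh (t::real)"
proof -
  have "(\<lambda>n. ((t ^ n /\<^sub>R fact n) + ((- t) ^ n /\<^sub>R fact n)) / 2) sums ((exp t + exp (- t)) / 2)"
    by (intro sums_divide sums_add exp_converges)
  also have "(\<lambda>n. ((t ^ n /\<^sub>R fact n) + ((- t) ^ n /\<^sub>R fact n)) / 2) = (\<lambda>n. if even n then t ^ n / fact n else 0)"
    by (auto simp: fun_eq_iff field_simps)
  also have "(exp t + exp (- t)) / 2 = cosh t" by (simp add: cosh_field_def)
  finally have "(\<lambda>n. if even n then t ^ n / fact n else 0) sums cosh t" .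
  then have "(\<lambda>n. if even (2 * n) then t ^ (2 * n) / fact (2 * n) else 0) sums cosh t"
    by (subst sums_mono_reindex[where g = "\<lambda>n. 2 * n"]) (auto simp: strict_mono_def elim!: evenE)
  then show ?thesis by simp
qed

lemma cosh_le_exp_abs: "cosh t \<le> exp \<bar>t::real\<bar>"
proof -
  have "exp t \<le> exp \<bar>t\<bar>" "exp (- t) \<le> exp \<bar>t\<bar>" by auto
  then have "exp t + exp (- t) \<le> exp \<bar>t\<bar> + exp \<bar>t\<bar>" by (rule add_mono)
  then show ?thesis by (simp add: cosh_field_def)
qed

lemma xi_kernel_bound: "\<exists>C>0. \<forall>x\<ge>1. xi_kernel x \<le> C * exp (- x)"
proof -
  obtain C where C: "C > 0" "\<And>x. x \<ge> 1 \<Longrightarrow> Psi x \<le> C * exp (- x)" using Psi_le_exp by blast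
  have "xi_kernel x \<le> C * exp (- x)" if "x \<ge> 1" for x
  proof -
    have "x powr (- 3 / 4) \<le> 1" using that powr_mono[of "-3/4" 0 x] by simp
    then have "xi_kernel x \<le> Psi x * 1" unfolding xi_kernel_def using Psi_pos[of x] that by (intro mult_left_mono) auto
    then show ?thesis using C(2)[OF that] by simp
  qed
  then show ?thesis using C(1) by blast
qed

text \<open>For \<open>\<bar>w\<bar> \<le> 2 * k\<close> the cosh is at most \<open>x ^ k\<close>,
  so the integrand is dominated by that of \<open>C * Gamma (k + 1)\<close>. The expansion of cosh
  in even powers has nonnegative terms and may therefore be integrated termwise.\<close>

lemma xi_kernel_cosh:
  fixes w :: real
  shows "(\<lambda>x. xi_kernel x * cosh (w * (ln x / 2))) absolutely_integrable_on {1..}"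
    and "(\<lambda>x. xi_kernel x * ((ln x / 2) ^ (2 * n) / fact (2 * n))) absolutely_integrable_on {1..}"
    and "(\<lambda>n. xi_coeff n * w ^ (2 * n)) sums integral {1..} (\<lambda>x. xi_kernel x * cosh (w * (ln x / 2)))"
    and "(\<And>x. x \<ge> 1 \<Longrightarrow> xi_kernel x \<le> C * exp (- x)) \<Longrightarrow> C > 0 \<Longrightarrow> \<bar>w\<bar> \<le> 2 * real k \<Longrightarrow>
      integral {1..} (\<lambda>x. xi_kernel x * cosh (w * (ln x / 2))) \<le> C * fact k"
proof -
  have S: "{1..} \<in> sets (lebesgue :: real measure)" by simp
  have cK: "continuous_on {1..} xi_kernel" by (rule continuous_on_subset[OF continuous_on_xi_kernel]) auto
  have main: "(\<lambda>x. xi_kernel x * cosh (w * (ln x / 2))) absolutely_integrable_on {1..} \<and>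
     integral {1..} (\<lambda>x. xi_kernel x * cosh (w * (ln x / 2))) \<le> C * fact k"
    if C: "\<And>x. x \<ge> 1 \<Longrightarrow> xi_kernel x \<le> C * exp (- x)" "C > 0" and w: "\<bar>w\<bar> \<le> 2 * real k" for C k and w :: real
  proof -
    let ?g = "\<lambda>x. C * (x powr (real k + 1 - 1) * exp (- 1 * x))"
    have G: "?g absolutely_integrable_on {0<..}"
      by (intro set_integrable_mult_right powr_exp_integral) auto
    have Gv: "integral {0<..} ?g = C * fact k"
      using powr_exp_integral(2)[of "real k + 1" 1] Gamma_fact[of k, where ?'a = real] by (simp add: add.commute)
    have G1: "?g absolutely_integrable_on {1..}" by (rule set_integrable_subset[OF G]) auto
    have le: "xi_kernel x * cosh (w * (ln x / 2)) \<le> ?g x" if "x \<in> {1..}" for x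
    proof -
      have x: "x \<ge> 1" using that by simp
      have "cosh (w * (ln x / 2)) \<le> exp \<bar>w * (ln x / 2)\<bar>" by (rule cosh_le_exp_abs)
      also have "\<bar>w * (ln x / 2)\<bar> = \<bar>w\<bar> * (ln x / 2)" using x by (simp add: abs_mult)
      also have "\<bar>w\<bar> * (ln x / 2) \<le> 2 * real k * (ln x / 2)" using w x by (intro mult_right_mono) auto
      finally have "cosh (w * (ln x / 2)) \<le> x powr (real k)" using x by (simp add: powr_def)
      then have "xi_kernel x * cosh (w * (ln x / 2)) \<le> (C * exp (- x)) * x powr (real k)"
        using C x xi_kernel_pos[of x] by (intro mult_mono) (auto simp: less_imp_le)
      then show ?thesis by (simp add: mult_ac)
    qed
    have ge: "0 \<le> xi_kernel x * cosh (w * (ln x / 2))" if "x \<in> {1..}" for x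
      using xi_kernel_pos[of x] that by (simp add: less_imp_le)
    have I: "(\<lambda>x. xi_kernel x * cosh (w * (ln x / 2))) absolutely_integrable_on {1..}"
    proof (rule measurable_bounded_by_integrable_imp_absolutely_integrable[OF _ S])
      show "(\<lambda>x. xi_kernel x * cosh (w * (ln x / 2))) \<in> borel_measurable (lebesgue_on {1..})"
        by (intro continuous_imp_measurable_on_sets_lebesgue continuous_intros cK) auto
      show "?g integrable_on {1..}" using G1 by (simp add: absolutely_integrable_on_def)
      show "norm (xi_kernel x * cosh (w * (ln x / 2))) \<le> ?g x" if "x \<in> {1..}" for x
        using le[OF that] ge[OF that] by simp
    qed
    have "integral {1..} (\<lambda>x. xi_kernel x * cosh (w * (ln x / 2))) \<le> integral {1..} ?g"
      by (rule integral_le) (use I G1 le in \<open>auto simp: absolutely_integrable_on_def\<close>)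
    also have "\<dots> \<le> integral {0<..} ?g"
      by (rule integral_subset_le) (use G G1 C in \<open>auto simp: absolutely_integrable_on_def less_imp_le\<close>)
    finally show ?thesis using I unfolding Gv by blast
  qed
  show "integral {1..} (\<lambda>x. xi_kernel x * cosh (w * (ln x / 2))) \<le> C * fact k"
    if "\<And>x. x \<ge> 1 \<Longrightarrow> xi_kernel x \<le> C * exp (- x)" "C > 0" "\<bar>w\<bar> \<le> 2 * real k"
    using main[OF that] by blast
  obtain C0 where C0: "C0 > 0" "\<And>x. x \<ge> 1 \<Longrightarrow> xi_kernel x \<le> C0 * exp (- x)" using xi_kernel_bound by blast
  have T: "(\<lambda>x. xi_kernel x * cosh (w * (ln x / 2))) absolutely_integrable_on {1..}" for w :: real
  proof -
    have "\<bar>w\<bar> \<le> 2 * real (nat \<lceil>\<bar>w\<bar>\<rceil>)" by linarith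
    from main[OF C0(2) C0(1) this] show ?thesis by blast
  qed
  then show "(\<lambda>x. xi_kernel x * cosh (w * (ln x / 2))) absolutely_integrable_on {1..}" .
  let ?f = "\<lambda>w n x. xi_kernel x * ((w * (ln x / 2)) ^ (2 * n) / fact (2 * n))"
  have fc: "continuous_on {1..} (?f w n)" for w n
    by (intro continuous_intros cK) auto
  have nn: "0 \<le> ?f w n x" if "x \<in> {1..}" for w n x
    using xi_kernel_pos[of x] that by (simp add: less_imp_le zero_le_even_power)
  have sm: "(\<lambda>n. ?f w n x) sums (xi_kernel x * cosh (w * (ln x / 2)))" for w x
    by (intro sums_mult cosh_sums_even)
  note D = sums_integral_dominated[OF S fc nn sm T]
  show I1: "(\<lambda>x. xi_kernel x * ((ln x / 2) ^ (2 * n) / fact (2 * n))) absolutely_integrable_on {1..}" for n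
    using D(1)[of 1 n] by simp
  have "integral {1..} (?f w n) = xi_coeff n * w ^ (2 * n)" for n
  proof -
    have "?f w n = (\<lambda>x. xi_kernel x * ((ln x / 2) ^ (2 * n) / fact (2 * n)) * w ^ (2 * n))"
      by (simp only: power_mult_distrib) (simp add: fun_eq_iff)
    then show ?thesis unfolding xi_coeff_def by (simp only: integral_mult_left)
  qed
  then show "(\<lambda>n. xi_coeff n * w ^ (2 * n)) sums integral {1..} (\<lambda>x. xi_kernel x * cosh (w * (ln x / 2)))"
    using D(2)[of w] by simp
qed

text \<open>On \<open>[exp 2, exp 3]\<close> the weight \<open>(ln x / 2) ^ (2 * n)\<close> is at
  least 1 for every \<open>n\<close>, and the kernel has a positive minimum. This bound is what
  later excludes \<open>y > 1\<close>.\<close>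

lemma xi_coeff_lower_bound: "\<exists>c>0. \<forall>n. xi_coeff n \<ge> c / fact (2 * n)"
proof -
  let ?I = "{exp 2..exp (3::real)}"
  have sub: "?I \<subseteq> {1..}"
  proof
    fix x assume "x \<in> ?I"
    then have "exp 0 \<le> x" using order.trans[of "exp 0" "exp (2::real)" x] by simp
    then show "x \<in> {1..}" by simp
  qed
  have Ipos: "x > 0" if "x \<in> ?I" for x
  proof -
    have "exp 2 \<le> x" using that by simp
    then show ?thesis using exp_gt_zero[of "2::real"] by linarith
  qed
  have cK: "continuous_on ?I xi_kernel" by (rule continuous_on_subset[OF continuous_on_xi_kernel]) (use Ipos in auto)
  obtain x0 where x0: "x0 \<in> ?I" "\<And>x. x \<in> ?I \<Longrightarrow> xi_kernel x0 \<le> xi_kernel x"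
    using continuous_attains_inf[OF compact_Icc _ cK] by auto
  define c where "c = xi_kernel x0 * (exp 3 - exp 2)"
  have k0: "xi_kernel x0 > 0" using x0(1) Ipos by (intro xi_kernel_pos) blast
  then have "c > 0" by (simp add: c_def)
  moreover have "xi_coeff n \<ge> c / fact (2 * n)" for n
  proof -
    let ?f = "\<lambda>x. xi_kernel x * ((ln x / 2) ^ (2 * n) / fact (2 * n))"
    have I: "?f integrable_on {1..}" using xi_kernel_cosh(2)[of n] by (simp add: absolutely_integrable_on_def)
    have I': "?f integrable_on ?I"
      using set_integrable_subset[OF xi_kernel_cosh(2)[of n] _ sub] by (simp add: absolutely_integrable_on_def)
    have "c / fact (2 * n) = integral ?I (\<lambda>_. xi_kernel x0 / fact (2 * n))"
      by (simp add: c_def)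
    also have "\<dots> \<le> integral ?I ?f"
    proof (rule integral_le[OF _ I'])
      fix x assume x: "x \<in> ?I"
      have "x > 0" using x Ipos by blast
      then have "ln x \<ge> 2" using x by (simp add: ln_ge_iff)
      then have "(ln x / 2) ^ (2 * n) \<ge> 1" by (intro one_le_power) simp
      then have "xi_kernel x0 * 1 \<le> xi_kernel x * (ln x / 2) ^ (2 * n)"
        using x0(2)[OF x] k0 by (intro mult_mono) auto
      then show "xi_kernel x0 / fact (2 * n) \<le> ?f x" by (simp add: divide_right_mono)
    qed auto
    also have "\<dots> \<le> integral {1..} ?f"
      by (rule integral_subset_le[OF sub I' I])
         (use xi_kernel_pos in \<open>auto simp: less_imp_le zero_le_even_power\<close>)
    finally show ?thesis by (simp add: xi_coeff_def)
  qed
  ultimately show ?thesis by blast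
qed

lemma xi_coeff_pos: "xi_coeff n > 0"
proof -
  obtain c where "c > 0" "xi_coeff n \<ge> c / fact (2 * n)" using xi_coeff_lower_bound by blast
  then show ?thesis by (smt (verit) divide_pos_pos fact_gt_zero)
qed

text \<open>A crude bound, from \<open>ln (sqrt k) \<le> sqrt k\<close>. With \<open>k\<close> close
  to \<open>sqrt R\<close> it becomes a multiple of \<open>R powr (3 / 4)\<close>, the source of the
  exponent in the growth estimates.\<close>

lemma ln_fact_le: "ln (fact k) \<le> 2 * (real k) powr (3 / 2)"
proof (cases "k = 0")
  case False
  have "fact k \<le> real k ^ k" using fact_le_power[of k, where ?'a = real] by simp
  then have "ln (fact k) \<le> ln (real k ^ k)" by (subst ln_le_cancel_iff) (use False in auto)
  also have "\<dots> = real k * ln (real k)" using False by (simp add: ln_realpow)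
  also have "ln (real k) = 2 * ln (sqrt (real k))" using False by (simp add: ln_sqrt)
  also have "ln (sqrt (real k)) \<le> sqrt (real k)" using False by (intro less_imp_le ln_less_self) simp
  then have "real k * (2 * ln (sqrt (real k))) \<le> real k * (2 * sqrt (real k))" by (intro mult_left_mono) auto
  also have "real k * (2 * sqrt (real k)) = 2 * (real k) powr (3 / 2)"
  proof -
    have "(real k) powr (3 / 2) = real k powr (1 + 1 / 2)" by simp
    also have "\<dots> = real k * sqrt (real k)" by (simp only: powr_add) (use False in \<open>simp add: powr_half_sqrt\<close>)
    finally show ?thesis by simp
  qed
  finally show ?thesis .
qed simp

lemma xi_coeff_growth:
  "\<exists>C. \<forall>R\<ge>0. summable (\<lambda>n. xi_coeff n * R ^ n) \<and>
      (\<Sum>n. xi_coeff n * R ^ n) \<le> exp (C * (1 + R) powr (3 / 4))"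
proof -
  obtain C0 where C0: "C0 > 0" "\<And>x. x \<ge> 1 \<Longrightarrow> xi_kernel x \<le> C0 * exp (- x)" using xi_kernel_bound by blast
  show ?thesis
  proof (intro exI allI impI conjI)
    fix R :: real assume R: "R \<ge> 0"
    \<comment> \<open>The moments are evaluated at \<open>w = sqrt R\<close>, whose even powers are
      the powers of \<open>R\<close>. Rounding up satisfies \<open>w \<le> 2 * k\<close> and stays
      within 1 of \<open>sqrt R\<close>.\<close>
    define k where "k = nat \<lceil>sqrt R\<rceil>"
    have k1: "\<bar>sqrt R\<bar> \<le> 2 * real k" unfolding k_def using real_sqrt_ge_zero[OF R] by linarith
    have sums: "(\<lambda>n. xi_coeff n * R ^ n) sums integral {1..} (\<lambda>x. xi_kernel x * cosh (sqrt R * (ln x / 2)))"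
      using xi_kernel_cosh(3)[of "sqrt R"] R by (simp add: power_mult)
    then show "summable (\<lambda>n. xi_coeff n * R ^ n)" by (simp add: sums_iff)
    have "(\<Sum>n. xi_coeff n * R ^ n) \<le> C0 * fact k"
      using xi_kernel_cosh(4)[OF C0(2) C0(1) k1] sums by (simp add: sums_iff)
    also have "\<dots> = exp (ln C0 + ln (fact k))" using C0 by (simp add: exp_add)
    also have "ln C0 + ln (fact k) \<le> \<bar>ln C0\<bar> * 1 + 2 * (real k) powr (3 / 2)"
      using ln_fact_le[of k] by linarith
    also have "\<dots> \<le> \<bar>ln C0\<bar> * (1 + R) powr (3 / 4) + 2 * (4 * (1 + R) powr (3 / 4))"
    proof (intro add_mono mult_left_mono)
      show "1 \<le> (1 + R) powr (3 / 4)" using R by (simp add: ge_one_powr_ge_zero)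
      have "real k \<le> sqrt R + 1" unfolding k_def using real_sqrt_ge_zero[OF R] by linarith
      moreover have "sqrt R \<le> sqrt (1 + R)" "1 \<le> sqrt (1 + R)" using R by simp_all
      ultimately have "real k \<le> 2 * sqrt (1 + R)" by linarith
      then have "(real k) powr (3 / 2) \<le> (2 * sqrt (1 + R)) powr (3 / 2)" by (intro powr_mono2) auto
      also have "\<dots> = 2 powr (3 / 2) * (1 + R) powr (3 / 4)"
        using R by (simp add: powr_mult powr_half_sqrt[symmetric] powr_powr)
      also have "2 powr (3 / 2) \<le> (2::real) powr 2" by (intro powr_mono) auto
      finally show "(real k) powr (3 / 2) \<le> 4 * (1 + R) powr (3 / 4)" by (simp add: mult_right_mono)
    qed auto
    finally show "(\<Sum>n. xi_coeff n * R ^ n) \<le> exp ((\<bar>ln C0\<bar> + 8) * (1 + R) powr (3 / 4))"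
      by (simp add: algebra_simps)
  qed
qed

section \<open>The zeta and Xi functions\<close>

definition xi_fps :: "complex fps" where
  "xi_fps = Abs_fps (\<lambda>n. of_real (xi_coeff n))"

definition xi_entire :: "complex \<Rightarrow> complex" where
  "xi_entire s = eval_fps xi_fps ((s - 1 / 2)\<^sup>2)"

lemma entire_fps_xi_fps: "entire_fps xi_fps"
proof (rule entire_fpsI)
  fix R :: real assume R: "R > 0"
  have "summable (\<lambda>n. xi_coeff n * R ^ n)" using xi_coeff_growth R by (metis less_imp_le)
  then obtain K where "\<And>n. norm (xi_coeff n * R ^ n) \<le> K"
    using summable_imp_Bseq[of "\<lambda>n. xi_coeff n * R ^ n"] by (auto simp: Bseq_def)
  then show "\<exists>C. \<forall>n. norm (fps_nth xi_fps n) * R ^ n \<le> C"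
    using R by (intro exI[of _ K]) (auto simp: xi_fps_def norm_mult abs_mult)
qed

lemma holomorphic_eval_fps_entire: "entire_fps F \<Longrightarrow> eval_fps F holomorphic_on S"
  by (intro holomorphic_on_eval_fps) (auto simp: entire_fps_def eball_def)

lemma holomorphic_xi_entire: "xi_entire holomorphic_on S"
proof -
  have "(eval_fps xi_fps \<circ> (\<lambda>s. (s - 1 / 2)\<^sup>2)) holomorphic_on S"
    by (intro holomorphic_on_compose holomorphic_eval_fps_entire entire_fps_xi_fps holomorphic_intros)
  then show ?thesis by (simp add: o_def xi_entire_def[abs_def])
qed

lemma xi_entire_real:
  fixes s :: real
  assumes s: "s > 1"
  shows "xi_entire (of_real s) =
     of_real (1 / 2 * s * (s - 1) * pi powr (- s / 2) * Gamma (s / 2) * (\<Sum>k. (real k + 1) powr (- s)))"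
proof -
  have "(\<lambda>n. xi_coeff n * (s - 1 / 2) ^ (2 * n)) sums
     (1 / 2 * s * (s - 1) * pi powr (- s / 2) * Gamma (s / 2) * (\<Sum>k. (real k + 1) powr (- s)))"
    using xi_kernel_cosh(3)[of "s - 1 / 2"] unfolding xi_kernel_fold[OF s] .
  then have "(\<lambda>n. complex_of_real (xi_coeff n * (s - 1 / 2) ^ (2 * n))) sums
     of_real (1 / 2 * s * (s - 1) * pi powr (- s / 2) * Gamma (s / 2) * (\<Sum>k. (real k + 1) powr (- s)))"
    by (subst sums_of_real_iff)
  moreover have "complex_of_real (xi_coeff n * (s - 1 / 2) ^ (2 * n)) = fps_nth xi_fps n * ((of_real s - 1 / 2)\<^sup>2) ^ n" for n
    by (simp add: xi_fps_def power_mult)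
  ultimately show ?thesis unfolding xi_entire_def eval_fps_def by (simp only: sums_iff)
qed

text \<open>The completed product solved for zeta. Since
  \<open>s / 2 * Gamma (s / 2) = Gamma (s / 2 + 1)\<close> absorbs the factor \<open>s\<close>, and
  \<open>rGamma\<close> is entire, the only division left is by \<open>s - 1\<close>. The value at 1
  copies the convention for \<open>zeta\<close>.\<close>

definition zeta_cont :: "complex \<Rightarrow> complex" where
  "zeta_cont s = (if s = 1 then 0 else xi_entire s * of_real pi powr (s / 2) * rGamma (s / 2 + 1) / (s - 1))"

lemma holomorphic_zeta_cont: "zeta_cont holomorphic_on - {1}"
proof -
  have "(\<lambda>s. xi_entire s * of_real pi powr (s / 2) * rGamma (s / 2 + 1) / (s - 1)) holomorphic_on - {1}"
    by (intro holomorphic_intros holomorphic_xi_entire) auto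
  then show ?thesis by (rule holomorphic_transform) (auto simp: zeta_cont_def)
qed

lemma norm_Suc_powr: "norm (of_nat (Suc n) powr (- s)) = (real n + 1) powr (- Re s)"
  by (subst norm_powr_real_powr) (auto simp: add.commute)

lemma Dirichlet_series_summable: "Re s > 1 \<Longrightarrow> summable (\<lambda>n. of_nat (Suc n) powr (- s) :: complex)"
  by (rule summable_norm_cancel) (simp only: norm_Suc_powr summable_Suc_powr)

lemma Dirichlet_series_holomorphic:
  "(\<lambda>s. \<Sum>n. of_nat (Suc n) powr (- s) :: complex) holomorphic_on {s. Re s > 1}"
proof (rule holomorphic_uniform_sequence)
  show "open {s. Re s > 1}" by (rule open_halfspace_Re_gt)
  show "(\<lambda>s. \<Sum>k<n. of_nat (Suc k) powr (- s)) holomorphic_on {s. Re s > 1}" for n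
    by (intro holomorphic_intros)
  fix z :: complex assume z: "z \<in> {s. Re s > 1}"
  define d where "d = (Re z - 1) / 2"
  have d: "d > 0" "Re z - d > 1" using z by (auto simp: d_def field_simps)
  have Re: "Re w \<ge> Re z - d" if "w \<in> cball z d" for w
    using abs_Re_le_cmod[of "z - w"] that by (simp add: dist_norm)
  have "uniform_limit (cball z d) (\<lambda>n s. \<Sum>k<n. of_nat (Suc k) powr (- s)) (\<lambda>s. \<Sum>k. of_nat (Suc k) powr (- s) :: complex) sequentially"
  proof (rule Weierstrass_m_test)
    show "norm (of_nat (Suc n) powr (- w) :: complex) \<le> (real n + 1) powr (- (Re z - d))" if "w \<in> cball z d" for n w
      unfolding norm_Suc_powr using Re[OF that] by (intro powr_mono) auto
    show "summable (\<lambda>n. (real n + 1) powr (- (Re z - d)))" by (rule summable_Suc_powr[OF d(2)])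
  qed
  moreover have "cball z d \<subseteq> {s. Re s > 1}" using Re d by force
  ultimately show "\<exists>d>0. cball z d \<subseteq> {s. 1 < Re s} \<and>
      uniform_limit (cball z d) (\<lambda>n s. \<Sum>k<n. of_nat (Suc k) powr (- s)) (\<lambda>s. \<Sum>k. of_nat (Suc k) powr (- s)) sequentially"
    using d(1) by blast
qed

lemma Dirichlet_series_real:
  assumes "s > 1"
  shows "(\<Sum>n. of_nat (Suc n) powr (- of_real s) :: complex) = of_real (\<Sum>k. (real k + 1) powr (- s))"
proof -
  have "(of_nat (Suc n) powr (- of_real s) :: complex) = of_real ((real n + 1) powr (- s))" for n
  proof -
    have "(of_nat (Suc n) :: complex) = of_real (real n + 1)" "- of_real s = (of_real (- s) :: complex)" by simp_all
    then show ?thesis by (simp only: powr_of_real)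
  qed
  then show ?thesis by (simp add: suminf_of_real summable_Suc_powr assms)
qed

lemma zeta_cont_real:
  assumes s: "s > 1"
  shows "zeta_cont (of_real s) = of_real (\<Sum>k. (real k + 1) powr (- s))"
proof -
  define Z where "Z = (\<Sum>k. (real k + 1) powr (- s))"
  have "rGamma (complex_of_real s / 2 + 1) = of_real (rGamma (s / 2 + 1))"
    by (simp add: rGamma_complex_of_real[symmetric])
  moreover have "complex_of_real pi powr (of_real s / 2) = of_real (pi powr (s / 2))"
    using powr_of_real[of pi "s / 2"] by simp
  moreover have "of_real s \<noteq> (1::complex)" using s by simp
  ultimately have "zeta_cont (of_real s) =
     of_real (1 / 2 * s * (s - 1) * pi powr (- s / 2) * Gamma (s / 2) * Z * pi powr (s / 2) * rGamma (s / 2 + 1) / (s - 1))"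
    unfolding zeta_cont_def xi_entire_real[OF s] Z_def[symmetric] by simp
  also have "1 / 2 * s * (s - 1) * pi powr (- s / 2) * Gamma (s / 2) * Z * pi powr (s / 2) * rGamma (s / 2 + 1) / (s - 1) = Z"
  proof -
    have nI: "s / 2 \<notin> \<int>\<^sub>\<le>\<^sub>0" using s by (auto dest: nonpos_Ints_nonpos)
    then have "Gamma (s / 2 + 1) = s / 2 * Gamma (s / 2)" by (rule Gamma_plus1)
    then have "rGamma (s / 2 + 1) = inverse (s / 2 * Gamma (s / 2))" by (simp only: rGamma_inverse_Gamma)
    moreover have "Gamma (s / 2) \<noteq> 0" using nI by (simp add: Gamma_eq_zero_iff)
    ultimately have r: "s / 2 * Gamma (s / 2) * rGamma (s / 2 + 1) = 1" using s by simp
    have p: "pi powr (- s / 2) * pi powr (s / 2) = 1" by (simp add: powr_add[symmetric])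
    have gen: "1 / 2 * s * t * a * g * Z * b * c / t = Z * (t / t) * (a * b) * (s / 2 * g * c)"
      for a b c g t :: real by simp
    show ?thesis unfolding gen r p using s by simp
  qed
  finally show ?thesis by (simp only: Z_def)
qed

lemma zeta_cont_sums:
  assumes s: "Re s > 1"
  shows "(\<lambda>n. of_nat (Suc n) powr (- s)) sums zeta_cont s"
proof -
  have "zeta_cont s - (\<Sum>n. of_nat (Suc n) powr (- s)) = 0"
  proof (rule analytic_continuation[where f = "\<lambda>s. zeta_cont s - (\<Sum>n. of_nat (Suc n) powr (- s))" and w = s and S = "{s. Re s > 1}" and U = "of_real ` {1<..}" and \<xi> = 2])
    show "(\<lambda>s. zeta_cont s - (\<Sum>n. of_nat (Suc n) powr (- s))) holomorphic_on {s. Re s > 1}"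
      by (intro holomorphic_intros Dirichlet_series_holomorphic holomorphic_on_subset[OF holomorphic_zeta_cont]) auto
    show "open {s. Re s > 1}" by (rule open_halfspace_Re_gt)
    show "connected {s. Re s > 1}" by (intro convex_connected convex_halfspace_Re_gt)
    show "2 islimpt complex_of_real ` {1<..}"
    proof -
      have "(2::real) islimpt {1<..}" by (rule open_imp_islimpt) auto
      then have "complex_of_real 2 islimpt complex_of_real ` {1<..}"
        unfolding islimpt_approachable
        by (metis dist_of_real image_eqI of_real_eq_iff image_iff)
      then show ?thesis by simp
    qed
    fix z assume "z \<in> complex_of_real ` {1<..}"
    then obtain t where "z = of_real t" "t > 1" by auto
    then show "zeta_cont z - (\<Sum>n. of_nat (Suc n) powr (- z)) = 0"
      using zeta_cont_real Dirichlet_series_real by simp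
  qed (use s in auto)
  then show ?thesis using summable_sums[OF Dirichlet_series_summable[OF s]] by simp
qed

text \<open>\<open>zeta_cont\<close> witnesses existence; uniqueness is the identity theorem on the
  punctured plane, which is connected.\<close>

lemma zeta_eq: "zeta = zeta_cont"
  unfolding zeta_def
proof (rule the_equality, intro conjI allI impI)
  show "zeta_cont 1 = 0" by (simp add: zeta_cont_def)
  fix f assume f: "f holomorphic_on - {1} \<and> (\<forall>s. Re s > 1 \<longrightarrow> (\<lambda>n. of_nat (Suc n) powr (- s)) sums f s) \<and> f 1 = 0"
  show "f = zeta_cont"
  proof
    fix z
    show "f z = zeta_cont z"
    proof (cases "z = 1")
      case False
      show ?thesis
      proof (rule analytic_continuation_open[where f = f and g = zeta_cont and z = z and s = "{s. Re s > 1}" and s' = "- {1}"])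
        show "connected (- {1::complex})" by (simp add: connected_punctured_universe)
        have "2 \<in> {s. Re s > 1}" by simp
        then show "{s. Re s > 1} \<noteq> {}" by blast
        show "f w = zeta_cont w" if "w \<in> {s. Re s > 1}" for w
          using f zeta_cont_sums[of w] that sums_unique2 by blast
      qed (use f False holomorphic_zeta_cont open_halfspace_Re_gt in auto)
    qed (use f in \<open>simp add: zeta_cont_def\<close>)
  qed
qed (use holomorphic_zeta_cont zeta_cont_sums in auto)

lemma Xi_eq: "Xi z = xi_entire (1 / 2 + \<i> * z)"
proof -
  define g where "g = (\<lambda>z. let s = 1 / 2 + \<i> * z in
          1 / 2 * s * (s - 1) * of_real pi powr (- s / 2) * Gamma (s / 2) * zeta s)"
  \<comment> \<open>Where \<open>h\<close> does not vanish, \<open>s\<close> is neither 1 nor a pole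
    of \<open>Gamma (s / 2)\<close>, and the product can be evaluated literally. The zeros of
    \<open>h\<close> are isolated, and \<open>remove_sings\<close> depends only on punctured
    neighbourhoods.\<close>
  define h where "h = (\<lambda>z. (1 / 2 + \<i> * z - 1) * rGamma ((1 / 2 + \<i> * z) / 2))"
  define E where "E = (\<lambda>z. xi_entire (1 / 2 + \<i> * z))"
  have gE: "g w = E w" if "h w \<noteq> 0" for w
  proof -
    define s where "s = 1 / 2 + \<i> * w"
    have "h w = (s - 1) * rGamma (s / 2)" by (simp only: h_def s_def)
    then have s1: "s \<noteq> 1" and r: "rGamma (s / 2) \<noteq> 0" using that by auto
    have nI: "s / 2 \<notin> \<int>\<^sub>\<le>\<^sub>0" using r by (simp add: rGamma_eq_zero_iff)
    then have s0: "s \<noteq> 0" by auto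
    have "s / 2 * rGamma (s / 2 + 1) = rGamma (s / 2)" by (rule rGamma_plus1)
    then have "s / 2 * Gamma (s / 2) * rGamma (s / 2 + 1) = 1"
      using r by (simp add: rGamma_inverse_Gamma mult_ac) (simp add: field_simps)
    moreover have "of_real pi powr (- s / 2) * of_real pi powr (s / 2) = (1::complex)"
      by (simp add: powr_add[symmetric])
    moreover have "g w = (s / 2 * Gamma (s / 2) * rGamma (s / 2 + 1)) * (of_real pi powr (- s / 2) * of_real pi powr (s / 2)) *
        xi_entire s * ((s - 1) / (s - 1))"
      unfolding g_def Let_def s_def[symmetric] zeta_eq zeta_cont_def using s1 by (simp add: mult_ac)
    ultimately have "g w = xi_entire s" using s1 by simp
    then show ?thesis by (simp only: E_def s_def)
  qed
  have "\<forall>\<^sub>F w in at z. h w \<noteq> 0 \<and> w \<in> UNIV"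
  proof (rule non_zero_neighbour_alt)
    show "h holomorphic_on UNIV"
      unfolding h_def by (intro holomorphic_intros) auto
    \<comment> \<open>This point corresponds to \<open>s = 2\<close>, where \<open>h\<close> is
      1.\<close>
    show "h (- (3 / 2) * \<i>) \<noteq> 0" by (simp add: h_def algebra_simps)
  qed auto
  then have "\<forall>\<^sub>F w in at z. g w = E w" by eventually_elim (use gE in auto)
  then have "remove_sings g z = remove_sings E z" by (intro remove_sings_cong) auto
  also have "E holomorphic_on UNIV"
  proof -
    have "(xi_entire \<circ> (\<lambda>z. 1 / 2 + \<i> * z)) holomorphic_on UNIV"
      by (intro holomorphic_on_compose holomorphic_xi_entire holomorphic_intros)
    then show ?thesis by (simp add: E_def o_def)
  qed
  then have "remove_sings E z = E z"
    by (intro remove_sings_at_analytic) (simp add: analytic_on_open holomorphic_on_imp_analytic_at)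
  finally show ?thesis by (simp add: Xi_def g_def E_def)
qed

lemma f_flat_eq: "f_flat = eval_fps xi_fps"
  by (simp add: fun_eq_iff f_flat_def Xi_eq xi_entire_def algebra_simps flip: mult.assoc)

lemma fps_expansion_f_flat: "fps_expansion f_flat 0 = xi_fps"
proof (rule fps_ext)
  fix n
  have "fps_nth xi_fps n = (deriv ^^ n) (eval_fps xi_fps) 0 / fact n"
    using entire_fps_xi_fps by (intro fps_nth_conv_deriv) (simp add: entire_fps_def)
  then show "fps_nth (fps_expansion f_flat 0) n = fps_nth xi_fps n"
    by (simp add: fps_expansion_def f_flat_eq)
qed

section \<open>The supremum \<open>\<Theta>\<close>\<close>

definition xi_norm :: "real \<Rightarrow> complex fps" where
  "xi_norm y = Abs_fps (\<lambda>n. of_real (xi_coeff n / xi_coeff 0 * y ^ (n * (n + 1) div 2)))"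

lemma B_f_flat_nth: "fps_nth (B y f_flat) n = of_real (xi_coeff 0) * fps_nth (xi_norm y) n"
  using xi_coeff_pos[of 0] by (simp add: B_def fps_expansion_f_flat xi_fps_def xi_norm_def)

lemma B_f_flat: "B y f_flat = fps_const (of_real (xi_coeff 0)) * xi_norm y"
  by (rule fps_ext) (simp add: B_f_flat_nth)

lemma entire_fps_B_f_flat: "entire_fps (B y f_flat) \<longleftrightarrow> entire_fps (xi_norm y)"
  using xi_coeff_pos[of 0] unfolding entire_fps_def B_f_flat
  by (simp add: fps_conv_radius_cmult_left)

lemma eval_B_f_flat:
  assumes "entire_fps (xi_norm y)"
  shows "eval_fps (B y f_flat) = (\<lambda>x. of_real (xi_coeff 0) * eval_fps (xi_norm y) x)"
  using assms unfolding B_f_flat entire_fps_def by (simp add: fun_eq_iff eval_fps_mult)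

text \<open>For \<open>y > 1\<close> the quotients of consecutive terms
  \<open>y ^ (n * (n + 1) div 2) / fact (2 * n)\<close> tend to infinity. By
  \<open>xi_coeff_lower_bound\<close> the coefficients then stay away from 0, and the series already
  diverges at 1.\<close>

lemma entire_xi_norm_le_1:
  assumes "entire_fps (xi_norm y)" "y \<ge> 0"
  shows "y \<le> 1"
proof (rule ccontr)
  assume "\<not> y \<le> 1"
  then have y: "y > 1" by simp
  define t where "t = (\<lambda>n. y ^ (n * (n + 1) div 2) / fact (2 * n))"
  have t0: "t n > 0" for n using y by (simp add: t_def)
  have tS: "t (Suc n) = t n * (y ^ Suc n / ((2 * real n + 1) * (2 * real n + 2)))" for n
  proof -
    have "fact (2 * Suc n) = fact (2 * n) * ((2 * real n + 1) * (2 * real n + 2))"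
      by (simp add: algebra_simps)
    then show ?thesis unfolding t_def triangle_Suc power_add by (simp add: mult_ac)
  qed
  have "(\<lambda>n. (2 * real n + 1) * (2 * real n + 2) / y ^ Suc n) \<longlonglongrightarrow> 0" using y by real_asymp
  then have "\<forall>\<^sub>F n in sequentially. (2 * real n + 1) * (2 * real n + 2) / y ^ Suc n < 1"
    by (rule order_tendstoD) simp
  then obtain N where N: "\<And>n. n \<ge> N \<Longrightarrow> (2 * real n + 1) * (2 * real n + 2) / y ^ Suc n < 1"
    by (auto simp: eventually_sequentially)
  have mono: "t n \<ge> t N" if "n \<ge> N" for n
    using that
  proof (induction n rule: dec_induct)
    case (step n)
    have p: "(2 * real n + 1) * (2 * real n + 2) > 0" by (intro mult_pos_pos) auto
    have "(2 * real n + 1) * (2 * real n + 2) < y ^ Suc n" using N[OF step(1)] y by (simp add: field_simps)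
    then have "1 \<le> y ^ Suc n / ((2 * real n + 1) * (2 * real n + 2))" using p by (simp add: less_imp_le)
    then have "t n * 1 \<le> t (Suc n)" unfolding tS using t0[of n] by (intro mult_left_mono) auto
    then show ?case using step.IH by simp
  qed simp
  obtain c where c: "c > 0" "\<And>n. xi_coeff n \<ge> c / fact (2 * n)" using xi_coeff_lower_bound by blast
  have "summable (\<lambda>n. fps_nth (xi_norm y) n * 1 ^ n)"
    using assms(1) by (intro summable_fps) (simp add: entire_fps_def)
  then have "(\<lambda>n. norm (fps_nth (xi_norm y) n)) \<longlonglongrightarrow> 0"
    using summable_LIMSEQ_zero tendsto_norm_zero by fastforce
  then have "\<forall>\<^sub>F n in sequentially. norm (fps_nth (xi_norm y) n) < c * t N / xi_coeff 0"
    by (rule order_tendstoD) (use c(1) t0 xi_coeff_pos in simp)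
  then obtain M where M: "\<And>n. n \<ge> M \<Longrightarrow> norm (fps_nth (xi_norm y) n) < c * t N / xi_coeff 0"
    by (auto simp: eventually_sequentially)
  define n where "n = max M N"
  have "c * t N \<le> c * t n" using mono[of n] c(1) by (simp add: n_def)
  also have "\<dots> = c / fact (2 * n) * y ^ (n * (n + 1) div 2)" by (simp add: t_def)
  also have "\<dots> \<le> xi_coeff n * y ^ (n * (n + 1) div 2)" using c(2) y by (intro mult_right_mono) auto
  finally have "c * t N / xi_coeff 0 \<le> xi_coeff n * y ^ (n * (n + 1) div 2) / xi_coeff 0"
    using xi_coeff_pos[of 0] by (intro divide_right_mono) auto
  moreover have "norm (fps_nth (xi_norm y) n) = xi_coeff n * y ^ (n * (n + 1) div 2) / xi_coeff 0"
    using xi_coeff_pos[of 0] xi_coeff_pos[of n] y by (simp add: xi_norm_def norm_mult norm_divide norm_power)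
  ultimately show False using M[of n] by (simp add: n_def)
qed

lemma xi_norm_negative_zeros_entire:
  assumes ent: "entire_fps (xi_norm y)" and y: "y > 0" and real: "only_real_zeros (eval_fps (xi_norm y))"
  shows "negative_zeros_entire (eval_fps (xi_norm y))"
  unfolding negative_zeros_entire_def
proof (intro conjI)
  show "eval_fps (xi_norm y) holomorphic_on UNIV" by (rule holomorphic_eval_fps_entire[OF ent])
  show "eval_fps (xi_norm y) 0 = 1" using xi_coeff_pos[of 0] by (simp add: eval_fps_at_0 xi_norm_def)
  show "only_negative_zeros (eval_fps (xi_norm y))"
    unfolding only_negative_zeros_def
  proof (intro allI impI)
    fix z assume z: "eval_fps (xi_norm y) z = 0"
    then have "z \<in> \<real>" using real by (auto simp: only_real_zeros_def)
    then obtain t where t: "z = of_real t" by (auto elim: Reals_cases)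
    have "t < 0"
    proof (rule ccontr)
      assume "\<not> t < 0"
      \<comment> \<open>At \<open>t \<ge> 0\<close> all terms of the series are nonnegative and the
        first one is 1, so the sum cannot be 0.\<close>
      define c where "c = (\<lambda>n. xi_coeff n / xi_coeff 0 * y ^ (n * (n + 1) div 2) * t ^ n)"
      have c0: "c n \<ge> 0" for n
        using xi_coeff_pos y \<open>\<not> t < 0\<close> by (simp add: c_def less_imp_le)
      have "(\<lambda>n. fps_nth (xi_norm y) n * z ^ n) sums 0"
        using sums_eval_fps[of z "xi_norm y"] ent z by (simp add: entire_fps_def)
      moreover have "fps_nth (xi_norm y) n * z ^ n = of_real (c n)" for n
        by (simp add: xi_norm_def c_def t)
      ultimately have "c sums 0" using sums_of_real_iff[of c 0, where ?'a = complex] by simp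
      then have "(\<Sum>n\<in>{0}. c n) \<le> 0"
        using sum_le_suminf[of c "{0}"] c0 by (auto simp: sums_iff)
      moreover have "c 0 = 1" using xi_coeff_pos[of 0] by (simp add: c_def)
      ultimately show False by simp
    qed
    then show "z \<in> \<real> \<and> Re z < 0" by (simp add: t)
  qed
qed

text \<open>Entireness forces \<open>y \<le> 1\<close>, so the multipliers are at most 1 and the
  growth of the unmultiplied series carries over.\<close>

lemma xi_norm_growth:
  assumes ent: "entire_fps (xi_norm y)" and y: "y \<ge> 0"
  shows "\<exists>C. \<forall>w. norm (eval_fps (xi_norm y) w) \<le> exp (C * (1 + norm w) powr (3 / 4))"
proof -
  obtain C where C: "\<And>R. R \<ge> 0 \<Longrightarrow> summable (\<lambda>n. xi_coeff n * R ^ n)"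
    "\<And>R. R \<ge> 0 \<Longrightarrow> (\<Sum>n. xi_coeff n * R ^ n) \<le> exp (C * (1 + R) powr (3 / 4))"
    using xi_coeff_growth by blast
  have y1: "y \<le> 1" by (rule entire_xi_norm_le_1[OF ent y])
  have "norm (eval_fps (xi_norm y) w) \<le> exp ((\<bar>ln (xi_coeff 0)\<bar> + C) * (1 + norm w) powr (3 / 4))" for w
  proof -
    let ?R = "norm w"
    have le: "norm (fps_nth (xi_norm y) n * w ^ n) \<le> xi_coeff n * ?R ^ n / xi_coeff 0" for n
    proof -
      have "norm (fps_nth (xi_norm y) n * w ^ n) = xi_coeff n / xi_coeff 0 * y ^ (n * (n + 1) div 2) * ?R ^ n"
        using xi_coeff_pos[of 0] xi_coeff_pos[of n] y by (simp add: xi_norm_def norm_mult norm_divide norm_power)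
      also have "\<dots> \<le> xi_coeff n / xi_coeff 0 * 1 * ?R ^ n"
        using xi_coeff_pos[of 0] xi_coeff_pos[of n] y y1
        by (intro mult_right_mono mult_left_mono power_le_one) (auto simp: less_imp_le)
      finally show ?thesis by simp
    qed
    have sm: "summable (\<lambda>n. xi_coeff n * ?R ^ n / xi_coeff 0)" by (intro summable_divide C) simp
    have "norm (eval_fps (xi_norm y) w) \<le> (\<Sum>n. xi_coeff n * ?R ^ n / xi_coeff 0)"
      unfolding eval_fps_def by (rule norm_suminf_le[OF le sm])
    also have "\<dots> = (\<Sum>n. xi_coeff n * ?R ^ n) / xi_coeff 0" by (rule suminf_divide) (intro C norm_ge_zero)
    also have "\<dots> \<le> exp (C * (1 + ?R) powr (3 / 4)) / xi_coeff 0"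
      using xi_coeff_pos[of 0] by (intro divide_right_mono C) auto
    also have "\<dots> = exp (C * (1 + ?R) powr (3 / 4) - ln (xi_coeff 0))"
      using xi_coeff_pos[of 0] by (simp add: exp_diff)
    also have "\<dots> \<le> exp ((\<bar>ln (xi_coeff 0)\<bar> + C) * (1 + ?R) powr (3 / 4))"
    proof -
      have "1 \<le> (1 + ?R) powr (3 / 4)" by (simp add: ge_one_powr_ge_zero)
      then have "\<bar>ln (xi_coeff 0)\<bar> * 1 \<le> \<bar>ln (xi_coeff 0)\<bar> * (1 + ?R) powr (3 / 4)" by (intro mult_left_mono) auto
      then show ?thesis unfolding exp_le_cancel_iff distrib_right by linarith
    qed
    finally show ?thesis .
  qed
  then show ?thesis by blast
qed

section \<open>The Laguerre property up to the supremum\<close>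

definition Theta_set :: "real set" where
  "Theta_set = {y. y \<ge> 0 \<and> entire_fps (B y f_flat) \<and> only_real_zeros (eval_fps (B y f_flat))}"

lemma q_laguerre_mono:
  assumes "q_laguerre q F" "q \<le> r"
  shows "q_laguerre r F"
proof -
  obtain \<sigma> a where *: "entire_fps F" "\<sigma> \<ge> (0::real)" "\<And>p. a p \<ge> (0::real)" "\<And>p. a (Suc p) \<le> q * a p" "summable a"
    "\<And>x. eval_fps F x = exp (of_real \<sigma> * x) * (\<Prod>p. 1 + of_real (a p) * x)"
    using assms(1) unfolding q_laguerre_def by blast
  have "a (Suc p) \<le> r * a p" for p
    using *(4)[of p] mult_right_mono[OF assms(2) *(3)[of p]] by linarith
  then show ?thesis unfolding q_laguerre_def using * by blast
qed

lemma q_laguerre_xi_norm_0: "q \<ge> 0 \<Longrightarrow> q_laguerre q (xi_norm 0)"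
proof -
  assume q: "q \<ge> 0"
  have "xi_norm 0 = 1"
  proof (rule fps_ext)
    fix n :: nat
    have "n * (n + 1) div 2 > 0" if n: "n > 0"
    proof -
      obtain m where m: "n = Suc m" using n by (cases n) auto
      show ?thesis unfolding m triangle_Suc by simp
    qed
    then show "fps_nth (xi_norm 0) n = fps_nth 1 n" using xi_coeff_pos[of 0]
      by (cases "n = 0") (simp_all add: xi_norm_def power_0_left)
  qed
  then show ?thesis unfolding q_laguerre_def entire_fps_def
    by (intro conjI exI[of _ 0] exI[of _ "\<lambda>_. 0"]) (use q in auto)
qed

lemma Theta_set_factorization:
  assumes "y \<in> Theta_set" "y > 0"
  obtains a where "\<And>p. a p \<ge> (0::real)" "\<And>p. a (Suc p) \<le> a p" "summable a"
    "\<And>x. eval_fps (xi_norm y) x = (\<Prod>p. 1 + of_real (a p) * x)" "entire_fps (xi_norm y)"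
proof -
  have ent: "entire_fps (xi_norm y)" using assms by (simp add: Theta_set_def entire_fps_B_f_flat)
  have "only_real_zeros (eval_fps (xi_norm y))"
    using assms(1) eval_B_f_flat[OF ent] by (simp add: Theta_set_def only_real_zeros_def)
  then have neg: "negative_zeros_entire (eval_fps (xi_norm y))"
    by (rule xi_norm_negative_zeros_entire[OF ent assms(2)])
  obtain C where "\<And>w. norm (eval_fps (xi_norm y) w) \<le> exp (C * (1 + norm w) powr (3 / 4))"
    using xi_norm_growth[OF ent] assms(2) by auto
  from Hadamard_negative_zeros[OF neg this] that ent show ?thesis by blast
qed

lemma q_laguerre_Theta_set:
  assumes "y \<in> Theta_set"
  shows "q_laguerre 1 (xi_norm y)"
proof (cases "y = 0")
  case False
  then have "y > 0" using assms by (simp add: Theta_set_def)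
  from Theta_set_factorization[OF assms this] obtain a where a:
    "\<And>p. a p \<ge> (0::real)" "\<And>p. a (Suc p) \<le> a p" "summable a"
    "\<And>x. eval_fps (xi_norm y) x = (\<Prod>p. 1 + of_real (a p) * x)" "entire_fps (xi_norm y)" by blast
  then show ?thesis unfolding q_laguerre_def
    by (intro conjI exI[of _ 0] exI[of _ a]) auto
qed (simp add: q_laguerre_xi_norm_0)

lemma q_laguerre_below:
  assumes "y1 \<in> Theta_set" "0 \<le> y" "y < y1"
  shows "\<exists>q<1. q_laguerre q (xi_norm y)"
proof (cases "y = 0")
  case True
  then show ?thesis using q_laguerre_xi_norm_0[of "1/2"] by (intro exI[of _ "1/2"]) auto
next
  case False
  define q where "q = y / y1"
  have y1: "y1 > 0" using assms by linarith
  have q: "0 < q" "q < 1" using assms False y1 by (auto simp: q_def)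
  from Theta_set_factorization[OF assms(1) y1] obtain a where a:
    "\<And>p. a p \<ge> (0::real)" "\<And>p. a (Suc p) \<le> a p" "summable a"
    "\<And>x. eval_fps (xi_norm y1) x = (\<Prod>p. 1 + of_real (a p) * x)" "entire_fps (xi_norm y1)" by blast
  have "q_laguerre q (B_fps q (xi_norm y1))" by (rule q_laguerre_B_fps[OF q a(1,2,3,5,4)])
  moreover have "B_fps q (xi_norm y1) = xi_norm y"
  proof (rule fps_ext)
    fix n
    have "y1 * q = y" using y1 by (simp add: q_def)
    then show "fps_nth (B_fps q (xi_norm y1)) n = fps_nth (xi_norm y) n"
      by (simp add: B_fps_def xi_norm_def mult.assoc flip: power_mult_distrib of_real_power of_real_mult)
  qed
  ultimately show ?thesis using q(2) by auto
qed

lemma Theta_eq: "Theta = (SUP y\<in>Theta_set. ereal y)"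
  by (simp add: Theta_def Theta_set_def)

lemma q_laguerre_less_Theta:
  assumes "0 \<le> y" "ereal y < Theta"
  shows "\<exists>q<1. q_laguerre q (xi_norm y)"
proof -
  obtain y1 where "y1 \<in> Theta_set" "ereal y < ereal y1"
    using assms(2) unfolding Theta_eq less_SUP_iff by blast
  then show ?thesis using q_laguerre_below[of y1 y] assms(1) by auto
qed

lemma q_laguerre_le_Theta:
  assumes y: "0 \<le> y" "ereal y \<le> Theta"
  shows "q_laguerre 1 (xi_norm y)"
proof (cases "ereal y < Theta")
  case True
  then show ?thesis using q_laguerre_less_Theta[OF y(1)] q_laguerre_mono[of _ _ 1] less_imp_le by blast
next
  case False
  then have T: "Theta = ereal y" using y(2) by simp
  \<comment> \<open>The supremum is not assumed to be attained, so it is approached by members of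
    the set. These are Laguerre with \<open>q = 1\<close>, and the closure lemma passes this on to
    the limit, including its entireness.\<close>
  have "\<exists>z\<in>Theta_set. y - inverse (real (Suc k)) < z" for k
  proof -
    have "ereal (y - inverse (real (Suc k))) < (SUP y\<in>Theta_set. ereal y)"
      unfolding Theta_eq[symmetric] T by simp
    then show ?thesis unfolding less_SUP_iff by auto
  qed
  then obtain z where z: "\<And>k. z k \<in> Theta_set" "\<And>k. y - inverse (real (Suc k)) < z k" by metis
  have zy: "z k \<le> y" for k
  proof -
    have "ereal (z k) \<le> Theta" unfolding Theta_eq by (rule SUP_upper[OF z(1)])
    then show ?thesis by (simp add: T)
  qed
  have zlim: "z \<longlonglongrightarrow> y"
  proof (rule tendsto_sandwich)
    have "(\<lambda>k. y - inverse (real (Suc k))) \<longlonglongrightarrow> y - 0" by (intro tendsto_intros LIMSEQ_inverse_real_of_nat)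
    then show "(\<lambda>k. y - inverse (real (Suc k))) \<longlonglongrightarrow> y" by simp
    show "\<forall>\<^sub>F k in sequentially. y - inverse (real (Suc k)) \<le> z k"
      using z(2) by (intro always_eventually allI less_imp_le)
  qed (use zy in auto)
  show ?thesis
  proof (rule q_laguerre_closed[OF order_refl q_laguerre_Theta_set[OF z(1)]])
    show "(\<lambda>k. fps_nth (xi_norm (z k)) n) \<longlonglongrightarrow> fps_nth (xi_norm y) n" for n
      unfolding xi_norm_def fps_nth_Abs_fps by (intro tendsto_intros zlim)
  qed
qed

theorem corollary6p2:
  shows "(\<forall>y::real. 0 \<le> y \<and> ereal y \<le> Theta \<longrightarrow>
            entire_fps (B y f_flat) \<and> L1 (eval_fps (B y f_flat)) \<and>
            only_negative_zeros (eval_fps (B y f_flat))) \<and>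
         (\<forall>y::real. 0 \<le> y \<and> ereal y < Theta \<longrightarrow>
            only_simple_zeros (eval_fps (B y f_flat))) \<and>
         (riemann_hypothesis \<longrightarrow>
            (\<forall>y\<in>{0<..<1::real}. only_simple_zeros (eval_fps (B y f_flat))))"
proof -
  have A0: "xi_coeff 0 > 0" by (rule xi_coeff_pos)
  have 1: "entire_fps (B y f_flat) \<and> L1 (eval_fps (B y f_flat)) \<and> only_negative_zeros (eval_fps (B y f_flat))"
    if y: "0 \<le> y" "ereal y \<le> Theta" for y
  proof -
    have q: "q_laguerre 1 (xi_norm y)" by (rule q_laguerre_le_Theta[OF y])
    then obtain \<sigma> a where a: "entire_fps (xi_norm y)" "\<sigma> \<ge> (0::real)" "\<And>p. a p \<ge> (0::real)" "summable a"
      "\<And>x. eval_fps (xi_norm y) x = exp (of_real \<sigma> * x) * (\<Prod>p. 1 + of_real (a p) * x)"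
      unfolding q_laguerre_def by blast
    have "L1 (eval_fps (B y f_flat))"
      unfolding L1_def eval_B_f_flat[OF a(1)]
      by (intro exI[of _ "xi_coeff 0"] exI[of _ \<sigma>] exI[of _ 0] exI[of _ a])
         (use A0 a in \<open>auto simp: mult.assoc\<close>)
    moreover have "only_negative_zeros (eval_fps (B y f_flat))"
      using q_laguerre_negative_zeros[OF q] A0 unfolding only_negative_zeros_def eval_B_f_flat[OF a(1)] by simp
    ultimately show ?thesis using a(1) by (simp add: entire_fps_B_f_flat)
  qed
  have 2: "only_simple_zeros (eval_fps (B y f_flat))" if y: "0 \<le> y" "ereal y < Theta" for y
  proof -
    obtain q where q: "q < 1" "q_laguerre q (xi_norm y)" using q_laguerre_less_Theta[OF y] by blast
    then have "entire_fps (xi_norm y)" by (simp add: q_laguerre_def)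
    then show ?thesis
      using q_laguerre_simple_zeros[OF q, of "of_real (xi_coeff 0)"] A0 by (simp add: eval_B_f_flat)
  qed
  have 3: "ereal 1 \<le> Theta" if riemann_hypothesis
  proof -
    \<comment> \<open>\<open>B 1\<close> leaves the series unchanged, so it suffices that
      \<open>f_flat\<close> has only real zeros: if \<open>z\<close> is one, then \<open>- z\<close>
      is the square of a zero of \<open>Xi\<close>.\<close>
    have B1: "B 1 f_flat = xi_fps" by (rule fps_ext) (simp add: B_def fps_expansion_f_flat)
    have "only_real_zeros f_flat"
      unfolding only_real_zeros_def
    proof (intro allI impI)
      fix z assume "f_flat z = 0"
      then have "Xi (- \<i> * csqrt z) = 0" by (simp only: f_flat_def)
      then have "- \<i> * csqrt z \<in> \<real>" using that unfolding riemann_hypothesis_def by blast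
      then have "(- \<i> * csqrt z)\<^sup>2 \<in> \<real>" by (rule Reals_power)
      then have "- z \<in> \<real>" by (simp add: power_mult_distrib)
      then show "z \<in> \<real>" using Reals_minus[of "- z"] by simp
    qed
    then have "1 \<in> Theta_set"
      by (simp add: Theta_set_def B1 entire_fps_xi_fps flip: f_flat_eq)
    then show ?thesis unfolding Theta_eq by (rule SUP_upper)
  qed
  show ?thesis using 1 2 3 less_le_trans[of "ereal _" "ereal 1" Theta] by auto
qed

end
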